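(* Let $\mu$ be the self-affine measure associated with an affinely irreducible integral affine IFS $\Phi=\{Ax+a_\ell\}_{\ell=1}^m$ on $\mathbb{R}^d$ and a strictly positive probability vector $\boldsymbol{p}=(p_\ell)_{\ell=1}^m$. Then the following conditions are equivalent: (i) $\mu$ is absolutely continuous with respect to the Lebesgue measure $\mathcal{L}^d$; (ii) $\mu$ has power Fourier decay; (iii) $\tau_A(\mu,2)=d$.
   Context: An integral affine IFS on $\mathbb{R}^d$ is a finite family $\Phi=\{\phi_\ell(x)=Ax+a_\ell\}_{\ell=1}^m$ with $A\in GL_d(\mathbb{R})$ of spectral radius less than $1$, $A^{-1}$ an integer matrix, and $a_\ell\in\mathbb{Z}^d$ for all $\ell$. It is affinely irreducible if there is no proper affine subspace $V$ of $\mathbb{R}^d$ with $\phi_\ell(V)=V$ for all $\ell$. The self-affine measure associated with $\Phi$ and a probability vector $\boldsymbol{p}=(p_\ell)_{\ell=1}^m$ is the unique Borel probability measure $\mu$ on $\mathbb{R}^d$ with $\mu=\sum_{\ell=1}^m p_\ell\,\mu\circ\phi_\ell^{-1}$. With $\widehat\mu(\xi)=\int e^{2\pi i\langle\xi,x\rangle}d\mu(x)$, $\mu$ has power Fourier decay if there is $\alpha>0$ with $|\widehat\mu(\xi)|=O(|\xi|^{-\alpha})$ as $|\xi|\to\infty$. For a compactly supported Borel probability measure $\nu$ on $\mathbb{R}^d$, $A\in GL_d(\mathbb{R})$ of spectral radius strictly less than $1$, and $q>0$, the $L^{(A,q)}$-dimension of $\nu$ is $$\tau_A(\nu,q)=\liminf_{n\to\infty}\frac{d}{n\log|\det(A)|}\log\Big(\sum_{Q\in\mathcal{D}}\nu(A^nQ)^q\Big),$$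 where $\mathcal{D}=\{[0,1)^d+z: z\in\mathbb{Z}^d\}$. *)

theory Defs
  imports "HOL-Probability.Probability" "HOL-Library.Landau_Symbols"
begin

(* A real matrix may have non-real eigenvalues, so eigenvectors are taken in complex space. *)
definition complex_spectrum :: "real^'n^'n \<Rightarrow> complex set" where
  "complex_spectrum A =
     {z. \<exists>v::complex^'n. v \<noteq> 0 \<and> map_matrix complex_of_real A *v v = z *s v}"

definition matrix_spectral_radius :: "real^'n^'n \<Rightarrow> real" where
  "matrix_spectral_radius A = Max (cmod ` complex_spectrum A)"

definition ifs_map :: "real^'n^'n \<Rightarrow> (nat \<Rightarrow> real^'n) \<Rightarrow> nat \<Rightarrow> real^'n \<Rightarrow> real^'n" where
  "ifs_map A a l x = A *v x + a l"

(* The family is indexed by l = 1, ..., m; values of a outside {1..m} are irrelevant. *)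
definition integral_affine_ifs :: "real^'n^'n \<Rightarrow> nat \<Rightarrow> (nat \<Rightarrow> real^'n) \<Rightarrow> bool" where
  "integral_affine_ifs A m a \<longleftrightarrow>
     invertible A \<and> matrix_spectral_radius A < 1 \<and>
     (\<forall>i j. matrix_inv A $ i $ j \<in> \<int>) \<and>
     (\<forall>l\<in>{1..m}. \<forall>i. a l $ i \<in> \<int>)"

(* The library predicate affine holds of the empty set, which is not an affine subspace here. *)
definition affinely_irreducible :: "real^'n^'n \<Rightarrow> nat \<Rightarrow> (nat \<Rightarrow> real^'n) \<Rightarrow> bool" where
  "affinely_irreducible A m a \<longleftrightarrow>
     \<not> (\<exists>V. affine V \<and> V \<noteq> {} \<and> V \<noteq> UNIV \<and> (\<forall>l\<in>{1..m}. ifs_map A a l ` V = V))"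

definition strictly_positive_probability_vector :: "nat \<Rightarrow> (nat \<Rightarrow> real) \<Rightarrow> bool" where
  "strictly_positive_probability_vector m p \<longleftrightarrow> (\<forall>l\<in>{1..m}. 0 < p l) \<and> (\<Sum>l=1..m. p l) = 1"

(* For a contracting A and a probability vector p, exactly one measure satisfies this. *)
definition is_self_affine_measure ::
    "real^'n^'n \<Rightarrow> nat \<Rightarrow> (nat \<Rightarrow> real^'n) \<Rightarrow> (nat \<Rightarrow> real) \<Rightarrow> (real^'n) measure \<Rightarrow> bool" where
  "is_self_affine_measure A m a p \<mu> \<longleftrightarrow>
     prob_space \<mu> \<and> sets \<mu> = sets borel \<and>
     (\<forall>B\<in>sets borel. measure \<mu> B = (\<Sum>l=1..m. p l * measure \<mu> (ifs_map A a l -` B)))"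

definition fourier_transform :: "(real^'n) measure \<Rightarrow> real^'n \<Rightarrow> complex" where
  "fourier_transform \<mu> \<xi> = (LINT x|\<mu>. exp (2 * complex_of_real pi * \<i> * complex_of_real (\<xi> \<bullet> x)))"

definition power_fourier_decay :: "(real^'n) measure \<Rightarrow> bool" where
  "power_fourier_decay \<mu> \<longleftrightarrow>
     (\<exists>\<alpha>>0. (\<lambda>\<xi>. cmod (fourier_transform \<mu> \<xi>)) \<in> O[at_infinity](\<lambda>\<xi>. norm \<xi> powr (- \<alpha>)))"

definition unit_cubes :: "(real^'n) set set" where
  "unit_cubes = {(+) z ` {x. \<forall>i. 0 \<le> x $ i \<and> x $ i < 1} | z. \<forall>i. z $ i \<in> \<int>}"

(* The n-th power of A is expressed by iterating x |-> A x, because the operation ^ on the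
   type real^'n^'n is the entrywise power.  For compactly supported \<nu> only finitely many
   terms of the sum are nonzero (note 0 powr q = 0).  The term n = 0 is immaterial.
   The lower limit is taken in the extended reals. *)
definition LAq_dimension :: "real^'n^'n \<Rightarrow> (real^'n) measure \<Rightarrow> real \<Rightarrow> ereal" where
  "LAq_dimension A \<nu> q =
     liminf (\<lambda>n. ereal (real CARD('n) / (real n * ln \<bar>det A\<bar>) *
       ln (\<Sum>\<^sub>\<infinity>Q\<in>unit_cubes. measure \<nu> (((*v) A ^^ n) ` Q) powr q)))"

end

theory Submission
  imports Defs "HOL-Computational_Algebra.Fundamental_Theorem_Algebra"
begin

text \<open>
  Let \<open>M\<close> be the inverse transpose of \<open>A\<close>, an expanding integer matrix. Since the translations are
  integral, the refinement equation for the Fourier transform shows that it takes the same value at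
  \<open>k\<close> and at \<open>M\<^sup>n k\<close> for every lattice point \<open>k\<close>. All three conditions are equivalent to the vanishing
  of the Fourier transform at the nonzero lattice points.

  Decay along \<open>M\<^sup>n k\<close>, as given by the Riemann-Lebesgue lemma or by (ii), forces the value at \<open>k\<close> to
  be \<open>0\<close>. Conversely, vanishing means that \<open>\<mu>\<close> projects to Haar measure on the torus, so \<open>\<mu>\<close> has a
  density \<open>f \<le> 1\<close>, which gives (i) and, by counting cubes, (iii). The autocorrelation \<open>\<Phi>\<close> of \<open>f\<close>
  satisfies a refinement equation with finitely many terms; hence \<open>\<Phi>(A\<^sup>n h) - \<Phi>(0)\<close> satisfies a linear
  recurrence in \<open>n\<close> which is independent of \<open>h\<close>, and as it tends to \<open>0\<close> it does so exponentially and
  uniformly in \<open>h\<close>. Thus translates of \<open>f\<close> by \<open>A\<^sup>n h\<close> are exponentially close to \<open>f\<close> in \<open>L\<^sup>1\<close>, which is (ii).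

  Finally, if the Fourier transform does not vanish at some lattice point \<open>k\<^sub>0 \<noteq> 0\<close>, it is bounded
  below in a multiplicative way at the points \<open>\<Sum>\<^sub>i \<epsilon>\<^sub>i M\<^bsup>iN\<^esup> k\<^sub>0\<close> with digits \<open>\<epsilon>\<^sub>i \<in> {0, 1}\<close>. The sum of its
  squared modulus over these points grows exponentially, and by Bessel's inequality this contradicts (iii).
\<close>

section \<open>Linear recurrences\<close>

text \<open>The autocorrelation enters because \<open>\<Phi> 0 - \<Phi> t\<close> is half the
  squared L2 distance between \<open>f\<close> and its translate by \<open>t\<close>: one scalar
  recurrence then measures the smoothness of \<open>f\<close>, and as the support is bounded, L2
  closeness gives L1 closeness. The orbit is matched to the frequency: for every large
  \<open>\<xi>\<close> there are \<open>n\<close>, at least a multiple of \<open>ln |\<xi>|\<close>,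
  and \<open>h\<close> in a fixed ball with \<open>\<xi> \<bullet> A^n h = 1/2\<close>. Translation
  by such a half period flips the sign of the character, so a rate exponential in \<open>n\<close>
  becomes a power of \<open>|\<xi>|\<close>. This is why the constants of the recurrence must not
  depend on \<open>h\<close>. For (iii), the sum of the squared masses of the cells is always at
  least a constant times \<open>|det A|^n\<close>, and the limit inferior drops below
  \<open>d\<close> as soon as this is exceeded by an exponential factor along a subsequence. Each
  digit supplies a factor \<open>1 + c^2 / 2\<close> with \<open>c = |ft k0|\<close>: the digit 0
  contributes nearly \<open>|ft 0|^2 = 1\<close> and the digit 1 nearly \<open>c^2\<close>.\<close>

lemma nontrivial_relation:
  fixes u :: "'i \<Rightarrow> 'z \<Rightarrow> 'a::field"
  assumes "finite Z" "finite I" "card Z < card I"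
  shows "\<exists>\<alpha>. (\<exists>i\<in>I. \<alpha> i \<noteq> 0) \<and> (\<forall>z\<in>Z. (\<Sum>i\<in>I. \<alpha> i * u i z) = 0)"
  using assms
proof (induction Z arbitrary: I u rule: finite_induct)
  case empty
  then obtain i where "i \<in> I" by (metis card_gt_0_iff equals0I card.empty)
  then show ?case by (intro exI[of _ "\<lambda>_. 1"]) auto
next
  case (insert z Z)
  show ?case
  proof (cases "\<forall>i\<in>I. u i z = 0")
    case True
    from insert.prems insert.hyps have "card Z < card I" by simp
    from insert.IH[OF insert.prems(1) this, of u] True show ?thesis by auto
  next
    case False
    then obtain i0 where i0: "i0 \<in> I" "u i0 z \<noteq> 0" by blast
    \<comment> \<open>Gaussian elimination: subtracting multiples of the vector \<open>i0\<close>
      clears the entry at \<open>z\<close> from all others, and the induction hypothesis relates the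
      cleared vectors on \<open>Z\<close>. In \<open>\<beta>\<close> the coefficient of
      \<open>i0\<close> collects the subtracted multiples.\<close>
    define J where "J = I - {i0}"
    have J: "finite J" "card Z < card J" "i0 \<notin> J" "I = insert i0 J"
      using insert.prems insert.hyps i0 by (auto simp: J_def)
    obtain \<alpha> j where \<alpha>: "j \<in> J" "\<alpha> j \<noteq> 0"
      "\<forall>w\<in>Z. (\<Sum>i\<in>J. \<alpha> i * (u i w - u i z / u i0 z * u i0 w)) = 0"
      using insert.IH[OF J(1,2), of "\<lambda>i w. u i w - u i z / u i0 z * u i0 w"] by auto
    define \<beta> where "\<beta> i = (if i = i0 then - (\<Sum>i\<in>J. \<alpha> i * u i z) / u i0 z else \<alpha> i)" for i
    have \<beta>: "(\<Sum>i\<in>I. \<beta> i * u i w) = - (\<Sum>i\<in>J. \<alpha> i * u i z) / u i0 z * u i0 w + (\<Sum>i\<in>J. \<alpha> i * u i w)" for w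
    proof -
      have "(\<Sum>i\<in>J. \<beta> i * u i w) = (\<Sum>i\<in>J. \<alpha> i * u i w)"
        using J(3) by (intro sum.cong) (auto simp: \<beta>_def)
      then show ?thesis using J by (simp add: \<beta>_def)
    qed
    have "(\<Sum>i\<in>I. \<beta> i * u i w) = 0" if "w \<in> insert z Z" for w
    proof (cases "w = z")
      case True
      then show ?thesis using i0 by (simp add: \<beta>)
    next
      case False
      then have "(\<Sum>i\<in>J. \<alpha> i * (u i w - u i z / u i0 z * u i0 w)) = 0" using \<alpha> that by blast
      moreover have "(\<Sum>i\<in>J. \<alpha> i * (u i w - u i z / u i0 z * u i0 w)) = (\<Sum>i\<in>I. \<beta> i * u i w)"
        unfolding \<beta> by (simp add: right_diff_distrib sum_subtractf sum_distrib_left sum_distrib_right sum_divide_distrib mult_ac)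
      ultimately show ?thesis by simp
    qed
    moreover have "\<beta> j \<noteq> 0" "j \<in> I" using \<alpha> J by (auto simp: \<beta>_def)
    ultimately show ?thesis by blast
  qed
qed

text \<open>The polynomial \<open>p\<close> acts on sequences with the indeterminate acting as the shift.\<close>

definition shift_apply :: "complex poly \<Rightarrow> (nat \<Rightarrow> complex) \<Rightarrow> nat \<Rightarrow> complex" where
  "shift_apply p c n = (\<Sum>i\<le>degree p. coeff p i * c (n + i))"

lemma shift_apply_eq: "degree p \<le> N \<Longrightarrow> shift_apply p c n = (\<Sum>i\<le>N. coeff p i * c (n + i))"
  unfolding shift_apply_def by (rule sum.mono_neutral_left) (auto simp: coeff_eq_0)

text \<open>A product of polynomials acts as the composition of their actions. Splitting off a root
  \<open>\<nu>\<close> therefore lowers the order of a recurrence by one, at the price of passing to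
  the sequence \<open>c (Suc k) - \<nu> * c k\<close>.\<close>

lemma shift_apply_linear_factor_mult:
  "shift_apply ([:-\<nu>, 1:] * q) c n = shift_apply q (\<lambda>k. c (Suc k) - \<nu> * c k) n"
proof -
  let ?N = "degree q"
  have deg: "degree ([:-\<nu>, 1:] * q) \<le> Suc ?N"
    by (rule order.trans[OF degree_mult_le]) simp
  have co: "coeff ([:-\<nu>, 1:] * q) i = (case i of 0 \<Rightarrow> 0 | Suc j \<Rightarrow> coeff q j) - \<nu> * coeff q i" for i
    by (simp add: coeff_pCons split: nat.split)
  have "shift_apply ([:-\<nu>, 1:] * q) c n
      = (\<Sum>i\<le>Suc ?N. (case i of 0 \<Rightarrow> 0 | Suc j \<Rightarrow> coeff q j) * c (n + i)) - (\<Sum>i\<le>Suc ?N. \<nu> * coeff q i * c (n + i))"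
    unfolding shift_apply_eq[OF deg] co by (simp only: left_diff_distrib sum_subtractf)
  also have "(\<Sum>i\<le>Suc ?N. (case i of 0 \<Rightarrow> 0 | Suc j \<Rightarrow> coeff q j) * c (n + i)) = (\<Sum>i\<le>?N. coeff q i * c (Suc (n + i)))"
    by (subst sum.atMost_Suc_shift) simp
  also have "(\<Sum>i\<le>Suc ?N. \<nu> * coeff q i * c (n + i)) = (\<Sum>i\<le>?N. coeff q i * (\<nu> * c (n + i)))"
    by (simp add: coeff_eq_0 mult_ac)
  finally show ?thesis
    by (simp add: shift_apply_def right_diff_distrib sum_subtractf)
qed

lemma poly_linear_factorE:
  fixes p :: "complex poly"
  assumes "degree p > 0"
  obtains \<nu> q where "p = [:-\<nu>, 1:] * q" "degree p = Suc (degree q)" "poly p \<nu> = 0"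
proof -
  have "\<not> constant (poly p)" using assms by (simp add: constant_degree)
  then obtain \<nu> where \<nu>: "poly p \<nu> = 0" using fundamental_theorem_of_algebra by blast
  then obtain q where q: "p = [:-\<nu>, 1:] * q" by (metis dvdE poly_eq_0_iff_dvd)
  have "q \<noteq> 0" using assms q by auto
  then have "degree p = Suc (degree q)" unfolding q by (subst degree_mult_eq) auto
  with q \<nu> show thesis using that by blast
qed

lemma shift_apply_degree_0:
  assumes "p \<noteq> 0" "degree p = 0" "\<forall>n. shift_apply p c n = 0"
  shows "c n = 0"
  using assms leading_coeff_0_iff[of p] by (auto simp: shift_apply_def)

text \<open>The last condition on \<open>C\<close> amounts to
  \<open>cmod \<mu> * C + E \<le> C * r\<close>, so \<open>C * r ^ n\<close> is a supersolution of
  the recurrence.\<close>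

lemma first_order_recurrence_bound:
  fixes c d :: "nat \<Rightarrow> complex"
  assumes "\<And>n. c (Suc n) = \<mu> * c n + d n" "cmod \<mu> < r" "0 < r"
    and "\<And>n. cmod (d n) \<le> E * r ^ n" "cmod (c 0) \<le> C" "E / (r - cmod \<mu>) \<le> C"
  shows "cmod (c n) \<le> C * r ^ n"
proof (induction n)
  case 0
  then show ?case using assms by simp
next
  case (Suc n)
  have "cmod (c (Suc n)) \<le> cmod \<mu> * cmod (c n) + cmod (d n)"
    unfolding assms(1)[of n] by (metis norm_mult norm_triangle_ineq)
  also have "\<dots> \<le> cmod \<mu> * (C * r ^ n) + E * r ^ n"
    using Suc.IH assms(4) by (intro add_mono mult_left_mono) auto
  also have "\<dots> = (cmod \<mu> * C + E) * r ^ n" by (simp add: algebra_simps)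
  also have "\<dots> \<le> (C * r) * r ^ n"
  proof (rule mult_right_mono)
    have "E \<le> C * (r - cmod \<mu>)" using assms(2,6) by (simp add: pos_divide_le_eq)
    then show "cmod \<mu> * C + E \<le> C * r" by (simp add: algebra_simps)
  qed (use assms in auto)
  finally show ?case by simp
qed

text \<open>Roots are split off one at a time. The constant depends on the sequence
  \<open>c\<close>; this suffices for the iterates of a matrix, where only the finitely many basis
  vectors matter in the end.\<close>

lemma recurrence_roots_decay:
  assumes "p \<noteq> 0" "\<forall>\<nu>. poly p \<nu> = 0 \<longrightarrow> cmod \<nu> < r" "0 < r" "\<forall>n. shift_apply p c n = 0"
  shows "\<exists>C. \<forall>n. cmod (c n) \<le> C * r ^ n"
  using assms
proof (induction "degree p" arbitrary: p c)
  case 0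
  then have "c n = 0" for n using shift_apply_degree_0[of p c n] by simp
  then show ?case by (intro exI[of _ 0]) auto
next
  case (Suc k)
  then have "degree p > 0" by simp
  then obtain \<nu> q where q: "p = [:-\<nu>, 1:] * q" "degree p = Suc (degree q)" "poly p \<nu> = 0"
    by (rule poly_linear_factorE)
  have \<nu>: "cmod \<nu> < r" using Suc.prems q by blast
  define d where "d n = c (Suc n) - \<nu> * c n" for n
  have "\<exists>C. \<forall>n. cmod (d n) \<le> C * r ^ n"
  proof (rule Suc.hyps(1))
    show "k = degree q" "q \<noteq> 0" using Suc q by auto
    show "\<forall>\<nu>. poly q \<nu> = 0 \<longrightarrow> cmod \<nu> < r" using Suc.prems(2) q(1) by simp
    show "\<forall>n. shift_apply q d n = 0"
      using Suc.prems(4) unfolding q(1) shift_apply_linear_factor_mult d_def .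
  qed fact
  then obtain E where E: "\<And>n. cmod (d n) \<le> E * r ^ n" by blast
  have "cmod (c n) \<le> max (cmod (c 0)) (E / (r - cmod \<nu>)) * r ^ n" for n
    by (rule first_order_recurrence_bound[OF _ \<nu> \<open>0 < r\<close> E]) (auto simp: d_def)
  then show ?case by blast
qed

text \<open>Here roots outside the open unit disc are harmless because \<open>c\<close> vanishes at infinity;
  the constants depend on \<open>p\<close> only.\<close>

lemma null_recurrence_decay:
  assumes "p \<noteq> 0"
  shows "\<exists>C r. 0 \<le> C \<and> 0 < r \<and> r < 1 \<and> (\<forall>c K. (\<forall>n. shift_apply p c n = 0) \<longrightarrow> c \<longlonglongrightarrow> 0 \<longrightarrow>
    (\<forall>n. cmod (c n) \<le> K) \<longrightarrow> (\<forall>n. cmod (c n) \<le> C * K * r ^ n))"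
  using assms
proof (induction "degree p" arbitrary: p)
  case 0
  then have "\<forall>n. shift_apply p c n = 0 \<Longrightarrow> c n = 0" for c n
    using shift_apply_degree_0[of p c n] by simp
  then show ?case by (intro exI[of _ 0] exI[of _ "1/2"]) auto
next
  case (Suc k)
  then have "degree p > 0" by simp
  then obtain \<nu> q where q: "p = [:-\<nu>, 1:] * q" "degree p = Suc (degree q)"
    by (rule poly_linear_factorE)
  then have "k = degree q" "q \<noteq> 0" using Suc by auto
  from Suc.hyps(1)[OF this] obtain C r where C: "0 \<le> C" "0 < r" "r < 1" and
    IH: "\<And>d K n. (\<forall>n. shift_apply q d n = 0) \<Longrightarrow> d \<longlonglongrightarrow> 0 \<Longrightarrow> (\<forall>n. cmod (d n) \<le> K) \<Longrightarrow> cmod (d n) \<le> C * K * r ^ n"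
    by blast
  have step: "cmod (c (Suc n) - \<nu> * c n) \<le> C * ((1 + cmod \<nu>) * K) * r ^ n"
    if c: "\<forall>n. shift_apply p c n = 0" "c \<longlonglongrightarrow> 0" "\<forall>n. cmod (c n) \<le> K" for c K n
  proof (rule IH)
    show "\<forall>n. shift_apply q (\<lambda>n. c (Suc n) - \<nu> * c n) n = 0"
      using c(1) unfolding q(1) shift_apply_linear_factor_mult .
    show "(\<lambda>n. c (Suc n) - \<nu> * c n) \<longlonglongrightarrow> 0"
      using tendsto_diff[OF LIMSEQ_Suc[OF c(2)] tendsto_mult[OF tendsto_const[of \<nu>] c(2)]] by simp
    show "\<forall>n. cmod (c (Suc n) - \<nu> * c n) \<le> (1 + cmod \<nu>) * K"
    proof
      fix n
      have "cmod (c (Suc n) - \<nu> * c n) \<le> cmod (c (Suc n)) + cmod \<nu> * cmod (c n)"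
        by (metis norm_mult norm_triangle_ineq4)
      also have "\<dots> \<le> K + cmod \<nu> * K" using c(3) by (intro add_mono mult_left_mono) auto
      finally show "cmod (c (Suc n) - \<nu> * c n) \<le> (1 + cmod \<nu>) * K" by (simp add: algebra_simps)
    qed
  qed
  show ?case
  proof (cases "cmod \<nu> < 1")
    case True
    \<comment> \<open>Strictly above both \<open>r\<close> and \<open>cmod \<nu>\<close>: if the two
      rates coincide, the solution may carry a factor polynomial in \<open>n\<close>.\<close>
    define s where "s = (1 + max r (cmod \<nu>)) / 2"
    have s: "cmod \<nu> < s" "r < s" "s < 1" "0 < s" using True C by (auto simp: s_def)
    define C' where "C' = max 1 (C * (1 + cmod \<nu>) / (s - cmod \<nu>))"
    have "cmod (c n) \<le> C' * K * s ^ n"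
      if c: "\<forall>n. shift_apply p c n = 0" "c \<longlonglongrightarrow> 0" "\<forall>n. cmod (c n) \<le> K" for c K n
    proof (rule first_order_recurrence_bound[where \<mu> = \<nu> and d = "\<lambda>n. c (Suc n) - \<nu> * c n"
          and E = "C * ((1 + cmod \<nu>) * K)"])
      have K: "0 \<le> K" using c(3) norm_ge_zero order.trans by blast
      show "cmod (c (Suc n) - \<nu> * c n) \<le> C * ((1 + cmod \<nu>) * K) * s ^ n" for n
        by (rule order.trans[OF step[OF c]]) (use K C s in \<open>auto intro!: mult_left_mono power_mono\<close>)
      have "1 * K \<le> C' * K" using K by (intro mult_right_mono) (auto simp: C'_def)
      with c(3) show "cmod (c 0) \<le> C' * K" by (metis mult_1 order.trans)
      have "C * (1 + cmod \<nu>) / (s - cmod \<nu>) * K \<le> C' * K"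
        using K by (intro mult_right_mono) (auto simp: C'_def)
      then show "C * ((1 + cmod \<nu>) * K) / (s - cmod \<nu>) \<le> C' * K" by (simp add: mult_ac)
    qed (use s in auto)
    moreover have "0 \<le> C'" by (simp add: C'_def)
    ultimately show ?thesis using s by blast
  next
    case False
    define C' where "C' = C * (1 + cmod \<nu>) / (1 - r)"
    have "cmod (c n) \<le> C' * K * r ^ n"
      if c: "\<forall>n. shift_apply p c n = 0" "c \<longlonglongrightarrow> 0" "\<forall>n. cmod (c n) \<le> K" for c K n
    proof -
      have K: "0 \<le> K" using c(3) norm_ge_zero order.trans by blast
      define E where "E = C * ((1 + cmod \<nu>) * K)"
      have E: "0 \<le> E" using C K by (auto simp: E_def)
      \<comment> \<open>As \<open>cmod \<nu> \<ge> 1\<close>, the recurrence is solved backwards: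
        \<open>c n\<close> is bounded by \<open>c (Suc n)\<close> plus a geometric error. Iterating
        to infinity, where \<open>c\<close> vanishes, leaves only the tail of a geometric
        series.\<close>
      have backward: "cmod (c n) \<le> cmod (c (Suc n)) + E * r ^ n" for n
      proof -
        have "cmod (c n) \<le> cmod \<nu> * cmod (c n)" using False by (simp add: mult_le_cancel_right1)
        also have "\<dots> = cmod (c (Suc n) - (c (Suc n) - \<nu> * c n))" by (simp add: norm_mult)
        also have "\<dots> \<le> cmod (c (Suc n)) + cmod (c (Suc n) - \<nu> * c n)" by (rule norm_triangle_ineq4)
        finally show ?thesis using step[OF c, of n] by (simp add: E_def)
      qed
      have telescope: "cmod (c n) \<le> cmod (c (n + m)) + E * r ^ n / (1 - r) * (1 - r ^ m)" for m
      proof (induction m)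
        case 0
        then show ?case by simp
      next
        case (Suc m)
        have "E * r ^ n / (1 - r) * (1 - r ^ m) + E * r ^ (n + m) = E * r ^ n / (1 - r) * (1 - r ^ Suc m)"
          using C by (simp add: field_simps power_add)
        with Suc backward[of "n + m"] show ?case by simp
      qed
      have limit: "(\<lambda>m. cmod (c (n + m)) + E * r ^ n / (1 - r) * (1 - r ^ m)) \<longlonglongrightarrow> 0 + E * r ^ n / (1 - r) * (1 - 0)"
      proof (intro tendsto_add tendsto_mult tendsto_diff tendsto_const)
        show "(\<lambda>m. cmod (c (n + m))) \<longlonglongrightarrow> 0"
          using LIMSEQ_ignore_initial_segment[OF c(2), of n] by (simp add: add.commute tendsto_norm_zero)
        show "(\<lambda>m. r ^ m) \<longlonglongrightarrow> 0" using C by (intro LIMSEQ_realpow_zero) auto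
      qed
      have "cmod (c n) \<le> 0 + E * r ^ n / (1 - r) * (1 - 0)"
        by (rule LIMSEQ_le_const[OF limit]) (use telescope in auto)
      then show ?thesis by (simp add: C'_def E_def mult_ac)
    qed
    moreover have "0 \<le> C'" using C by (simp add: C'_def)
    ultimately show ?thesis using C by blast
  qed
qed

section \<open>Matrices of spectral radius less than one\<close>

text \<open>\<open>P\<close> does not depend on \<open>v\<close>, so a linear relation between
  finitely many powers is a relation between their matrix entries.\<close>

lemma funpow_matrix_vector_mult:
  fixes T :: "'a::field^'n^'n"
  shows "\<exists>P. \<forall>i v. ((*v) T ^^ i) v = P i *v v"
proof -
  have "\<exists>P. \<forall>v. ((*v) T ^^ i) v = P *v v" for i
  proof (induction i)
    case 0
    show ?case by (intro exI[of _ "mat 1"]) auto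
  next
    case (Suc i)
    then obtain P where "\<And>v. ((*v) T ^^ i) v = P *v v" by blast
    then show ?case by (intro exI[of _ "T ** P"]) (simp add: matrix_vector_mul_assoc)
  qed
  then show ?thesis by metis
qed

text \<open>By minimality of the annihilating polynomial, each of its roots is an eigenvalue.\<close>

lemma annihilating_polynomial_spectrum:
  fixes A :: "real^'n^'n"
  defines "T \<equiv> map_matrix complex_of_real A"
  obtains p where "p \<noteq> 0" "\<And>v j n. shift_apply p (\<lambda>k. (((*v) T ^^ k) v) $ j) n = 0"
    "\<And>\<nu>. poly p \<nu> = 0 \<Longrightarrow> \<nu> \<in> complex_spectrum A" "finite (complex_spectrum A)"
proof -
  define s where "s v j k = (((*v) T ^^ k) v) $ j" for v :: "complex^'n" and j k
  define Ann where "Ann p \<longleftrightarrow> p \<noteq> 0 \<and> (\<forall>v j. shift_apply p (s v j) 0 = 0)" for p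
  obtain P where P: "\<And>i v. ((*v) T ^^ i) v = P i *v v"
    using funpow_matrix_vector_mult[of T] by blast
  have "\<exists>p. Ann p"
  proof -
    \<comment> \<open>There are \<open>card ?Z + 1\<close> powers of \<open>T\<close> but only
      \<open>card ?Z\<close> matrix entries, hence a linear relation.\<close>
    let ?Z = "UNIV :: ('n \<times> 'n) set" and ?I = "{..card (UNIV :: ('n \<times> 'n) set)}"
    obtain \<alpha> i0 where \<alpha>: "i0 \<in> ?I" "\<alpha> i0 \<noteq> 0" "\<And>j k. (\<Sum>i\<in>?I. \<alpha> i * P i $ j $ k) = 0"
      using nontrivial_relation[of ?Z ?I "\<lambda>i z. P i $ fst z $ snd z"] by auto
    define p where "p = (\<Sum>i\<in>?I. monom (\<alpha> i) i)"
    have co: "coeff p i = (if i \<in> ?I then \<alpha> i else 0)" for i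
      by (simp add: p_def coeff_sum sum.delta if_distrib cong: if_cong)
    have "degree p \<le> card ?Z" unfolding p_def
      by (intro degree_sum_le) (auto intro: order.trans[OF degree_monom_le])
    then have "shift_apply p (s v j) 0 = (\<Sum>i\<in>?I. \<alpha> i * s v j i)" for v j
      by (simp add: shift_apply_eq co)
    also have "(\<Sum>i\<in>?I. \<alpha> i * s v j i) = 0" for v j
    proof -
      have "(\<Sum>i\<in>?I. \<alpha> i * s v j i) = (\<Sum>i\<in>?I. \<Sum>k\<in>UNIV. \<alpha> i * P i $ j $ k * v $ k)"
        by (simp add: s_def P matrix_vector_mult_def sum_distrib_left mult_ac)
      also have "\<dots> = (\<Sum>k\<in>UNIV. (\<Sum>i\<in>?I. \<alpha> i * P i $ j $ k) * v $ k)"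
        by (subst sum.swap) (simp add: sum_distrib_right)
      finally show ?thesis unfolding \<alpha>(3) by simp
    qed
    finally have "\<forall>v j. shift_apply p (s v j) 0 = 0" by blast
    moreover have "p \<noteq> 0" using co[of i0] \<alpha>(1,2) by auto
    ultimately show ?thesis by (auto simp: Ann_def)
  qed
  then obtain p where p: "Ann p" "\<And>q. Ann q \<Longrightarrow> degree p \<le> degree q"
    using ex_has_least_nat[of Ann _ degree] by metis
  show thesis
  proof (rule that)
    show "p \<noteq> 0" using p by (simp add: Ann_def)
    show "shift_apply p (\<lambda>k. (((*v) T ^^ k) v) $ j) n = 0" for v j n
    proof -
      have "((*v) T ^^ (n + i)) v = ((*v) T ^^ i) (((*v) T ^^ n) v)" for i
        by (subst add.commute) (simp add: funpow_add)
      then have "shift_apply p (s v j) n = shift_apply p (s (((*v) T ^^ n) v) j) 0"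
        by (simp add: shift_apply_def s_def)
      then have "shift_apply p (s v j) n = 0" using p(1) by (simp add: Ann_def)
      then show ?thesis unfolding s_def[abs_def] .
    qed
    \<comment> \<open>Conversely every eigenvalue is a root of \<open>p\<close>. This makes the
      spectrum finite, without which the \<open>Max\<close> in \<open>matrix_spectral_radius\<close>
      would be unspecified.\<close>
    have root: "poly p z = 0" if "z \<in> complex_spectrum A" for z
    proof -
      from that obtain v where v: "v \<noteq> 0" "T *v v = z *s v" by (auto simp: complex_spectrum_def T_def)
      have "((*v) T ^^ k) v = z ^ k *s v" for k
        by (induction k) (simp_all add: v vector_scalar_commute vector_smult_assoc mult.commute)
      then have "shift_apply p (s v j) 0 = poly p z * v $ j" for j
        by (simp add: shift_apply_def s_def poly_altdef sum_distrib_left mult_ac)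
      with p(1) v(1) show ?thesis by (auto simp: Ann_def vec_eq_iff)
    qed
    show "finite (complex_spectrum A)"
      by (rule finite_subset[OF _ poly_roots_finite[OF \<open>p \<noteq> 0\<close>]]) (use root in auto)
    show "\<nu> \<in> complex_spectrum A" if "poly p \<nu> = 0" for \<nu>
    proof -
      from that obtain q where q: "p = [:-\<nu>, 1:] * q" by (metis dvdE poly_eq_0_iff_dvd)
      have "q \<noteq> 0" using \<open>p \<noteq> 0\<close> q by auto
      then have "degree q < degree p" unfolding q by (subst degree_mult_eq) auto
      then obtain v j where vj: "shift_apply q (s v j) 0 \<noteq> 0" using p(2)[of q] \<open>q \<noteq> 0\<close> by (auto simp: Ann_def)
      \<comment> \<open>\<open>w\<close> is \<open>q(T) v\<close>. By minimality of \<open>p\<close>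
        some \<open>v\<close> makes it nonzero, and \<open>(T - \<nu>) w = p(T) v = 0\<close> makes
        it an eigenvector.\<close>
      define w where "w = (\<chi> i. shift_apply q (s v i) 0)"
      have "w \<noteq> 0" using vj by (auto simp: w_def vec_eq_iff)
      moreover have "T *v w = \<nu> *s w"
      proof (subst vec_eq_iff, rule allI)
        fix i
        have "(T *v w) $ i = (\<Sum>l\<in>UNIV. \<Sum>k\<le>degree q. T $ i $ l * (coeff q k * s v l k))"
          by (simp add: matrix_vector_mult_def w_def shift_apply_def sum_distrib_left)
        also have "\<dots> = (\<Sum>k\<le>degree q. coeff q k * (\<Sum>l\<in>UNIV. T $ i $ l * s v l k))"
          by (subst sum.swap) (simp add: sum_distrib_left mult_ac)
        also have "\<dots> = shift_apply q (\<lambda>k. s v i (Suc k)) 0"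
          by (simp add: shift_apply_def s_def matrix_vector_mult_def)
        finally have "(T *v w) $ i - \<nu> * w $ i = shift_apply p (s v i) 0"
          unfolding q shift_apply_linear_factor_mult
          by (simp add: w_def shift_apply_def right_diff_distrib sum_subtractf sum_distrib_left mult_ac)
        then show "(T *v w) $ i = (\<nu> *s w) $ i" using p(1) by (simp add: Ann_def)
      qed
      ultimately show ?thesis by (auto simp: complex_spectrum_def T_def)
    qed
  qed
qed

lemma linear_funpow_matrix: "linear ((*v) (A :: real^'n^'n) ^^ n)"
proof (induction n)
  case 0
  show ?case by (simp add: linear_iff)
next
  case (Suc n)
  show ?case unfolding funpow.simps by (rule linear_compose[OF Suc]) simp
qed

lemma spectral_radius_decay:
  fixes A :: "real^'n^'n"
  assumes "matrix_spectral_radius A < 1"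
  obtains C r where "0 < C" "0 < r" "r < 1" "\<And>n x. norm (((*v) A ^^ n) x) \<le> C * r ^ n * norm x"
proof -
  let ?T = "map_matrix complex_of_real A"
  obtain p where p: "p \<noteq> 0" "\<And>v j n. shift_apply p (\<lambda>k. (((*v) ?T ^^ k) v) $ j) n = 0"
    "\<And>\<nu>. poly p \<nu> = 0 \<Longrightarrow> \<nu> \<in> complex_spectrum A" "finite (complex_spectrum A)"
    using annihilating_polynomial_spectrum by blast
  \<comment> \<open>The midpoint between the spectral radius and 1; \<open>max 0\<close> secures
    \<open>0 < r\<close> without knowing that the spectrum is nonempty.\<close>
  define r where "r = (1 + max 0 (matrix_spectral_radius A)) / 2"
  have r: "0 < r" "r < 1" "matrix_spectral_radius A < r" using assms by (auto simp: r_def)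
  have roots: "\<forall>\<nu>. poly p \<nu> = 0 \<longrightarrow> cmod \<nu> < r"
  proof (intro allI impI)
    fix \<nu> assume "poly p \<nu> = 0"
    then have "cmod \<nu> \<le> matrix_spectral_radius A"
      unfolding matrix_spectral_radius_def using p(3,4) by (intro Max_ge) auto
    with r show "cmod \<nu> < r" by simp
  qed
  define cv :: "real^'n \<Rightarrow> complex^'n" where "cv x = (\<chi> i. complex_of_real (x $ i))" for x
  have cv: "((*v) ?T ^^ k) (cv x) = cv (((*v) A ^^ k) x)" for k x
    by (induction k) (auto simp: cv_def vec_eq_iff matrix_vector_mult_def map_matrix_def)
  have comp: "\<exists>C. \<forall>n. \<bar>(((*v) A ^^ n) x) $ j\<bar> \<le> C * r ^ n" for x j
  proof -
    have "\<exists>C. \<forall>n. cmod ((((*v) ?T ^^ n) (cv x)) $ j) \<le> C * r ^ n"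
      by (rule recurrence_roots_decay[OF p(1) roots r(1)]) (use p(2) in auto)
    then show ?thesis by (simp add: cv) (simp add: cv_def)
  qed
  then obtain C where C: "\<And>x j n. \<bar>(((*v) A ^^ n) x) $ j\<bar> \<le> C x j * r ^ n" by metis
  have nb: "norm (((*v) A ^^ n) x) \<le> (\<Sum>j\<in>UNIV. C x j) * r ^ n" for x n
  proof -
    have "norm (((*v) A ^^ n) x) \<le> (\<Sum>j\<in>UNIV. \<bar>(((*v) A ^^ n) x) $ j\<bar>)" by (rule norm_le_l1_cart)
    also have "\<dots> \<le> (\<Sum>j\<in>UNIV. C x j * r ^ n)" by (intro sum_mono C)
    finally show ?thesis by (simp add: sum_distrib_right)
  qed
  \<comment> \<open>The constant in \<open>nb\<close> depends on \<open>x\<close>; expanding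
    \<open>x\<close> in the basis makes it uniform.\<close>
  define D where "D = (\<Sum>b\<in>Basis. \<bar>\<Sum>j\<in>UNIV. C b j\<bar>)"
  have "norm (((*v) A ^^ n) x) \<le> (D + 1) * r ^ n * norm x" for n x
  proof -
    have "((*v) A ^^ n) x = ((*v) A ^^ n) (\<Sum>b\<in>Basis. (x \<bullet> b) *\<^sub>R b)" by (simp add: euclidean_representation)
    also have "\<dots> = (\<Sum>b\<in>Basis. (x \<bullet> b) *\<^sub>R ((*v) A ^^ n) b)"
      by (simp add: linear_sum[OF linear_funpow_matrix] linear_cmul[OF linear_funpow_matrix])
    also have "norm \<dots> \<le> (\<Sum>b\<in>Basis. \<bar>x \<bullet> b\<bar> * norm (((*v) A ^^ n) b))"
      by (rule order.trans[OF norm_sum]) simp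
    also have "\<dots> \<le> (\<Sum>b\<in>Basis. norm x * (\<bar>\<Sum>j\<in>UNIV. C b j\<bar> * r ^ n))"
    proof (intro sum_mono mult_mono)
      fix b :: "real^'n"
      show "norm (((*v) A ^^ n) b) \<le> \<bar>\<Sum>j\<in>UNIV. C b j\<bar> * r ^ n"
        using r by (intro order.trans[OF nb] mult_right_mono) auto
    qed (auto intro: Basis_le_norm)
    also have "\<dots> = D * r ^ n * norm x" by (simp add: D_def sum_distrib_left sum_distrib_right mult_ac)
    also have "\<dots> \<le> (D + 1) * r ^ n * norm x" using r by (intro mult_right_mono) auto
    finally show ?thesis .
  qed
  moreover have "0 < D + 1" unfolding D_def by (intro add_nonneg_pos sum_nonneg) auto
  ultimately show thesis using that r by blast
qed

text \<open>In the weighted norm \<open>N x = \<Sum>k<K. norm (A^k x) / \<theta>^k\<close> a single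
  application of \<open>A\<close> contracts, whereas in the Euclidean norm only high powers need to.
  Hence balls of \<open>N\<close> are \<open>A\<close>-invariant; the bound on the support and the
  choice of an invariant set of translations rely on this.\<close>

lemma adapted_norm:
  fixes A :: "real^'n^'n"
  assumes "matrix_spectral_radius A < 1"
  obtains N :: "real^'n \<Rightarrow> real" and \<theta> C where "0 < \<theta>" "\<theta> < 1" "0 < C" "\<And>x. norm x \<le> N x" "\<And>x. N x \<le> C * norm x"
    "\<And>x y. N (x + y) \<le> N x + N y" "\<And>x. N (A *v x) \<le> \<theta> * N x" "continuous_on UNIV N"
proof -
  obtain C r where C: "0 < C" "0 < r" "r < 1" "\<And>n x. norm (((*v) A ^^ n) x) \<le> C * r ^ n * norm x"
    using spectral_radius_decay[OF assms] by metis
  define \<theta> where "\<theta> = (1 + r) / 2"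
  have \<theta>: "0 < \<theta>" "r < \<theta>" "\<theta> < 1" using C by (auto simp: \<theta>_def)
  have "(\<lambda>n. C * (r / \<theta>) ^ n) \<longlonglongrightarrow> C * 0"
    by (intro tendsto_intros LIMSEQ_realpow_zero) (use C \<theta> in auto)
  then have "\<forall>\<^sub>F n in sequentially. C * (r / \<theta>) ^ n < 1" by (rule order_tendstoD) simp
  then obtain K0 where K0: "\<And>n. n \<ge> K0 \<Longrightarrow> C * (r / \<theta>) ^ n < 1" by (auto simp: eventually_sequentially)
  define K where "K = Suc K0"
  have K: "norm (((*v) A ^^ K) x) / \<theta> ^ K \<le> norm x" for x
  proof -
    have "norm (((*v) A ^^ K) x) / \<theta> ^ K \<le> C * r ^ K * norm x / \<theta> ^ K"
      using C(4) \<theta> by (intro divide_right_mono) auto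
    also have "\<dots> = C * (r / \<theta>) ^ K * norm x" by (simp add: power_divide)
    also have "\<dots> \<le> 1 * norm x" using K0[of K] by (intro mult_right_mono) (auto simp: K_def)
    finally show ?thesis by simp
  qed
  define N where "N x = (\<Sum>k<K. norm (((*v) A ^^ k) x) / \<theta> ^ k)" for x
  show thesis
  proof (rule that)
    show "0 < \<theta>" "\<theta> < 1" by fact+
    show "norm x \<le> N x" for x
    proof -
      have "(\<Sum>k\<in>{0}. norm (((*v) A ^^ k) x) / \<theta> ^ k) \<le> N x"
        unfolding N_def using \<theta> by (intro sum_mono2) (auto simp: K_def)
      then show ?thesis by simp
    qed
    show "0 < (\<Sum>k<K. C * r ^ k / \<theta> ^ k)"
      using C \<theta> by (intro sum_pos) (auto simp: K_def)
    show "N x \<le> (\<Sum>k<K. C * r ^ k / \<theta> ^ k) * norm x" for x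
      unfolding N_def sum_distrib_right using C(4) \<theta>
      by (intro sum_mono) (simp add: divide_right_mono)
    show "N (x + y) \<le> N x + N y" for x y
      unfolding N_def sum.distrib[symmetric] linear_add[OF linear_funpow_matrix] add_divide_distrib[symmetric]
      using \<theta> by (intro sum_mono divide_right_mono norm_triangle_ineq) auto
    show "N (A *v x) \<le> \<theta> * N x" for x
    proof -
      define g where "g k = norm (((*v) A ^^ k) x) / \<theta> ^ k" for k
      have "norm (((*v) A ^^ k) (A *v x)) / \<theta> ^ k = \<theta> * g (Suc k)" for k
        using \<theta> by (simp add: g_def funpow_swap1[symmetric])
      \<comment> \<open>The sum shifts by one index: it gains the term \<open>K\<close> and loses
        the term 0, and \<open>K\<close> was chosen so that the former is at most the
        latter.\<close>
      then have "N (A *v x) = \<theta> * (\<Sum>k<K. g (Suc k))"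
        by (simp add: N_def sum_distrib_left)
      also have "(\<Sum>k<K. g (Suc k)) = (\<Sum>k<K. g k) + g K - g 0"
        by (induction K) auto
      also have "g K \<le> g 0" using K[of x] by (simp add: g_def)
      then have "\<theta> * ((\<Sum>k<K. g k) + g K - g 0) \<le> \<theta> * (\<Sum>k<K. g k)" using \<theta> by (intro mult_left_mono) auto
      finally show ?thesis by (simp add: N_def g_def)
    qed
    have "continuous_on UNIV (((*v) A ^^ k))" for k
      by (rule linear_continuous_on[OF linear_conv_bounded_linear[THEN iffD1, OF linear_funpow_matrix]])
    then show "continuous_on UNIV N"
      unfolding N_def using \<theta> by (intro continuous_intros) auto
  qed
qed

section \<open>Lebesgue measure under linear maps and translations\<close>

lemma prod_Basis_cart: "(\<Prod>b\<in>(Basis :: (real^'n) set). f b) = (\<Prod>i\<in>UNIV. f (axis i 1))"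
proof -
  have B: "(Basis :: (real^'n) set) = range (\<lambda>i. axis i 1)" by (auto simp: Basis_vec_def)
  have inj: "inj (\<lambda>i. axis i (1::real) :: real^'n)" by (auto simp: inj_on_def axis_eq_axis)
  show ?thesis unfolding B prod.reindex[OF inj] by (simp add: o_def)
qed

lemma distr_lborel_permute:
  assumes "p permutes (UNIV :: 'n::finite set)"
  shows "distr lborel borel (\<lambda>x::real^'n. \<chi> i. x $ p i) = lborel"
proof (rule lborel_eqI[symmetric])
  let ?h = "\<lambda>x::real^'n. \<chi> i. x $ p i"
  have meas: "?h \<in> borel_measurable borel"
    by (intro borel_measurable_continuous_onI continuous_intros)
  fix l u :: "real^'n" assume "\<And>b. b \<in> Basis \<Longrightarrow> l \<bullet> b \<le> u \<bullet> b"
  then have le: "l $ i \<le> u $ i" for i by (metis axis_in_Basis_iff cart_eq_inner_axis Basis_real_def insertI1)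
  define q where "q = inv p"
  have q: "q permutes UNIV" "\<And>i. p (q i) = i" "\<And>i. q (p i) = i"
    using assms by (auto simp: q_def permutes_inv permutes_inverses)
  have "?h -` box l u = box (\<chi> i. l $ q i) (\<chi> i. u $ q i)"
    unfolding mem_box_cart set_eq_iff vimage_def mem_Collect_eq vec_lambda_beta
    by (metis q(2,3))
  then have "emeasure (distr lborel borel ?h) (box l u) = emeasure lborel (box (\<chi> i. l $ q i) (\<chi> i. u $ q i))"
    using meas by (simp add: emeasure_distr)
  also have "\<dots> = (\<Prod>i\<in>UNIV. (u - l) $ q i)"
  proof (subst emeasure_lborel_box)
    show "(\<chi> i. l $ q i) \<bullet> b \<le> (\<chi> i. u $ q i) \<bullet> b" if "b \<in> Basis" for b
      using le that by (auto simp: Basis_vec_def inner_axis)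
  qed (simp add: prod_Basis_cart inner_axis)
  also have "(\<Prod>i\<in>UNIV. (u - l) $ q i) = (\<Prod>i\<in>UNIV. (u - l) $ i)"
    using prod.permute[OF q(1), of "\<lambda>i. (u - l) $ i"] by (simp add: o_def)
  finally show "emeasure (distr lborel borel ?h) (box l u) = (\<Prod>b\<in>Basis. (u - l) \<bullet> b)"
    by (simp add: prod_Basis_cart inner_axis)
qed simp

lemma distr_lborel_shear:
  assumes "m \<noteq> (n :: 'n::finite)"
  shows "distr lborel borel (\<lambda>x::real^'n. \<chi> i. if i = m then x $ m + x $ n else x $ i) = lborel"
proof -
  define h where "h x = (\<chi> i. if i = m then x $ m + x $ n else x $ i)" for x :: "real^'n"
  define g where "g x = (\<chi> i. if i = m then x $ m - x $ n else x $ i)" for x :: "real^'n"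
  have lin: "linear h" "linear g"
    by (auto intro!: linearI simp: h_def g_def vec_eq_iff algebra_simps)
  have hg: "h (g x) = x" "g (h x) = x" for x
    using assms by (auto simp: h_def g_def vec_eq_iff)
  have meas: "h \<in> borel_measurable borel" "g \<in> borel_measurable borel"
    using lin by (auto intro!: borel_measurable_continuous_onI linear_continuous_on linear_conv_bounded_linear[THEN iffD1])
  have meq: "measure lebesgue (h ` cbox a b) = 1 * measure lebesgue (cbox a b)" for a b
  proof (cases "cbox a b = {}")
    case False
    \<comment> \<open>\<open>measure_shear_interval\<close> asks for a nonnegative
      \<open>n\<close>-th coordinate of the lower corner, so the box is shifted until that
      coordinate is 0.\<close>
    define w :: "real^'n" where "w = axis n (- (a $ n))"
    have "cbox a b = (+) (- w) ` cbox (w + a) (w + b)"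
      unfolding cbox_translation by (simp only: image_image) simp
    then have "h ` cbox a b = (+) (h (- w)) ` (h ` cbox (w + a) (w + b))"
      by (simp only: image_image linear_add[OF lin(1)])
    then have "measure lebesgue (h ` cbox a b) = measure lebesgue (h ` cbox (w + a) (w + b))"
      by (simp only: measure_translation)
    also have "\<dots> = measure lebesgue (cbox (w + a) (w + b))"
    proof -
      have "cbox (w + a) (w + b) \<noteq> {}" using False by (simp add: cbox_translation)
      then show ?thesis unfolding h_def[abs_def]
        by (rule measure_shear_interval[OF assms]) (simp add: w_def)
    qed
    also have "\<dots> = measure lebesgue (cbox a b)"
      unfolding cbox_translation by (rule measure_translation)
    finally show ?thesis by simp
  qed simp
  \<comment> \<open>Invariance is shown for the inverse shear \<open>g\<close> first, because the
    preimage of a box under \<open>g\<close> is its image under \<open>h\<close>, whose measure is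
    known.\<close>
  have "lborel = distr lborel borel g"
  proof (rule lborel_eqI)
    fix l u :: "real^'n" assume lu: "\<And>b. b \<in> Basis \<Longrightarrow> l \<bullet> b \<le> u \<bullet> b"
    have img: "g -` box l u = h ` box l u" 
    proof (intro set_eqI iffI)
      fix y assume "y \<in> g -` box l u"
      then have "h (g y) \<in> h ` box l u" by simp
      then show "y \<in> h ` box l u" by (simp only: hg)
    qed (auto simp: hg)
    have M: "h ` box l u \<in> lmeasurable" "measure lebesgue (h ` box l u) = measure lebesgue (box l u)"
      using measure_linear_sufficient[OF lin(1) lmeasurable_box meq, of l u] by auto
    have "h ` box l u \<in> sets borel"
      unfolding img[symmetric] using measurable_sets[OF meas(2), of "box l u"] by simp
    then have "emeasure (distr lborel borel g) (box l u) = emeasure lebesgue (h ` box l u)"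
      using meas by (simp add: emeasure_distr img)
    also have "\<dots> = ennreal (measure lebesgue (h ` box l u))"
      by (rule emeasure_eq_measure2[OF M(1)])
    also have "\<dots> = emeasure lborel (box l u)"
      unfolding M(2) using emeasure_eq_measure2[OF lmeasurable_box, of l u] by simp
    also have "\<dots> = (\<Prod>b\<in>Basis. (u - l) \<bullet> b)"
      using lu by (rule emeasure_lborel_box)
    finally show "emeasure (distr lborel borel g) (box l u) = (\<Prod>b\<in>Basis. (u - l) \<bullet> b)" .
  qed simp
  then have "distr lborel borel h = distr (distr lborel borel g) borel h" by simp
  also have "\<dots> = distr lborel borel (h \<circ> g)" using meas by (simp add: distr_distr)
  also have "h \<circ> g = (\<lambda>x. x)" using hg by (simp add: fun_eq_iff)
  finally show ?thesis by (simp add: distr_id2 h_def[abs_def])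
qed

lemma borel_measurable_matrix_vector_mult [measurable]:
  "(*v) (A :: real^'n^'m) \<in> borel_measurable borel"
  by (intro borel_measurable_continuous_onI linear_continuous_on matrix_vector_mul_bounded_linear)

text \<open>The scaling factor is multiplicative in \<open>A\<close>, so it suffices to treat
  elementary matrices: diagonal ones, swaps and shears. A zero row is excluded by
  \<open>det A \<noteq> 0\<close>. For nonnegative functions no integrability has to be carried
  through the induction.\<close>

theorem nn_integral_lborel_matrix:
  fixes A :: "real^'n^'n"
  assumes "det A \<noteq> 0" "f \<in> borel_measurable borel"
  shows "(\<integral>\<^sup>+x. f x \<partial>lborel) = ennreal \<bar>det A\<bar> * (\<integral>\<^sup>+x. f (A *v x) \<partial>lborel)"
proof -
  have unimodular: "\<forall>f\<in>borel_measurable borel. (\<integral>\<^sup>+x. f x \<partial>lborel) = ennreal \<bar>det B\<bar> * (\<integral>\<^sup>+x. f (B *v x) \<partial>lborel)"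
    if "\<bar>det B\<bar> = 1" "distr lborel borel ((*v) B) = lborel" for B :: "real^'n^'n"
  proof
    fix f :: "real^'n \<Rightarrow> ennreal" assume f: "f \<in> borel_measurable borel"
    have "(\<integral>\<^sup>+x. f x \<partial>lborel) = (\<integral>\<^sup>+x. f x \<partial>distr lborel borel ((*v) B))" using that by simp
    also have "\<dots> = (\<integral>\<^sup>+x. f (B *v x) \<partial>lborel)" using f by (subst nn_integral_distr) auto
    finally show "(\<integral>\<^sup>+x. f x \<partial>lborel) = ennreal \<bar>det B\<bar> * (\<integral>\<^sup>+x. f (B *v x) \<partial>lborel)" using that by simp
  qed
  have "det A \<noteq> 0 \<longrightarrow> (\<forall>f\<in>borel_measurable borel.
      (\<integral>\<^sup>+x. f x \<partial>lborel) = ennreal \<bar>det A\<bar> * (\<integral>\<^sup>+x. f (A *v x) \<partial>lborel))"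
  proof (induction A rule: induct_matrix_elementary_alt)
    case (1 A B)
    show ?case
    proof (intro impI ballI)
      fix f :: "real^'n \<Rightarrow> ennreal" assume nz: "det (A ** B) \<noteq> 0" and f[measurable]: "f \<in> borel_measurable borel"
      then have "det A \<noteq> 0" "det B \<noteq> 0" by (auto simp: det_mul)
      have "(\<integral>\<^sup>+x. f x \<partial>lborel) = ennreal \<bar>det A\<bar> * (\<integral>\<^sup>+x. f (A *v x) \<partial>lborel)"
        using 1(1) \<open>det A \<noteq> 0\<close> f by blast
      also have "(\<lambda>x. f (A *v x)) \<in> borel_measurable borel" by measurable
      with 1(2) \<open>det B \<noteq> 0\<close> have "(\<integral>\<^sup>+x. f (A *v x) \<partial>lborel) = ennreal \<bar>det B\<bar> * (\<integral>\<^sup>+x. f (A *v (B *v x)) \<partial>lborel)"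
        by blast
      finally show "(\<integral>\<^sup>+x. f x \<partial>lborel) = ennreal \<bar>det (A ** B)\<bar> * (\<integral>\<^sup>+x. f ((A ** B) *v x) \<partial>lborel)"
        by (simp only: det_mul abs_mult ennreal_mult abs_ge_zero mult.assoc matrix_vector_mul_assoc)
    qed
  next
    case (2 A i)
    then show ?case using det_zero_row by blast
  next
    case (3 A)
    show ?case
    proof (intro impI ballI)
      fix f :: "real^'n \<Rightarrow> ennreal" assume nz: "det A \<noteq> 0" and f[measurable]: "f \<in> borel_measurable borel"
      have det: "det A = (\<Prod>i\<in>UNIV. A $ i $ i)" using 3 by (rule det_diagonal)
      define c where "c b = (\<chi> i. A $ i $ i) \<bullet> b" for b :: "real^'n"
      have pc: "(\<Prod>j\<in>Basis. \<bar>c j\<bar>) = \<bar>det A\<bar>"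
        by (simp add: prod_Basis_cart c_def inner_axis det abs_prod)
      have "c b \<noteq> 0" if "b \<in> Basis" for b
        using nz that by (auto simp: det c_def Basis_vec_def inner_axis)
      note affine = lborel_affine_euclidean[where t = "0 :: real^'n" and c = c, OF this]
      have T: "0 + (\<Sum>j\<in>Basis. (c j * (x \<bullet> j)) *\<^sub>R j) = A *v x" for x
      proof -
        have "(A *v x) $ i = A $ i $ i * x $ i" for i
        proof -
          have "(A *v x) $ i = (\<Sum>j\<in>UNIV. A $ i $ j * x $ j)"
            by (subst matrix_vector_mult_def) (rule vec_lambda_beta)
          also have "\<dots> = (\<Sum>j\<in>UNIV. if j = i then A $ i $ i * x $ i else 0)"
            by (rule sum.cong[OF refl]) (use 3 in auto)
          finally show ?thesis by simp
        qed
        moreover have "(\<Sum>j\<in>Basis. (c j * (x \<bullet> j)) *\<^sub>R j) $ i = A $ i $ i * x $ i" for i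
        proof -
          have "(\<Sum>j\<in>Basis. (c j * (x \<bullet> j)) *\<^sub>R j) \<bullet> axis i 1 = c (axis i 1) * (x \<bullet> axis i 1)"
            by (simp add: axis_in_Basis_iff)
          then show ?thesis by (simp add: inner_axis c_def)
        qed
        ultimately show ?thesis by (simp add: vec_eq_iff)
      qed
      have "(\<integral>\<^sup>+x. f x \<partial>lborel) = (\<integral>\<^sup>+x. f x \<partial>density (distr lborel borel ((*v) A)) (\<lambda>_. ennreal \<bar>det A\<bar>))"
        using affine unfolding T pc by simp
      also have "\<dots> = ennreal \<bar>det A\<bar> * (\<integral>\<^sup>+x. f (A *v x) \<partial>lborel)"
        by (simp add: nn_integral_density nn_integral_distr nn_integral_cmult)
      finally show "(\<integral>\<^sup>+x. f x \<partial>lborel) = ennreal \<bar>det A\<bar> * (\<integral>\<^sup>+x. f (A *v x) \<partial>lborel)" .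
    qed
  next
    case (4 m n)
    let ?p = "Transposition.transpose m n" and ?S = "\<chi> i j. mat 1 $ i $ Transposition.transpose m n j :: real^'n^'n"
    have p: "?p permutes UNIV" by (rule permutes_swap_id) auto
    have "\<bar>det ?S\<bar> = 1"
      by (subst det_permute_columns[OF p]) (simp add: abs_mult sign_def)
    moreover have "(*v) ?S = (\<lambda>x. \<chi> i. x $ ?p i)"
    proof (rule ext, subst vec_eq_iff, rule allI)
      fix x :: "real^'n" and i
      have "(?S *v x) $ i = (\<Sum>j\<in>UNIV. ?S $ i $ j * x $ j)"
        by (subst matrix_vector_mult_def) (rule vec_lambda_beta)
      also have "\<dots> = (\<Sum>j\<in>UNIV. if j = ?p i then x $ j else 0)"
      proof (rule sum.cong[OF refl])
        fix j
        have "i = ?p j \<longleftrightarrow> j = ?p i" by (metis transpose_involutory)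
        then have "?S $ i $ j = (if j = ?p i then 1 else 0)" by (auto simp: mat_def)
        then show "?S $ i $ j * x $ j = (if j = ?p i then x $ j else 0)" by simp
      qed
      finally show "(?S *v x) $ i = (\<chi> i. x $ ?p i) $ i" by simp
    qed
    then have "distr lborel borel ((*v) ?S) = lborel" using distr_lborel_permute[OF p] by presburger
    ultimately show ?case using unimodular by blast
  next
    case (5 m n)
    let ?S = "\<chi> i j. of_bool (i = m \<and> j = n \<or> i = j) :: real^'n^'n"
    have "?S = (\<chi> k. if k = m then row m (mat 1) + 1 *s row n (mat 1) else row k (mat 1))"
      using 5 by (auto simp: vec_eq_iff row_def mat_def)
    then have "det ?S = 1" using det_row_operation[OF 5, of "mat 1 :: real^'n^'n" 1] by simp
    moreover have "(*v) ?S = (\<lambda>x. \<chi> i. if i = m then x $ m + x $ n else x $ i)"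
    proof (rule ext, subst vec_eq_iff, rule allI)
      fix x :: "real^'n" and i
      have "(?S *v x) $ i = (\<Sum>j\<in>UNIV. ?S $ i $ j * x $ j)"
        by (subst matrix_vector_mult_def) (rule vec_lambda_beta)
      also have "\<dots> = (\<Sum>j\<in>UNIV. (if j = i then x $ j else 0) + (if j = n then if i = m then x $ n else 0 else 0))"
      proof (rule sum.cong[OF refl])
        fix j
        have "?S $ i $ j = (if j = i then 1 else 0) + (if j = n then if i = m then 1 else 0 else 0)"
          using 5 by simp
        then show "?S $ i $ j * x $ j = (if j = i then x $ j else 0) + (if j = n then if i = m then x $ n else 0 else 0)" by simp
      qed
      finally show "(?S *v x) $ i = (\<chi> i. if i = m then x $ m + x $ n else x $ i) $ i"
        by (simp add: sum.distrib)
    qed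
    then have "distr lborel borel ((*v) ?S) = lborel" using distr_lborel_shear[OF 5] by presburger
    ultimately show ?case using unimodular by force
  qed
  then show ?thesis using assms by blast
qed

section \<open>Translations of integrable functions\<close>

lemma integrable_translate:
  fixes f :: "'a::euclidean_space \<Rightarrow> 'b::{banach, second_countable_topology}"
  assumes "integrable lborel f"
  shows "integrable lborel (\<lambda>x. f (x + t))"
proof -
  have "integrable (distr lborel borel ((+) t)) f" using assms by (simp add: lborel_distr_plus)
  then show ?thesis by (subst (asm) integrable_distr_eq) (use assms in \<open>auto simp: add.commute\<close>)
qed

lemma integral_translate:
  fixes f :: "'a::euclidean_space \<Rightarrow> 'b::{banach, second_countable_topology}"
  assumes [measurable]: "f \<in> borel_measurable borel"
  shows "(LINT x|lborel. f (x + t)) = (LINT x|lborel. f x)"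
proof -
  have "(LINT x|lborel. f x) = (LINT x|distr lborel borel ((+) t). f x)" by (simp add: lborel_distr_plus)
  also have "\<dots> = (LINT x|lborel. f (x + t))" by (subst integral_distr) (auto simp: add.commute)
  finally show ?thesis by simp
qed

text \<open>Enclose \<open>A\<close> between a compact \<open>K\<close> and an open \<open>U\<close>
  with \<open>U - K\<close> small. For \<open>t\<close> shorter than the distance from
  \<open>K\<close> to the complement of \<open>U\<close>, the two indicators differ only where
  \<open>x\<close> or \<open>x + t\<close> lies in \<open>U - K\<close>.\<close>

lemma indicator_translation_continuous:
  fixes A :: "'a::euclidean_space set"
  assumes A[measurable]: "A \<in> sets borel" and fin: "emeasure lborel A < \<infinity>" and "0 < e"
  shows "\<exists>d>0. \<forall>t. norm t < d \<longrightarrow> (LINT x|lborel. \<bar>indicat_real A (x + t) - indicat_real A x\<bar>) < e"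
proof -
  define \<epsilon> where "\<epsilon> = e / 4"
  have \<epsilon>: "0 < \<epsilon>" using assms by (auto simp: \<epsilon>_def)
  obtain U where U: "open U" "A \<subseteq> U" "emeasure lborel (U - A) < ennreal \<epsilon>"
    using outer_regular_lborel[OF A \<epsilon>] by auto
  obtain K where K: "compact K" "K \<subseteq> A" "measure lborel A - \<epsilon> < measure lborel K"
  proof (cases "measure lborel A < \<epsilon>")
    case True
    then show thesis using that[of "{}"] by auto
  next
    case False
    \<comment> \<open>Inner regularity by compact sets is applied to a finite measure, hence the
      restriction of Lebesgue measure to \<open>A\<close>.\<close>
    let ?M = "density lborel (indicator A)"
    have sub: "emeasure ?M K = emeasure lborel K" if K: "K \<subseteq> A" "K \<in> sets borel" for K
    proof -
      have "(\<lambda>x. indicator A x * indicator K x :: ennreal) = indicator K"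
        using K(1) by (auto simp: indicator_def fun_eq_iff)
      then show ?thesis using K(2) by (simp add: emeasure_density)
    qed
    have "emeasure ?M A = (SUP K \<in> {K. K \<subseteq> A \<and> compact K}. emeasure ?M K)"
    proof (rule inner_regular)
      show "emeasure ?M (space ?M) \<noteq> \<infinity>" using fin by (simp add: emeasure_density)
    qed auto
    moreover have "ennreal (measure lborel A - \<epsilon>) < emeasure ?M A"
    proof -
      have "emeasure ?M A = ennreal (measure lborel A)"
        unfolding sub[OF order.refl A] using fin by (intro emeasure_eq_ennreal_measure) auto
      then show ?thesis using False \<epsilon> by (simp add: ennreal_less_iff)
    qed
    ultimately obtain K where K: "K \<subseteq> A" "compact K" "ennreal (measure lborel A - \<epsilon>) < emeasure ?M K"
      by (auto simp: less_SUP_iff)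
    have "K \<in> sets borel" using K(2) by (rule borel_compact)
    moreover have "emeasure lborel K < \<infinity>"
      using emeasure_mono[OF K(1), of lborel] fin by auto
    ultimately have "ennreal (measure lborel A - \<epsilon>) < ennreal (measure lborel K)"
      using K(3) unfolding sub[OF K(1) \<open>K \<in> sets borel\<close>] by (subst (asm) emeasure_eq_ennreal_measure) auto
    then have "measure lborel A - \<epsilon> < measure lborel K"
      using False by (simp add: ennreal_less_iff)
    with K that show thesis by blast
  qed
  have [measurable]: "K \<in> sets borel" "U \<in> sets borel" using K(1) U(1) by (auto intro: borel_compact)
  have K_fin: "emeasure lborel K < \<infinity>" using emeasure_mono[OF K(2), of lborel] fin by auto
  define W where "W = U - K"
  have [measurable]: "W \<in> sets borel" by (simp add: W_def)
  have "measure lborel (A - K) = measure lborel A - measure lborel K"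
    using K(2) fin K_fin by (intro measure_Diff) auto
  then have AK: "measure lborel (A - K) < \<epsilon>" using K(3) by simp
  have "emeasure lborel (A - K) \<le> emeasure lborel A" by (rule emeasure_mono) auto
  then have "emeasure lborel (A - K) = ennreal (measure lborel (A - K))"
    using fin by (intro emeasure_eq_ennreal_measure) auto
  then have "emeasure lborel (A - K) < ennreal \<epsilon>" using AK \<epsilon> by (simp add: ennreal_less_iff)
  then have "emeasure lborel (U - A) + emeasure lborel (A - K) < ennreal \<epsilon> + ennreal \<epsilon>"
    using U(3) by (intro add_strict_mono)
  moreover have "emeasure lborel W \<le> emeasure lborel (U - A) + emeasure lborel (A - K)"
    using U(2) K(2) by (intro order.trans[OF emeasure_mono emeasure_subadditive]) (auto simp: W_def)
  ultimately have W: "emeasure lborel W < ennreal (2 * \<epsilon>)"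
    using \<epsilon> by (simp add: ennreal_plus[symmetric] del: ennreal_plus)
  then have W_int: "integrable lborel (indicat_real W)"
    by (intro integrable_real_indicator) (auto simp: less_top[symmetric] top_unique)
  have "emeasure lborel W = ennreal (measure lborel W)"
    using W by (intro emeasure_eq_ennreal_measure) auto
  then have W_meas: "measure lborel W < 2 * \<epsilon>"
    using W \<epsilon> by (simp add: ennreal_less_iff)
  have "compact K" "closed (- U)" "K \<inter> - U = {}" using K U by auto
  then obtain d where d: "d > 0" "\<And>x y. x \<in> K \<Longrightarrow> y \<in> - U \<Longrightarrow> d \<le> dist x y"
    using separate_compact_closed by metis
  have "(LINT x|lborel. \<bar>indicat_real A (x + t) - indicat_real A x\<bar>) < e" if t: "norm t < d" for t
  proof -
    have near: "x + t \<in> U" if "x \<in> K" for x using d(2)[OF that, of "x + t"] t by (force simp: dist_norm)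
    have near': "x \<in> U" if "x + t \<in> K" for x using d(2)[OF that, of x] t by (force simp: dist_norm)
    have int: "integrable lborel (\<lambda>x. indicat_real W (x + t))" by (rule integrable_translate[OF W_int])
    have "(LINT x|lborel. \<bar>indicat_real A (x + t) - indicat_real A x\<bar>)
        \<le> (LINT x|lborel. indicat_real W (x + t) + indicat_real W x)"
    proof (rule integral_mono')
      show "integrable lborel (\<lambda>x. indicat_real W (x + t) + indicat_real W x)"
        using int W_int by auto
      show "\<bar>indicat_real A (x + t) - indicat_real A x\<bar> \<le> indicat_real W (x + t) + indicat_real W x" for x
        using near[of x] near'[of x] K(2) U(2) by (auto simp: indicator_def W_def)
    qed auto
    also have "\<dots> = (LINT x|lborel. indicat_real W (x + t)) + (LINT x|lborel. indicat_real W x)"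
      using int W_int by (rule Bochner_Integration.integral_add)
    also have "\<dots> = 2 * measure lborel W"
      by (subst integral_translate) auto
    also have "\<dots> < e" using W_meas by (simp add: \<epsilon>_def)
    finally show ?thesis .
  qed
  with d(1) show ?thesis by blast
qed

text \<open>The property passes from indicators to sums and to dominated limits. It serves twice:
  for the Riemann-Lebesgue lemma and for the continuity of the autocorrelation at 0.\<close>

lemma L1_translation_continuous:
  fixes f :: "'a::euclidean_space \<Rightarrow> real"
  assumes "integrable lborel f" "0 < e"
  shows "\<exists>d>0. \<forall>t. norm t < d \<longrightarrow> (LINT x|lborel. abs (f (x + t) - f x)) < e"
  using assms
proof (induction arbitrary: e rule: integrable_induct)
  case (base A c)
  have "0 < e / (abs c + 1)" using base by simp
  then obtain d where d: "d > 0"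
    "\<And>t. norm t < d \<Longrightarrow> (LINT x|lborel. abs (indicat_real A (x + t) - indicat_real A x)) < e / (abs c + 1)"
    using indicator_translation_continuous[of A "e / (abs c + 1)"] base by auto
  have "(LINT x|lborel. abs (indicator A (x + t) *\<^sub>R c - indicator A x *\<^sub>R c)) < e" if "norm t < d" for t
  proof -
    have "(LINT x|lborel. abs (indicator A (x + t) *\<^sub>R c - indicator A x *\<^sub>R c))
        = (LINT x|lborel. abs (indicat_real A (x + t) - indicat_real A x) * abs c)"
      by (simp add: left_diff_distrib flip: abs_mult)
    also have "\<dots> = (LINT x|lborel. abs (indicat_real A (x + t) - indicat_real A x)) * abs c"
      by simp
    also have "\<dots> \<le> e / (abs c + 1) * abs c" using d(2)[OF that] by (intro mult_right_mono) auto
    also have "\<dots> < e" using base by (simp add: field_simps)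
    finally show ?thesis .
  qed
  with d(1) show ?case by blast
next
  case (add f g)
  have "0 < e / 2" using add.prems by simp
  obtain d1 where d1: "d1 > 0" "\<And>t. norm t < d1 \<Longrightarrow> (LINT x|lborel. abs (f (x + t) - f x)) < e / 2"
    using add.IH(1)[OF \<open>0 < e / 2\<close>] by blast
  obtain d2 where d2: "d2 > 0" "\<And>t. norm t < d2 \<Longrightarrow> (LINT x|lborel. abs (g (x + t) - g x)) < e / 2"
    using add.IH(2)[OF \<open>0 < e / 2\<close>] by blast
  have "(LINT x|lborel. abs (f (x + t) + g (x + t) - (f x + g x))) < e" if "norm t < min d1 d2" for t
  proof -
    have int: "integrable lborel (\<lambda>x. f (x + t))" "integrable lborel (\<lambda>x. g (x + t))"
      using add.hyps by (auto intro: integrable_translate)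
    have "(LINT x|lborel. abs (f (x + t) + g (x + t) - (f x + g x)))
        \<le> (LINT x|lborel. abs (f (x + t) - f x) + abs (g (x + t) - g x))"
      using add.hyps int by (intro integral_mono) auto
    also have "\<dots> = (LINT x|lborel. abs (f (x + t) - f x)) + (LINT x|lborel. abs (g (x + t) - g x))"
      using add.hyps int by (intro Bochner_Integration.integral_add) auto
    also have "\<dots> < e" using d1(2)[of t] d2(2)[of t] that by simp
    finally show ?thesis .
  qed
  then show ?case using d1(1) d2(1) by (intro exI[of _ "min d1 d2"]) auto
next
  case (lim f s)
  have "(\<lambda>i. LINT x|lborel. norm (s i x - f x)) \<longlonglongrightarrow> (LINT x|(lborel :: 'a measure). 0)"
  \<comment> \<open>The approximants satisfy \<open>norm (s i x) \<le> 2 * norm (f x)\<close>,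
    whence the factor 3.\<close>
  proof (rule integral_dominated_convergence[where w = "\<lambda>x. 3 * norm (f x)"
        and f = "\<lambda>_. 0" and s = "\<lambda>i x. norm (s i x - f x)"])
    show "AE x in lborel. (\<lambda>i. norm (s i x - f x)) \<longlonglongrightarrow> 0"
      using lim.hyps(2) by (intro AE_I2 tendsto_norm_zero) (simp add: LIM_zero_iff)
    show "AE x in lborel. norm (norm (s i x - f x)) \<le> 3 * norm (f x)" for i
    proof (intro AE_I2)
      fix x show "norm (norm (s i x - f x)) \<le> 3 * norm (f x)"
        using lim.hyps(3)[of x i] norm_triangle_ineq4[of "s i x" "f x"] by simp
    qed
    show "(\<lambda>x. norm (s i x - f x)) \<in> borel_measurable lborel" for i
      using lim.hyps(1)[of i] lim.hyps(4) by measurable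
    show "integrable lborel (\<lambda>x. 3 * norm (f x))" using lim.hyps(4) by auto
  qed simp
  then have "\<forall>\<^sub>F i in sequentially. (LINT x|lborel. abs (s i x - f x)) < e / 3"
    using lim.prems by (intro order_tendstoD(2)[where a = "e / 3"]) auto
  then obtain i where i: "(LINT x|lborel. abs (s i x - f x)) < e / 3"
    by (auto simp: eventually_sequentially)
  obtain d where d: "d > 0" "\<And>t. norm t < d \<Longrightarrow> (LINT x|lborel. abs (s i (x + t) - s i x)) < e / 3"
    using lim.IH[of "e / 3" i] lim.prems by auto
  have "(LINT x|lborel. abs (f (x + t) - f x)) < e" if "norm t < d" for t
  proof -
    have ints: "integrable lborel (s i)" "integrable lborel f" using lim.hyps(1,4) by auto
    note int = ints integrable_translate[OF ints(1), of t] integrable_translate[OF ints(2), of t]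
    have "(LINT x|lborel. abs (f (x + t) - f x))
        \<le> (LINT x|lborel. abs (s i (x + t) - f (x + t)) + abs (s i (x + t) - s i x) + abs (s i x - f x))"
      using int by (intro integral_mono) auto
    also have "\<dots> = (LINT x|lborel. abs (s i (x + t) - f (x + t))) + (LINT x|lborel. abs (s i (x + t) - s i x))
        + (LINT x|lborel. abs (s i x - f x))"
      using int by (simp add: Bochner_Integration.integral_add)
    also have "(LINT x|lborel. abs (s i (x + t) - f (x + t))) = (LINT x|lborel. abs (s i x - f x))"
      using ints integral_translate[of "\<lambda>x. abs (s i x - f x)" t] by auto
    finally show ?thesis using i d(2)[OF that] by simp
  qed
  with d(1) show ?case by blast
qed

section \<open>Characters\<close>

definition character :: "real^'n \<Rightarrow> real^'n \<Rightarrow> complex" where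
  "character \<xi> x = exp (2 * complex_of_real pi * \<i> * complex_of_real (\<xi> \<bullet> x))"

definition integer_lattice :: "(real^'n) set" where
  "integer_lattice = {z. \<forall>i. z $ i \<in> \<int>}"

lemma fourier_transform_character: "fourier_transform \<mu> \<xi> = (LINT x|\<mu>. character \<xi> x)"
  by (simp add: fourier_transform_def character_def)

lemma norm_character [simp]: "cmod (character \<xi> x) = 1"
  by (simp add: character_def)

lemma character_add_left: "character (\<xi> + \<eta>) x = character \<xi> x * character \<eta> x"
  by (simp add: character_def inner_add_left ring_distribs exp_add)

lemma character_add_right: "character \<xi> (x + y) = character \<xi> x * character \<xi> y"
  by (simp add: character_def inner_add_right ring_distribs exp_add)

lemma character_0 [simp]: "character 0 x = 1" "character \<xi> 0 = 1"
  by (simp_all add: character_def)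

lemma cnj_character: "cnj (character \<xi> x) = character (- \<xi>) x"
  by (simp add: character_def exp_cnj)

lemma character_measurable [measurable]: "character \<xi> \<in> borel_measurable borel"
  unfolding character_def[abs_def] by (intro borel_measurable_continuous_onI continuous_intros)

lemma integer_lattice_inner: "k \<in> integer_lattice \<Longrightarrow> z \<in> integer_lattice \<Longrightarrow> k \<bullet> z \<in> \<int>"
  by (auto simp: integer_lattice_def inner_vec_def intro!: Ints_sum Ints_mult)

lemma character_integer: "k \<in> integer_lattice \<Longrightarrow> z \<in> integer_lattice \<Longrightarrow> character k z = 1"
proof -
  assume "k \<in> integer_lattice" "z \<in> integer_lattice"
  then have "k \<bullet> z \<in> \<int>" by (rule integer_lattice_inner)
  from exp_integer_2pi[OF this] show ?thesis by (simp add: character_def mult_ac)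
qed

lemma norm_character_diff_1: "cmod (character \<xi> x - 1) \<le> 2 * pi * \<bar>\<xi> \<bullet> x\<bar>"
proof -
  have "character \<xi> x = exp (\<i> * complex_of_real (2 * pi * (\<xi> \<bullet> x)))"
    by (simp add: character_def mult_ac)
  then have "cmod (character \<xi> x - 1) = 2 * \<bar>sin (2 * pi * (\<xi> \<bullet> x) / 2)\<bar>"
    by (simp only: dist_exp_i_1)
  also have "\<dots> \<le> 2 * \<bar>2 * pi * (\<xi> \<bullet> x) / 2\<bar>"
    using abs_sin_x_le_abs_x by (intro mult_left_mono) auto
  finally show ?thesis by (simp add: abs_mult)
qed

lemma norm_character_diff_1_le: "cmod (character \<xi> x - 1) \<le> 2 * pi * (norm \<xi> * norm x)"
  by (rule order.trans[OF norm_character_diff_1])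
    (intro mult_left_mono Cauchy_Schwarz_ineq2, auto)

lemma integral_lborel_prod_Basis:
  fixes f :: "'a::euclidean_space \<Rightarrow> real \<Rightarrow> complex"
  assumes int: "\<And>b. b \<in> Basis \<Longrightarrow> integrable lborel (f b)"
  shows "(LINT x|lborel. (\<Prod>b\<in>Basis. f b (x \<bullet> b))) = (\<Prod>b\<in>Basis. (LINT x|lborel. f b x))"
proof -
  interpret product_sigma_finite "\<lambda>_::'a. lborel :: real measure" ..
  have [measurable]: "f b \<in> borel_measurable borel" if "b \<in> Basis" for b
    using int[OF that] by auto
  have "(LINT x|lborel. (\<Prod>b\<in>Basis. f b (x \<bullet> b)))
      = (LINT x|(\<Pi>\<^sub>M b\<in>Basis. lborel). (\<Prod>b\<in>Basis. f b ((\<Sum>b\<in>Basis. x b *\<^sub>R b) \<bullet> b)))"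
    by (subst lborel_eq, subst integral_distr) auto
  also have "\<dots> = (LINT x|(\<Pi>\<^sub>M b\<in>(Basis::'a set). lborel). (\<Prod>b\<in>Basis. f b (x b)))"
    by (intro Bochner_Integration.integral_cong refl prod.cong) simp
  also have "\<dots> = (\<Prod>b\<in>Basis. (LINT x|lborel. f b x))"
    using int by (intro product_integral_prod) auto
  finally show ?thesis .
qed

text \<open>The primitive has period 1 and the interval has integer length. Lengths other than 1 are
  needed when Bessel's inequality is applied on a large cube.\<close>

lemma integral_exp_integer_frequency:
  assumes "j \<in> \<int>" "j \<noteq> 0"
  shows "(LINT x|lborel. indicator {c..c + real L} x *\<^sub>R exp (2 * complex_of_real pi * \<i> * complex_of_real (j * x))) = 0"
proof -
  define w where "w = 2 * complex_of_real pi * \<i> * complex_of_real j"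
  have w: "w \<noteq> 0" using assms by (simp add: w_def)
  have wx: "2 * complex_of_real pi * \<i> * complex_of_real (j * x) = w * of_real x" for x
    by (simp add: w_def mult_ac)
  define F where "F x = exp (w * of_real x) / w" for x :: real
  have "(LINT x|lborel. indicator {c..c + real L} x *\<^sub>R exp (w * of_real x)) = F (c + real L) - F c"
  proof (rule integral_FTC_Icc)
    show "(F has_vector_derivative exp (w * of_real x)) (at x within {c..c + real L})" for x
    proof -
      have "((\<lambda>z. exp (w * z) / w) has_field_derivative exp (w * of_real x)) (at (of_real x))"
        using w by (auto intro!: derivative_eq_intros)
      from has_vector_derivative_real_field[OF this] show ?thesis by (simp add: F_def[abs_def])
    qed
    show "continuous_on {c..c + real L} (\<lambda>x. exp (w * of_real x))"
      by (intro continuous_intros)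
  qed simp
  also have "F (c + real L) = F c"
  proof -
    have "j * real L \<in> \<int>" using assms by auto
    from exp_integer_2pi[OF this] have "exp (w * of_real (real L)) = 1"
      by (simp add: w_def mult_ac)
    then show ?thesis by (simp add: F_def ring_distribs exp_add)
  qed
  finally show ?thesis unfolding wx by simp
qed

lemma integral_character_cube:
  fixes k :: "real^'n"
  assumes k: "k \<in> integer_lattice" "k \<noteq> 0"
  shows "(LINT x|lborel. indicator (cbox a (a + real L *\<^sub>R One)) x *\<^sub>R character k x) = 0"
proof -
  define f where "f b t = indicator {a \<bullet> b..a \<bullet> b + real L} t *\<^sub>R
    exp (2 * complex_of_real pi * \<i> * complex_of_real ((k \<bullet> b) * t))" for b :: "real^'n" and t
  have int: "integrable lborel (f b)" for b
    unfolding f_def by (intro borel_integrable_compact continuous_intros) auto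
  have "indicator (cbox a (a + real L *\<^sub>R One)) x *\<^sub>R character k x = (\<Prod>b\<in>Basis. f b (x \<bullet> b))" for x
  proof -
    have "(\<Prod>b\<in>Basis. indicat_real {a \<bullet> b..a \<bullet> b + real L} (x \<bullet> b)) = indicat_real (cbox a (a + real L *\<^sub>R One)) x"
    proof (cases "x \<in> cbox a (a + real L *\<^sub>R One)")
      case True
      then show ?thesis by (auto simp: mem_box inner_add_left)
    next
      case False
      then obtain b where "b \<in> Basis" "x \<bullet> b \<notin> {a \<bullet> b..a \<bullet> b + real L}" by (auto simp: mem_box inner_add_left)
      then show ?thesis using False by (auto intro!: prod_zero bexI[of _ b])
    qed
    moreover have "(\<Prod>b\<in>Basis. exp (2 * complex_of_real pi * \<i> * complex_of_real ((k \<bullet> b) * (x \<bullet> b)))) = character k x"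
      by (simp add: character_def euclidean_inner[of k x] sum_distrib_left flip: exp_sum)
    ultimately show ?thesis
      by (simp add: f_def scaleR_conv_of_real prod.distrib flip: of_real_prod)
  qed
  then have "(LINT x|lborel. indicator (cbox a (a + real L *\<^sub>R One)) x *\<^sub>R character k x)
      = (\<Prod>b\<in>Basis. (LINT x|lborel. f b x))"
    using integral_lborel_prod_Basis[of f, OF int] by simp
  also have "\<dots> = 0"
  proof -
    obtain i where i: "k $ i \<noteq> 0" using k by (auto simp: vec_eq_iff)
    have "(LINT x|lborel. f (axis i 1) x) = 0"
      unfolding f_def using k i by (intro integral_exp_integer_frequency) (auto simp: inner_axis integer_lattice_def)
    then show ?thesis by (intro prod_zero bexI[of _ "axis i 1"]) (auto simp: axis_in_Basis_iff)
  qed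
  finally show ?thesis .
qed

text \<open>The square function of the trigonometric sum is compared with \<open>f\<close> by AM-GM with weight \<open>V\<close>,
  so that completeness of \<open>L\<^sup>2\<close> is never needed.\<close>

lemma bessel_inequality:
  fixes e :: "'k \<Rightarrow> 'a \<Rightarrow> complex" and f :: "'a \<Rightarrow> real"
  assumes M: "finite_measure M" and K: "finite K" and V: "0 < V"
    and e[measurable]: "\<And>k. e k \<in> borel_measurable M" and e1: "\<And>k x. cmod (e k x) \<le> 1"
    and orth: "\<And>k j. k \<in> K \<Longrightarrow> j \<in> K \<Longrightarrow> (LINT x|M. e k x * cnj (e j x)) = (if k = j then of_real V else 0)"
    and f[measurable]: "f \<in> borel_measurable M" and fB: "\<And>x. \<bar>f x\<bar> \<le> B"
  shows "(\<Sum>k\<in>K. (cmod (LINT x|M. of_real (f x) * e k x))\<^sup>2) \<le> V * (LINT x|M. (f x)\<^sup>2)"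
proof -
  interpret finite_measure M by fact
  define c where "c k = (LINT x|M. of_real (f x) * e k x)" for k
  define H where "H x = (\<Sum>k\<in>K. cnj (c k) * e k x)" for x
  define s where "s = (\<Sum>k\<in>K. (cmod (c k))\<^sup>2)"
  have [measurable]: "(\<lambda>x. cnj (e k x)) \<in> borel_measurable M" for k
    by (rule measurable_compose[OF e borel_measurable_continuous_onI]) (intro continuous_intros)
  have [measurable]: "H \<in> borel_measurable M" unfolding H_def by measurable
  have B: "0 \<le> B" using fB[of undefined] by simp
  have int_fe: "integrable M (\<lambda>x. of_real (f x) * e k x)" for k
  proof (rule integrable_const_bound[where B = B])
    show "AE x in M. cmod (of_real (f x) * e k x) \<le> B"
    proof (intro AE_I2)
      fix x
      have "\<bar>f x\<bar> * cmod (e k x) \<le> B * 1" using fB e1 B by (intro mult_mono) auto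
      then show "cmod (of_real (f x) * e k x) \<le> B" by (simp add: norm_mult)
    qed
  qed measurable
  have int_ee: "integrable M (\<lambda>x. e k x * cnj (e j x))" for k j
  proof (rule integrable_const_bound[where B = 1])
    show "AE x in M. cmod (e k x * cnj (e j x)) \<le> 1"
      using e1 by (intro AE_I2) (simp add: norm_mult mult_le_one)
  qed measurable
  have int_f2: "integrable M (\<lambda>x. (f x)\<^sup>2)"
  proof (rule integrable_const_bound[where B = "B\<^sup>2"])
    show "AE x in M. norm ((f x)\<^sup>2) \<le> B\<^sup>2"
    proof (intro AE_I2)
      fix x show "norm ((f x)\<^sup>2) \<le> B\<^sup>2"
        using power_mono[OF fB[of x], of 2] by (simp add: power_abs[symmetric] abs_le_square_iff)
    qed
  qed measurable
  have s_fH: "complex_of_real s = (LINT x|M. of_real (f x) * H x)"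
  proof -
    have "(LINT x|M. of_real (f x) * H x) = (LINT x|M. (\<Sum>k\<in>K. cnj (c k) * (of_real (f x) * e k x)))"
      by (simp add: H_def sum_distrib_left mult_ac)
    also have "\<dots> = (\<Sum>k\<in>K. cnj (c k) * c k)"
      by (subst Bochner_Integration.integral_sum) (auto intro!: int_fe integrable_mult_right simp: c_def)
    also have "\<dots> = complex_of_real s"
      by (simp only: s_def of_real_sum complex_norm_square mult.commute)
    finally show ?thesis by simp
  qed
  have HH: "complex_of_real ((cmod (H x))\<^sup>2) = (\<Sum>k\<in>K. \<Sum>j\<in>K. cnj (c k) * c j * (e k x * cnj (e j x)))" for x
    unfolding complex_norm_square H_def cnj_sum sum_product complex_cnj_mult complex_cnj_cnj
    by (intro sum.cong refl) (simp only: mult_ac)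
  have int_HH: "integrable M (\<lambda>x. complex_of_real ((cmod (H x))\<^sup>2))"
    unfolding HH by (intro Bochner_Integration.integrable_sum integrable_mult_right int_ee)
  have "complex_of_real (LINT x|M. (cmod (H x))\<^sup>2) = (LINT x|M. complex_of_real ((cmod (H x))\<^sup>2))"
    by (rule integral_complex_of_real[symmetric])
  also have "\<dots> = (\<Sum>k\<in>K. \<Sum>j\<in>K. cnj (c k) * c j * (LINT x|M. e k x * cnj (e j x)))"
    unfolding HH by (simp add: Bochner_Integration.integral_sum int_ee integrable_mult_right)
  also have "\<dots> = (\<Sum>k\<in>K. cnj (c k) * c k * of_real V)"
    using K by (intro sum.cong refl) (simp add: orth sum.delta' if_distrib cong: if_cong)
  also have "\<dots> = complex_of_real (V * s)"
    by (simp only: s_def of_real_sum of_real_mult complex_norm_square sum_distrib_left mult_ac)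
  finally have H2: "(LINT x|M. (cmod (H x))\<^sup>2) = V * s" by (simp only: of_real_eq_iff)
  have int_H2: "integrable M (\<lambda>x. (cmod (H x))\<^sup>2)"
    using int_HH by (simp only: complex_of_real_integrable_eq)
  have "0 \<le> s" by (simp add: s_def sum_nonneg)
  then have "s = cmod (complex_of_real s)" by simp
  also have "\<dots> \<le> (LINT x|M. cmod (of_real (f x) * H x))"
    unfolding s_fH by (rule integral_norm_bound)
  \<comment> \<open>AM-GM is weighted so that, since the integral of \<open>|H|^2\<close> is
    \<open>V * s\<close>, the second term contributes exactly \<open>s / 2\<close>, which the left
    side absorbs.\<close>
  also have "\<dots> \<le> (LINT x|M. (V * (f x)\<^sup>2 + (cmod (H x))\<^sup>2 / V) / 2)"
  proof (rule integral_mono')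
    show "integrable M (\<lambda>x. (V * (f x)\<^sup>2 + (cmod (H x))\<^sup>2 / V) / 2)"
      using int_f2 int_H2 by auto
    show "cmod (of_real (f x) * H x) \<le> (V * (f x)\<^sup>2 + (cmod (H x))\<^sup>2 / V) / 2" for x
    proof -
      have "0 \<le> (V * \<bar>f x\<bar> - cmod (H x))\<^sup>2 / V" using V by simp
      also have "\<dots> = V * (f x)\<^sup>2 + (cmod (H x))\<^sup>2 / V - 2 * (\<bar>f x\<bar> * cmod (H x))"
        using V by (simp add: power2_eq_square field_simps abs_mult_self_eq)
      finally show ?thesis by (simp add: norm_mult)
    qed
  qed (use V in auto)
  also have "\<dots> = (V * (LINT x|M. (f x)\<^sup>2) + s) / 2"
    using int_f2 int_H2 V by (simp add: H2)
  finally show ?thesis by (simp add: s_def c_def)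
qed

section \<open>Uniqueness of measures and the Riemann-Lebesgue lemma\<close>

lemma finite_borel_measure_eqI:
  fixes M N :: "'a::euclidean_space measure"
  assumes "finite_measure M" "finite_measure N" and sets: "sets M = sets borel" "sets N = sets borel"
    and eq: "\<And>f :: 'a \<Rightarrow> real. continuous_on UNIV f \<Longrightarrow> (\<And>x. \<bar>f x\<bar> \<le> 1) \<Longrightarrow> integral\<^sup>L M f = integral\<^sup>L N f"
  shows "M = N"
proof -
  interpret M: finite_measure M by fact
  interpret N: finite_measure N by fact
  have space: "space M = UNIV" "space N = UNIV" using sets_eq_imp_space_eq[OF sets(1)] sets_eq_imp_space_eq[OF sets(2)] by simp_all
  have closed: "measure M C = measure N C" if C: "closed C" for C
  proof (cases "C = {}")
    case False
    \<comment> \<open>Lipschitz cutoffs decreasing to the indicator of \<open>C\<close>; closed sets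
      form an intersection-stable generator, so agreement on them is enough. The empty set is
      treated apart because \<open>infdist\<close> to it is 0, which would make every
      \<open>u n\<close> equal to 1.\<close>
    define u where "u n x = max 0 (1 - real n * infdist x C)" for n x
    have cont: "continuous_on UNIV (u n)" for n
      unfolding u_def by (intro continuous_intros)
    have bnd: "\<bar>u n x\<bar> \<le> 1" for n x by (auto simp: u_def infdist_nonneg)
    have lim: "(\<lambda>n. u n x) \<longlonglongrightarrow> indicat_real C x" for x
    proof (cases "x \<in> C")
      case True
      then show ?thesis by (simp add: u_def)
    next
      case False
      then have "0 < infdist x C" using C \<open>C \<noteq> {}\<close> by (metis in_closed_iff_infdist_zero infdist_nonneg order_less_le)
      then obtain n0 where n0: "1 < real n0 * infdist x C" using reals_Archimedean3 by blast
      have "u n x = 0" if "n \<ge> n0" for n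
      proof -
        have "real n0 * infdist x C \<le> real n * infdist x C" using that by (intro mult_right_mono) (auto simp: infdist_nonneg)
        then show ?thesis using n0 by (simp add: u_def)
      qed
      then have "\<forall>\<^sub>F n in sequentially. u n x = indicat_real C x"
        using False by (auto simp: eventually_sequentially)
      then show ?thesis by (rule tendsto_eventually)
    qed
    have conv: "(\<lambda>n. integral\<^sup>L L (u n)) \<longlonglongrightarrow> measure L C" if L: "finite_measure L" "sets L = sets borel" for L
    proof -
      interpret L: finite_measure L by fact
      have "(\<lambda>n. integral\<^sup>L L (u n)) \<longlonglongrightarrow> (LINT x|L. indicat_real C x)"
      proof (rule integral_dominated_convergence[where w = "\<lambda>_. 1"])
        show "u n \<in> borel_measurable L" for n
          using borel_measurable_continuous_onI[OF cont] L(2) by (simp cong: measurable_cong_sets)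
        show "indicat_real C \<in> borel_measurable L"
          using C L(2) by (intro borel_measurable_indicator) auto
      qed (use lim bnd in auto)
      moreover have "C \<in> sets L" using C L(2) by auto
      ultimately show ?thesis by (simp add: sets.Int_space_eq2)
    qed
    have "(\<lambda>n. integral\<^sup>L M (u n)) \<longlonglongrightarrow> measure N C"
      using conv[of N] assms eq[OF cont bnd] by simp
    with conv[of M] assms show ?thesis using LIMSEQ_unique by blast
  qed simp
  show ?thesis
  proof (rule measure_eqI_generator_eq[where E = "Collect closed" and A = "\<lambda>_. UNIV" and \<Omega> = UNIV])
    show "Int_stable (Collect closed :: 'a set set)" by (auto simp: Int_stable_def)
    show "emeasure M X = emeasure N X" if "X \<in> Collect closed" for X
      using closed that by (simp add: M.emeasure_eq_measure N.emeasure_eq_measure)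
    show "sets M = sigma_sets UNIV (Collect closed)" "sets N = sigma_sets UNIV (Collect closed)"
      using sets by (simp_all add: borel_eq_closed)
    show "emeasure M UNIV \<noteq> \<infinity>" using M.emeasure_finite[of UNIV] by simp
  qed auto
qed

text \<open>Translation by half a period changes the sign of the character, so twice the integral is
  the integral of \<open>f x - f (x + t)\<close> against it. This turns L1 continuity under
  translation into decay, qualitatively in \<open>riemann_lebesgue\<close> and with a rate in
  \<open>ft_decay_step\<close>.\<close>

lemma half_period_shift:
  fixes f :: "real^'n \<Rightarrow> real"
  assumes f: "integrable lborel f" and t: "\<xi> \<bullet> t = 1 / 2"
  shows "2 * cmod (LINT x|lborel. of_real (f x) * character \<xi> x) \<le> (LINT x|lborel. \<bar>f (x + t) - f x\<bar>)"
proof -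
  have [measurable]: "f \<in> borel_measurable borel" using f by auto
  have int: "integrable lborel (\<lambda>x. of_real (g x) * character \<xi> x)" if "integrable lborel g" for g :: "real^'n \<Rightarrow> real"
    by (rule Bochner_Integration.integrable_bound[OF that]) (use that in \<open>auto simp: norm_mult\<close>)
  have ct: "character \<xi> t = -1"
  proof -
    have "character \<xi> t = exp (complex_of_real pi * \<i>)" by (simp add: character_def t)
    then show ?thesis by (simp add: exp_pi_i)
  qed
  let ?I = "LINT x|lborel. of_real (f x) * character \<xi> x"
  have "?I = (LINT x|lborel. of_real (f (x + t)) * character \<xi> (x + t))"
    by (rule integral_translate[symmetric]) measurable
  also have "\<dots> = - (LINT x|lborel. of_real (f (x + t)) * character \<xi> x)"
    by (simp add: character_add_right ct)
  finally have I: "2 * ?I = ?I - (LINT x|lborel. of_real (f (x + t)) * character \<xi> x)" by simp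
  also have "\<dots> = (LINT x|lborel. of_real (f x) * character \<xi> x - of_real (f (x + t)) * character \<xi> x)"
    using int[OF f] int[OF integrable_translate[OF f, of t]] by (rule Bochner_Integration.integral_diff[symmetric])
  finally have "cmod (2 * ?I) \<le> (LINT x|lborel. cmod (of_real (f x) * character \<xi> x - of_real (f (x + t)) * character \<xi> x))"
    by (simp only: integral_norm_bound)
  also have "\<dots> = (LINT x|lborel. \<bar>f (x + t) - f x\<bar>)"
    by (intro Bochner_Integration.integral_cong refl)
      (simp add: norm_mult abs_minus_commute flip: left_diff_distrib of_real_diff)
  finally show ?thesis by (simp add: norm_mult)
qed

lemma riemann_lebesgue:
  fixes f :: "real^'n \<Rightarrow> real"
  assumes f: "integrable lborel f" and "0 < e"
  shows "\<exists>R. \<forall>\<xi>. R < norm \<xi> \<longrightarrow> cmod (LINT x|lborel. of_real (f x) * character \<xi> x) < e"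
proof -
  obtain d where d: "d > 0" "\<And>t. norm t < d \<Longrightarrow> (LINT x|lborel. abs (f (x + t) - f x)) < e"
    using L1_translation_continuous[OF assms] by blast
  have "cmod (LINT x|lborel. of_real (f x) * character \<xi> x) < e" if \<xi>: "1 / d < norm \<xi>" for \<xi>
  proof -
    have pos: "0 < norm \<xi>" using \<xi> d(1) by (meson divide_pos_pos less_trans zero_less_one)
    \<comment> \<open>The shortest vector with \<open>\<xi> \<bullet> t = 1 / 2\<close>; its length
      is \<open>1 / (2 * norm \<xi>)\<close>.\<close>
    define t where "t = (1 / (2 * (norm \<xi>)\<^sup>2)) *\<^sub>R \<xi>"
    have "\<xi> \<bullet> t = 1 / 2" using pos by (simp add: t_def dot_square_norm)
    define q where "q = 1 / norm \<xi>"
    have "norm t = q / 2" using pos by (simp add: t_def q_def power2_eq_square)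
    moreover have "q < d" "0 < q" using \<xi> pos d(1) by (auto simp: q_def field_simps)
    ultimately have "norm t < d" by simp
    then have "2 * cmod (LINT x|lborel. of_real (f x) * character \<xi> x) < e"
      using half_period_shift[OF f \<open>\<xi> \<bullet> t = 1 / 2\<close>] d(2) by fastforce
    then show ?thesis by (smt (verit) norm_ge_zero)
  qed
  then show ?thesis by blast
qed

section \<open>Measures with vanishing Fourier coefficients\<close>

text \<open>Closed under products (\<open>trig_poly_mult\<close>), hence containing every real
  polynomial in the real and imaginary parts of the coordinates of \<open>torus_map\<close>; these
  are dense by Stone-Weierstrass.\<close>

inductive trig_poly :: "(real^'n \<Rightarrow> complex) \<Rightarrow> bool" where
  monomial: "k \<in> integer_lattice \<Longrightarrow> trig_poly (\<lambda>x. c * character k x)"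
| add: "trig_poly f \<Longrightarrow> trig_poly g \<Longrightarrow> trig_poly (\<lambda>x. f x + g x)"

lemma integer_lattice_add: "k \<in> integer_lattice \<Longrightarrow> j \<in> integer_lattice \<Longrightarrow> k + j \<in> integer_lattice"
  and integer_lattice_diff: "k \<in> integer_lattice \<Longrightarrow> j \<in> integer_lattice \<Longrightarrow> k - j \<in> integer_lattice"
  and integer_lattice_uminus: "k \<in> integer_lattice \<Longrightarrow> - k \<in> integer_lattice"
  and integer_lattice_0: "0 \<in> integer_lattice"
  and integer_lattice_axis: "axis i 1 \<in> integer_lattice"
  by (auto simp: integer_lattice_def axis_def)

lemma trig_poly_const: "trig_poly (\<lambda>x. c)"
  using trig_poly.monomial[OF integer_lattice_0, of c] by simp

lemma trig_poly_mult:
  assumes "trig_poly f" "trig_poly g"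
  shows "trig_poly (\<lambda>x. f x * g x)"
  using assms(1)
proof induction
  case (monomial k c)
  show ?case using assms(2)
  proof induction
    case (monomial j d)
    have "(\<lambda>x. c * character k x * (d * character j x)) = (\<lambda>x. (c * d) * character (k + j) x)"
      by (simp add: character_add_left mult_ac)
    then show ?case using trig_poly.monomial[OF integer_lattice_add[OF \<open>k \<in> integer_lattice\<close> monomial]] by metis
  next
    case (add g h)
    then show ?case using trig_poly.add[OF add.IH] by (simp add: ring_distribs)
  qed
next
  case (add f h)
  then show ?case using trig_poly.add[OF add.IH] by (simp add: ring_distribs)
qed

lemma trig_poly_sum: "finite I \<Longrightarrow> (\<And>i. i \<in> I \<Longrightarrow> trig_poly (f i)) \<Longrightarrow> trig_poly (\<lambda>x. \<Sum>i\<in>I. f i x)"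
  by (induction I rule: finite_induct) (auto intro: trig_poly_const trig_poly.add)

text \<open>The torus is realised as a product of unit circles in \<open>complex^'n\<close>; two
  points have the same image exactly when they differ by a lattice vector.\<close>

definition torus_map :: "real^'n \<Rightarrow> complex^'n" where
  "torus_map x = (\<chi> i. character (axis i 1) x)"

lemma continuous_on_torus_map: "continuous_on S torus_map"
  unfolding torus_map_def character_def by (intro continuous_intros)

lemma torus_map_measurable [measurable]: "torus_map \<in> borel_measurable borel"
  by (intro borel_measurable_continuous_onI continuous_on_torus_map)

lemma torus_map_eq_iff: "torus_map x = torus_map y \<longleftrightarrow> x - y \<in> integer_lattice"
proof -
  have "character (axis i 1) x = character (axis i 1) y \<longleftrightarrow> x $ i - y $ i \<in> \<int>" for i
  proof -
    have ch: "character (axis i 1) v = exp (2 * complex_of_real pi * \<i> * complex_of_real (v $ i))" for v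
      by (simp add: character_def inner_axis')
    have "character (axis i 1) x = character (axis i 1) y \<longleftrightarrow>
      (\<exists>n::int. 2 * complex_of_real pi * \<i> * complex_of_real (x $ i)
        = 2 * complex_of_real pi * \<i> * complex_of_real (y $ i) + of_int (2 * n) * complex_of_real pi * \<i>)"
      unfolding ch exp_eq by simp
    also have "\<dots> \<longleftrightarrow> (\<exists>n::int. x $ i = y $ i + of_int n)"
    proof (intro ex_cong1)
      fix n :: int
      have "2 * complex_of_real pi * \<i> * complex_of_real (x $ i)
          = 2 * complex_of_real pi * \<i> * complex_of_real (y $ i) + of_int (2 * n) * complex_of_real pi * \<i>
        \<longleftrightarrow> (2 * complex_of_real pi * \<i>) * complex_of_real (x $ i) = (2 * complex_of_real pi * \<i>) * complex_of_real (y $ i + of_int n)"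
        by (simp add: algebra_simps)
      also have "\<dots> \<longleftrightarrow> x $ i = y $ i + of_int n"
        by (subst mult_cancel_left) (simp only: of_real_eq_iff, simp)
      finally show "2 * complex_of_real pi * \<i> * complex_of_real (x $ i)
          = 2 * complex_of_real pi * \<i> * complex_of_real (y $ i) + of_int (2 * n) * complex_of_real pi * \<i>
        \<longleftrightarrow> x $ i = y $ i + of_int n" .
    qed
    also have "\<dots> \<longleftrightarrow> x $ i - y $ i \<in> \<int>"
      by (auto elim!: Ints_cases simp: algebra_simps)
    finally show ?thesis .
  qed
  then show ?thesis by (simp add: torus_map_def vec_eq_iff integer_lattice_def)
qed

text \<open>Real and imaginary part of a coordinate are combinations of a character and its
  conjugate, which is the character of the opposite frequency.\<close>

lemma trig_poly_polynomial_torus_map: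
  assumes "real_polynomial_function q"
  shows "trig_poly (\<lambda>x::real^'n. complex_of_real (q (torus_map x)))"
  using assms
proof (induction q)
  case (linear f)
  interpret bounded_linear f by fact
  have rep: "v = (\<Sum>i\<in>UNIV. Re (v $ i) *\<^sub>R axis i 1 + Im (v $ i) *\<^sub>R axis i \<i>)" for v :: "complex^'n"
    by (simp add: vec_eq_iff axis_def complex_eq_iff if_distrib sum.distrib cong: if_cong)
  have f: "f v = (\<Sum>i\<in>UNIV. Re (v $ i) * f (axis i 1) + Im (v $ i) * f (axis i \<i>))" for v
    by (subst rep) (simp only: sum add scaleR real_scaleR_def)
  have re: "trig_poly (\<lambda>x. complex_of_real (Re (torus_map x $ i)))" for i :: 'n
  proof -
    have "complex_of_real (Re (torus_map x $ i)) = 1 / 2 * character (axis i 1) x + 1 / 2 * character (- axis i 1) x" for x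
      unfolding torus_map_def cnj_character[symmetric] by (simp add: complex_eq_iff)
    then show ?thesis
      by (simp only:) (intro trig_poly.intros integer_lattice_axis integer_lattice_uminus)
  qed
  have im: "trig_poly (\<lambda>x. complex_of_real (Im (torus_map x $ i)))" for i :: 'n
  proof -
    have "complex_of_real (Im (torus_map x $ i)) = (- \<i> / 2) * character (axis i 1) x + (\<i> / 2) * character (- axis i 1) x" for x
      by (simp add: torus_map_def flip: cnj_character) (simp add: complex_eq_iff)
    then show ?thesis
      by (simp only:) (intro trig_poly.intros integer_lattice_axis integer_lattice_uminus)
  qed
  have eq: "complex_of_real (f (torus_map x)) = (\<Sum>i\<in>UNIV. complex_of_real (Re (torus_map x $ i)) * complex_of_real (f (axis i 1))
      + complex_of_real (Im (torus_map x $ i)) * complex_of_real (f (axis i \<i>)))" for x :: "real^'n"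
    by (subst f) (simp only: of_real_sum of_real_add of_real_mult)
  show ?case
    unfolding eq
    by (intro trig_poly_sum trig_poly.add trig_poly_mult re im trig_poly_const) auto
next
  case (const c)
  show ?case by (rule trig_poly_const)
next
  case (add f g)
  then show ?case using trig_poly.add[OF add.IH] by simp
next
  case (mult f g)
  then show ?case using trig_poly_mult[OF mult.IH] by simp
qed

text \<open>Equality of the coefficients extends to trigonometric polynomials by linearity and to
  continuous functions on the compact torus by Stone-Weierstrass; these determine the image
  measures.\<close>

lemma distr_torus_map_eqI:
  fixes M N :: "(real^'n) measure"
  assumes M: "prob_space M" "sets M = sets borel" and N: "prob_space N" "sets N = sets borel"
    and eq: "\<And>k. k \<in> integer_lattice \<Longrightarrow> (LINT x|M. character k x) = (LINT x|N. character k x)"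
  shows "distr M borel torus_map = distr N borel torus_map"
proof -
  interpret M: prob_space M by fact
  interpret N: prob_space N by fact
  have meas: "torus_map \<in> measurable M borel" "torus_map \<in> measurable N borel"
    using torus_map_measurable M(2) N(2) by (simp_all cong: measurable_cong_sets)
  have char_meas: "character k \<in> borel_measurable M" "character k \<in> borel_measurable N" for k
    using character_measurable[of k] M(2) N(2) by (simp_all cong: measurable_cong_sets)
  have char_int: "integrable M (character k)" "integrable N (character k)" for k
    using char_meas by (auto intro!: M.integrable_const_bound[where B = 1] N.integrable_const_bound[where B = 1])
  have trig: "integrable M g \<and> integrable N g \<and> integral\<^sup>L M g = integral\<^sup>L N g" if "trig_poly g" for g
    using that
  proof induction
    case (monomial k c)
    then show ?case using char_int[of k] eq[of k] by (auto intro: integrable_mult_right)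
  next
    case (add f g)
    then show ?case by (simp add: Bochner_Integration.integral_add)
  qed
  define T :: "(complex^'n) set" where "T = {z. \<forall>i. z $ i \<in> sphere 0 1}"
  have "closed T" unfolding T_def by (intro closed_Collect_all closed_vimage_vec_nth[unfolded vimage_def, simplified]) auto
  moreover have "bounded T"
  proof (rule boundedI)
    fix z assume "z \<in> T"
    then have component: "norm (z $ i) \<le> 1" for i by (auto simp: T_def)
    have "norm z \<le> (\<Sum>i\<in>UNIV. norm (z $ i))" by (simp add: norm_vec_def L2_set_le_sum)
    also have "\<dots> \<le> (\<Sum>i\<in>(UNIV::'n set). 1)" by (intro sum_mono component)
    finally show "norm z \<le> real CARD('n)" by simp
  qed
  ultimately have T: "compact T" by (simp add: compact_eq_bounded_closed)
  have in_T: "torus_map x \<in> T" for x by (simp add: torus_map_def T_def)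
  show ?thesis
  proof (rule finite_borel_measure_eqI)
    show "finite_measure (distr M borel torus_map)" "finite_measure (distr N borel torus_map)"
      using meas M.prob_space_distr N.prob_space_distr prob_space.finite_measure by blast+
    fix f :: "complex^'n \<Rightarrow> real" assume f: "continuous_on UNIV f" "\<And>x. \<bar>f x\<bar> \<le> 1"
    have fm: "f \<in> borel_measurable borel" using f(1) by (rule borel_measurable_continuous_onI)
    have int: "integrable M (\<lambda>x. f (torus_map x))" "integrable N (\<lambda>x. f (torus_map x))"
      using f(2) measurable_compose[OF meas(1) fm] measurable_compose[OF meas(2) fm]
      by (auto intro!: M.integrable_const_bound[where B = 1] N.integrable_const_bound[where B = 1])
    have approx: "\<bar>(LINT x|M. f (torus_map x)) - (LINT x|N. f (torus_map x))\<bar> \<le> 2 * e" if "e > 0" for e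
    proof -
      obtain q where q: "real_polynomial_function q" "\<And>z. z \<in> T \<Longrightarrow> \<bar>f z - q z\<bar> < e"
        using Stone_Weierstrass_real_polynomial_function[OF T continuous_on_subset[OF f(1)] \<open>e > 0\<close>] by auto
      note qt = trig[OF trig_poly_polynomial_torus_map[OF q(1)]]
      then have q_int: "integrable M (\<lambda>x. q (torus_map x))" "integrable N (\<lambda>x. q (torus_map x))"
        and q_eq: "(LINT x|M. q (torus_map x)) = (LINT x|N. q (torus_map x))"
        by (simp_all only: complex_of_real_integrable_eq integral_complex_of_real of_real_eq_iff)
      have close: "\<bar>(LINT x|L. f (torus_map x)) - (LINT x|L. q (torus_map x))\<bar> \<le> e"
        if "prob_space L" "integrable L (\<lambda>x. f (torus_map x))" "integrable L (\<lambda>x. q (torus_map x))" for L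
      proof -
        interpret L: prob_space L by fact
        have "\<bar>(LINT x|L. f (torus_map x)) - (LINT x|L. q (torus_map x))\<bar>
            = \<bar>LINT x|L. f (torus_map x) - q (torus_map x)\<bar>"
          using that by (simp add: Bochner_Integration.integral_diff)
        also have "\<dots> \<le> (LINT x|L. \<bar>f (torus_map x) - q (torus_map x)\<bar>)"
          using integral_norm_bound[of L "\<lambda>x. f (torus_map x) - q (torus_map x)"] by simp
        also have "\<dots> \<le> (LINT x|L. e)"
          using that q(2)[OF in_T] by (intro integral_mono) (auto intro: less_imp_le)
        finally show ?thesis by (simp add: L.prob_space)
      qed
      show ?thesis using close[OF M(1) int(1) q_int(1)] close[OF N(1) int(2) q_int(2)] q_eq by linarith
    qed
    have "\<bar>(LINT x|M. f (torus_map x)) - (LINT x|N. f (torus_map x))\<bar> \<le> 0 + e" if "e > 0" for e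
      using approx[of "e / 2"] that by simp
    then have "\<bar>(LINT x|M. f (torus_map x)) - (LINT x|N. f (torus_map x))\<bar> \<le> 0" by (rule field_le_epsilon)
    then show "integral\<^sup>L (distr M borel torus_map) f = integral\<^sup>L (distr N borel torus_map) f"
      using meas fm by (simp add: integral_distr)
  qed simp_all
qed

section \<open>The unit cell as a fundamental domain of the integer lattice\<close>

definition unit_cell :: "(real^'n) set" where
  "unit_cell = {x. \<forall>i. 0 \<le> x $ i \<and> x $ i < 1}"

lemma unit_cubes_eq: "unit_cubes = (\<lambda>z. (+) z ` unit_cell) ` integer_lattice"
  by (auto simp: unit_cubes_def unit_cell_def integer_lattice_def)

lemma mem_translate_unit_cell: "x \<in> (+) z ` unit_cell \<longleftrightarrow> (\<forall>i. z $ i \<le> x $ i \<and> x $ i < z $ i + 1)"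
proof -
  have "x \<in> (+) z ` unit_cell \<longleftrightarrow> x - z \<in> unit_cell" by (force simp: image_iff)
  then show ?thesis by (auto simp: unit_cell_def algebra_simps)
qed

lemma unit_cell_measurable [measurable]: "unit_cell \<in> sets borel"
proof -
  have "unit_cell = (\<Inter>i. {x::real^'n. 0 \<le> x $ i} \<inter> {x. x $ i < 1})" by (auto simp: unit_cell_def)
  also have "\<dots> \<in> sets borel"
    by (intro sets.countable_INT'' sets.Int borel_closed borel_open closed_Collect_le open_Collect_less continuous_intros) auto
  finally show ?thesis .
qed

lemma translate_eq_vimage: "(+) z ` S = (\<lambda>x. x - z) -` (S :: 'a::ab_group_add set)"
  by (force simp: image_iff algebra_simps)

lemma translate_measurable [measurable]: "S \<in> sets borel \<Longrightarrow> (+) z ` S \<in> sets (borel :: 'a::euclidean_space measure)"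
  unfolding translate_eq_vimage by (rule measurable_sets_borel[of _ borel]) auto

lemma emeasure_lborel_translate:
  "S \<in> sets borel \<Longrightarrow> emeasure lborel ((+) z ` S) = emeasure lborel (S :: 'a::euclidean_space set)"
proof -
  assume S: "S \<in> sets borel"
  have "emeasure lborel S = emeasure (distr lborel borel ((+) (- z))) S" by (simp add: lborel_distr_plus)
  also have "\<dots> = emeasure lborel ((+) (- z) -` S)" using S by (simp add: emeasure_distr)
  also have "(+) (- z) -` S = (+) z ` S" unfolding translate_eq_vimage by auto
  finally show ?thesis by simp
qed

lemma unit_cell_bounds: "box 0 One \<subseteq> (unit_cell :: (real^'n) set)" "unit_cell \<subseteq> cbox 0 (One :: real^'n)"
proof -
  have "(One :: real^'n) $ i = 1" for i
    using inner_sum_left_Basis[of "axis i 1 :: real^'n" "\<lambda>_. 1"] by (simp add: inner_axis axis_in_Basis_iff Basis_real_def)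
  then show "box 0 One \<subseteq> (unit_cell :: (real^'n) set)" "unit_cell \<subseteq> cbox 0 (One :: real^'n)"
    by (auto simp: unit_cell_def mem_box_cart less_imp_le)
qed

text \<open>The half-open cell tiles space, while integrals of characters are computed over closed
  cubes; the boundary in which they differ is null.\<close>

lemma AE_unit_cell: "AE x in lborel. x \<in> cbox 0 (One :: real^'n) \<longleftrightarrow> x \<in> unit_cell"
proof (rule AE_I)
  have "emeasure lborel (cbox 0 (One :: real^'n) - box 0 One) = emeasure lborel (cbox 0 (One :: real^'n)) - emeasure lborel (box 0 (One :: real^'n))"
    by (intro emeasure_Diff) (auto simp: box_subset_cbox)
  also have "\<dots> = 0" by (simp add: emeasure_lborel_cbox_eq emeasure_lborel_box_eq)
  finally show "emeasure lborel (cbox 0 (One :: real^'n) - box 0 One) = 0" .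
qed (use unit_cell_bounds in auto)

lemma emeasure_unit_cell: "emeasure lborel (unit_cell :: (real^'n) set) = 1"
proof -
  have "emeasure lborel (unit_cell :: (real^'n) set) = emeasure lborel (cbox 0 (One :: real^'n))"
    using AE_unit_cell by (intro emeasure_eq_AE) auto
  then show ?thesis by (simp add: emeasure_lborel_cbox_eq)
qed

lemma countable_integer_lattice: "countable (integer_lattice :: (real^'n) set)"
proof -
  have range: "integer_lattice = range (\<lambda>f :: 'n \<Rightarrow> int. \<chi> i. real_of_int (f i))"
  proof (intro set_eqI iffI)
    fix z :: "real^'n" assume "z \<in> integer_lattice"
    then have "z = (\<chi> i. real_of_int \<lfloor>z $ i\<rfloor>)" by (simp add: vec_eq_iff integer_lattice_def)
    then show "z \<in> range (\<lambda>f :: 'n \<Rightarrow> int. \<chi> i. real_of_int (f i))" by (intro range_eqI)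
  qed (auto simp: integer_lattice_def)
  show ?thesis unfolding range by (intro countable_image countableI_type)
qed

lemma ex_lattice_cell: "\<exists>z\<in>integer_lattice. x \<in> (+) z ` unit_cell"
  by (rule bexI[of _ "\<chi> i. real_of_int \<lfloor>x $ i\<rfloor>"]) (auto simp: mem_translate_unit_cell integer_lattice_def)

lemma lattice_cell_unique:
  assumes "z \<in> integer_lattice" "w \<in> integer_lattice" "x \<in> (+) z ` unit_cell" "x \<in> (+) w ` unit_cell"
  shows "z = w"
proof (subst vec_eq_iff, rule allI)
  fix i
  obtain k j where kj: "z $ i = of_int k" "w $ i = of_int j"
    using assms by (auto simp: integer_lattice_def elim!: Ints_cases) (metis Ints_cases)
  moreover have "z $ i \<le> x $ i" "x $ i < z $ i + 1" "w $ i \<le> x $ i" "x $ i < w $ i + 1"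
    using assms by (auto simp: mem_translate_unit_cell)
  ultimately have "k = j" by linarith
  with kj show "z $ i = w $ i" by simp
qed

lemma disjoint_family_lattice_cells: "disjoint_family_on (\<lambda>z. (+) z ` unit_cell) integer_lattice"
  unfolding disjoint_family_on_def using lattice_cell_unique by blast

text \<open>The projection of \<open>\<mu>\<close> to the torus is Haar measure.\<close>

lemma emeasure_le_lborel:
  fixes \<mu> :: "(real^'n) measure"
  assumes \<mu>: "prob_space \<mu>" "sets \<mu> = sets borel"
    and zero: "\<And>k. k \<in> integer_lattice \<Longrightarrow> k \<noteq> 0 \<Longrightarrow> fourier_transform \<mu> k = 0"
    and S: "S \<in> sets borel"
  shows "emeasure \<mu> S \<le> emeasure lborel S"
proof -
  interpret prob_space \<mu> by fact
  \<comment> \<open>The comparison measure: its nontrivial Fourier coefficients vanish as well, so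
    \<open>\<mu>\<close> and \<open>N\<close> have the same image on the torus.\<close>
  define N :: "(real^'n) measure" where "N = density lborel (indicator unit_cell)"
  have N: "prob_space N" "sets N = sets borel"
    by (auto intro!: prob_spaceI simp: N_def emeasure_density emeasure_unit_cell)
  interpret N: prob_space N by fact
  have N_char: "(LINT x|N. character k x) = 0" if "k \<in> integer_lattice" "k \<noteq> 0" for k
  proof -
    have "(LINT x|N. character k x) = (LINT x|lborel. indicat_real unit_cell x *\<^sub>R character k x)"
      unfolding N_def ennreal_indicator[symmetric] by (subst integral_density) auto
    also have "\<dots> = (LINT x|lborel. indicat_real (cbox 0 (0 + real 1 *\<^sub>R One)) x *\<^sub>R character k x)"
      using AE_unit_cell by (intro integral_cong_AE) (auto simp: indicator_def elim!: eventually_mono)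
    also have "\<dots> = 0" by (rule integral_character_cube[OF that])
    finally show ?thesis .
  qed
  have eq: "distr \<mu> borel torus_map = distr N borel torus_map"
  proof (rule distr_torus_map_eqI[OF \<mu> N])
    fix k :: "real^'n" assume k: "k \<in> integer_lattice"
    show "(LINT x|\<mu>. character k x) = (LINT x|N. character k x)"
    proof (cases "k = 0")
      case True
      then show ?thesis by (simp add: prob_space N.prob_space)
    next
      case False
      then show ?thesis using zero[OF k] N_char[OF k] by (simp add: fourier_transform_character)
    qed
  qed
  have meas: "torus_map \<in> measurable \<mu> borel" "torus_map \<in> measurable N borel"
    using torus_map_measurable \<mu>(2) N(2) by (simp_all cong: measurable_cong_sets)
  have sp: "space \<mu> = UNIV" "space N = UNIV"
    using sets_eq_imp_space_eq[OF \<mu>(2)] sets_eq_imp_space_eq[OF N(2)] by simp_all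
  \<comment> \<open>Compact sets come first because their image on the torus is again compact, hence
    Borel. As \<open>K\<close> lies in one lattice cell, the points of the unit cell with the same
    image as a point of \<open>K\<close> form no more than a translate of \<open>K\<close>.\<close>
  have cpt: "emeasure \<mu> K \<le> emeasure lborel K"
    if K: "compact K" "K \<subseteq> (+) z ` unit_cell" "z \<in> integer_lattice" for K z
  proof -
    have Kb: "K \<in> sets borel" using K(1) by (rule borel_compact)
    have "compact (torus_map ` K)" by (rule compact_continuous_image[OF continuous_on_torus_map K(1)])
    then have TK: "torus_map ` K \<in> sets borel" by (rule borel_compact)
    then have pre: "torus_map -` torus_map ` K \<in> sets borel"
      using measurable_sets_borel[OF torus_map_measurable] by blast
    have "emeasure \<mu> K \<le> emeasure \<mu> (torus_map -` torus_map ` K)"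
      using pre \<mu>(2) by (intro emeasure_mono) auto
    also have "\<dots> = emeasure (distr \<mu> borel torus_map) (torus_map ` K)"
      using TK meas sp by (simp add: emeasure_distr)
    also have "\<dots> = emeasure N (torus_map -` torus_map ` K)"
      unfolding eq using TK meas sp by (simp add: emeasure_distr)
    also have "\<dots> = emeasure lborel (unit_cell \<inter> torus_map -` torus_map ` K)"
      using pre by (simp add: N_def emeasure_density flip: indicator_inter_arith)
    also have "\<dots> \<le> emeasure lborel ((+) (- z) ` K)"
    proof (rule emeasure_mono)
      show "unit_cell \<inter> torus_map -` torus_map ` K \<subseteq> (+) (- z) ` K"
      proof
        fix x assume "x \<in> unit_cell \<inter> torus_map -` torus_map ` K"
        then obtain y where y: "x \<in> unit_cell" "y \<in> K" "torus_map x = torus_map y" by auto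
        define w where "w = x - y"
        have w: "w \<in> integer_lattice" using y(3) by (simp add: torus_map_eq_iff w_def)
        have "x \<in> (+) 0 ` unit_cell" using y(1) by auto
        moreover have "x \<in> (+) (z + w) ` unit_cell"
          using subsetD[OF K(2) y(2)] by (auto simp: mem_translate_unit_cell w_def algebra_simps)
        ultimately have "z + w = 0"
          using lattice_cell_unique[OF integer_lattice_0 integer_lattice_add[OF K(3) w]] by metis
        then have "x = - z + y" by (simp add: w_def add_eq_0_iff algebra_simps)
        with y(2) show "x \<in> (+) (- z) ` K" by blast
      qed
      show "(+) (- z) ` K \<in> sets lborel" using translate_measurable[OF Kb, of "- z"] by simp
    qed
    also have "\<dots> = emeasure lborel K" by (rule emeasure_lborel_translate[OF Kb])
    finally show ?thesis .
  qed
  have cell: "emeasure \<mu> (S \<inter> (+) z ` unit_cell) \<le> emeasure lborel (S \<inter> (+) z ` unit_cell)" if z: "z \<in> integer_lattice" for z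
  proof -
    let ?R = "S \<inter> (+) z ` unit_cell"
    have R: "?R \<in> sets borel" using S by auto
    have "emeasure \<mu> ?R = (SUP K \<in> {K. K \<subseteq> ?R \<and> compact K}. emeasure \<mu> K)"
      using \<mu>(2) emeasure_finite R by (intro inner_regular) auto
    also have "\<dots> \<le> emeasure lborel ?R"
    proof (rule SUP_least)
      fix K assume "K \<in> {K. K \<subseteq> ?R \<and> compact K}"
      then have "emeasure \<mu> K \<le> emeasure lborel K" "emeasure lborel K \<le> emeasure lborel ?R"
        using cpt[of K z] z R by (auto intro: emeasure_mono)
      then show "emeasure \<mu> K \<le> emeasure lborel ?R" by (rule order.trans)
    qed
    finally show ?thesis .
  qed
  have split: "emeasure L S = (\<integral>\<^sup>+z. emeasure L (S \<inter> (+) z ` unit_cell) \<partial>count_space integer_lattice)"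
    if "sets L = sets borel" for L :: "(real^'n) measure"
  proof -
    have "S = (\<Union>z\<in>integer_lattice. S \<inter> (+) z ` unit_cell)" using ex_lattice_cell by blast
    then have "emeasure L S = emeasure L (\<Union>z\<in>integer_lattice. S \<inter> (+) z ` unit_cell)" by simp
    also have "\<dots> = (\<integral>\<^sup>+z. emeasure L (S \<inter> (+) z ` unit_cell) \<partial>count_space integer_lattice)"
    proof (intro emeasure_UN_countable countable_integer_lattice)
      show "disjoint_family_on (\<lambda>z. S \<inter> (+) z ` unit_cell) integer_lattice"
        using disjoint_family_lattice_cells unfolding disjoint_family_on_def by blast
    qed (use S that in auto)
    finally show ?thesis .
  qed
  show ?thesis
    unfolding split[OF \<mu>(2)] split[OF sets_lborel] by (intro nn_integral_mono) (use cell in auto)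
qed

section \<open>Integral self-affine measures\<close>

lemma funpow_inverse:
  fixes f g :: "'a \<Rightarrow> 'a"
  assumes "\<And>x. f (g x) = x"
  shows "(f ^^ n) ((g ^^ n) x) = x"
proof (induction n)
  case (Suc n)
  then show ?case
    using assms by (simp add: funpow_Suc_right[of n f] funpow.simps(2)[of n g] del: funpow.simps)
qed simp

locale integral_self_affine =
  fixes A :: "real^'n^'n" and m :: nat and a :: "nat \<Rightarrow> real^'n" and p :: "nat \<Rightarrow> real" and \<mu> :: "(real^'n) measure"
  assumes ifs: "integral_affine_ifs A m a"
    and prob_vector: "strictly_positive_probability_vector m p"
    and self_affine: "is_self_affine_measure A m a p \<mu>"

sublocale integral_self_affine \<subseteq> prob_space \<mu>
  using self_affine by (simp add: is_self_affine_measure_def)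

definition (in integral_self_affine) "invA = matrix_inv A"
text \<open>\<open>trB\<close> is the expanding integer matrix written \<open>M\<close> in the
  overview, and \<open>trA\<close> is its contracting inverse.\<close>

definition (in integral_self_affine) "trA = transpose A"
definition (in integral_self_affine) "trB = transpose invA"

abbreviation (in integral_self_affine) "ft \<equiv> fourier_transform \<mu>"

text \<open>The Fourier transform of the discrete measure that puts mass \<open>p l\<close> at each
  \<open>a l\<close>. As the \<open>a l\<close> are integral, it is invariant under lattice
  translations.\<close>

definition (in integral_self_affine) mask :: "real^'n \<Rightarrow> complex" where
  "mask \<xi> = (\<Sum>l=1..m. of_real (p l) * character \<xi> (a l))"

lemma (in integral_self_affine) sets_mu [measurable_cong]: "sets \<mu> = sets borel"
  using self_affine by (simp add: is_self_affine_measure_def)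

lemma (in integral_self_affine) space_mu [simp]: "space \<mu> = UNIV"
  using sets_eq_imp_space_eq[OF sets_mu] by simp

lemma (in integral_self_affine) measure_self_affine:
  "S \<in> sets borel \<Longrightarrow> measure \<mu> S = (\<Sum>l=1..m. p l * measure \<mu> (ifs_map A a l -` S))"
  using self_affine by (simp add: is_self_affine_measure_def)

lemma (in integral_self_affine) p_pos: "l \<in> {1..m} \<Longrightarrow> 0 < p l"
  and sum_p: "(\<Sum>l=1..m. p l) = 1"
  using prob_vector by (auto simp: strictly_positive_probability_vector_def)

lemma (in integral_self_affine) translations_integer: "l \<in> {1..m} \<Longrightarrow> a l \<in> integer_lattice"
  using ifs by (auto simp: integral_affine_ifs_def integer_lattice_def)

lemma (in integral_self_affine) invertible_A: "invertible A"
  and spectral_radius_A: "matrix_spectral_radius A < 1"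
  using ifs by (auto simp: integral_affine_ifs_def)

lemma (in integral_self_affine) invA_mult: "invA ** A = mat 1" "A ** invA = mat 1"
proof -
  have "A ** matrix_inv A = mat 1 \<and> matrix_inv A ** A = mat 1"
    using invertible_A unfolding matrix_inv_def invertible_def by (rule someI_ex)
  then show "invA ** A = mat 1" "A ** invA = mat 1" by (simp_all add: invA_def)
qed

lemma (in integral_self_affine) invA_cancel [simp]: "invA *v (A *v x) = x" "A *v (invA *v x) = x"
  by (simp_all add: matrix_vector_mul_assoc invA_mult)

lemma (in integral_self_affine) trB_cancel [simp]: "trB *v (trA *v x) = x" "trA *v (trB *v x) = x"
  unfolding matrix_vector_mul_assoc trA_def trB_def matrix_transpose_mul[symmetric] invA_mult by simp_all

lemma (in integral_self_affine) invA_integer: "invA $ i $ j \<in> \<int>"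
  using ifs by (auto simp: integral_affine_ifs_def invA_def)

lemma (in integral_self_affine) invA_lattice: "k \<in> integer_lattice \<Longrightarrow> invA *v k \<in> integer_lattice"
  using invA_integer by (auto simp: integer_lattice_def matrix_vector_mult_def intro!: Ints_sum Ints_mult)

lemma (in integral_self_affine) trB_lattice: "k \<in> integer_lattice \<Longrightarrow> trB *v k \<in> integer_lattice"
proof -
  have "trB $ i $ j \<in> \<int>" for i j using invA_integer by (simp add: trB_def transpose_def)
  then show "k \<in> integer_lattice \<Longrightarrow> trB *v k \<in> integer_lattice"
    by (auto simp: integer_lattice_def matrix_vector_mult_def intro!: Ints_sum Ints_mult)
qed

lemma (in integral_self_affine) trB_pow_lattice: "k \<in> integer_lattice \<Longrightarrow> ((*v) trB ^^ n) k \<in> integer_lattice"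
  by (induction n) (auto intro: trB_lattice)

lemma (in integral_self_affine) trA_trB_pow: "((*v) trA ^^ n) (((*v) trB ^^ n) x) = x"
  by (rule funpow_inverse) simp

lemma (in integral_self_affine) trB_trA_pow: "((*v) trB ^^ n) (((*v) trA ^^ n) x) = x"
  by (rule funpow_inverse) simp

lemma (in integral_self_affine) invA_A_pow: "((*v) invA ^^ n) (((*v) A ^^ n) x) = x"
  by (rule funpow_inverse) simp

lemma (in integral_self_affine) A_invA_pow: "((*v) A ^^ n) (((*v) invA ^^ n) x) = x"
  by (rule funpow_inverse) simp

lemma (in integral_self_affine) inner_trA: "(trA *v \<xi>) \<bullet> x = \<xi> \<bullet> (A *v x)"
  by (simp add: trA_def dot_lmul_matrix)

lemma (in integral_self_affine) inner_trA_pow: "(((*v) trA ^^ n) \<xi>) \<bullet> x = \<xi> \<bullet> (((*v) A ^^ n) x)"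
proof (induction n arbitrary: x)
  case (Suc n)
  then show ?case
    by (simp add: inner_trA funpow_Suc_right[of n "(*v) A"] funpow.simps(2)[of n "(*v) trA"] del: funpow.simps)
qed simp

text \<open>For the transpose, test \<open>y = trA^n x\<close> against itself:
  \<open>y \<bullet> y = x \<bullet> A^n y\<close>. The same \<open>C\<close> and \<open>r\<close>
  then serve both matrices.\<close>

lemma (in integral_self_affine) decay:
  obtains C r where "0 < C" "0 < r" "r < 1" "\<And>n x. norm (((*v) A ^^ n) x) \<le> C * r ^ n * norm x"
    "\<And>n x. norm (((*v) trA ^^ n) x) \<le> C * r ^ n * norm x"
proof -
  obtain C r where C: "0 < C" "0 < r" "r < 1" "\<And>n x. norm (((*v) A ^^ n) x) \<le> C * r ^ n * norm x"
    using spectral_radius_decay[OF spectral_radius_A] by metis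
  have "norm (((*v) trA ^^ n) x) \<le> C * r ^ n * norm x" for n x
  proof (cases "((*v) trA ^^ n) x = 0")
    case False
    let ?y = "((*v) trA ^^ n) x"
    have "norm ?y * norm ?y = ?y \<bullet> ?y" by (simp add: dot_square_norm power2_eq_square)
    also have "\<dots> = x \<bullet> (((*v) A ^^ n) ?y)" by (rule inner_trA_pow)
    also have "\<dots> \<le> norm x * norm (((*v) A ^^ n) ?y)" by (rule norm_cauchy_schwarz)
    also have "\<dots> \<le> norm x * (C * r ^ n * norm ?y)" using C(4) by (intro mult_left_mono) auto
    finally have "norm ?y * norm ?y \<le> (C * r ^ n * norm x) * norm ?y" by (simp add: mult_ac)
    then show ?thesis using False by simp
  qed (use C in auto)
  with C that show thesis by blast
qed

lemma (in integral_self_affine) A_pow_tendsto_0: "(\<lambda>n. ((*v) A ^^ n) x) \<longlonglongrightarrow> 0"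
proof -
  obtain C r where C: "0 < C" "0 < r" "r < 1" "\<And>n x. norm (((*v) A ^^ n) x) \<le> C * r ^ n * norm x"
    using decay by metis
  have "(\<lambda>n. C * r ^ n * norm x) \<longlonglongrightarrow> C * 0 * norm x"
    by (intro tendsto_mult tendsto_const LIMSEQ_realpow_zero) (use C in auto)
  then have "(\<lambda>n. C * r ^ n * norm x) \<longlonglongrightarrow> 0" by simp
  then show ?thesis by (rule Lim_null_comparison[OF always_eventually[OF allI[OF C(4)]]])
qed

lemma (in integral_self_affine) det_A_nonzero: "det A \<noteq> 0"
  using invertible_A invertible_det_nz by blast

lemma (in integral_self_affine) matrix_pow_measurable [measurable]: "((*v) T ^^ n) \<in> borel_measurable borel"
  for T :: "real^'n^'n"
  by (intro borel_measurable_continuous_onI linear_continuous_on linear_conv_bounded_linear[THEN iffD1] linear_funpow_matrix)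

lemma (in integral_self_affine) nn_integral_A_pow:
  "f \<in> borel_measurable borel \<Longrightarrow>
    (\<integral>\<^sup>+x. f x \<partial>lborel) = ennreal (\<bar>det A\<bar> ^ n) * (\<integral>\<^sup>+x. f (((*v) A ^^ n) x) \<partial>lborel)"
proof (induction n)
  case (Suc n)
  then have f[measurable]: "f \<in> borel_measurable borel" by simp
  have "(\<integral>\<^sup>+x. f (((*v) A ^^ n) x) \<partial>lborel) = ennreal \<bar>det A\<bar> * (\<integral>\<^sup>+x. f (((*v) A ^^ n) (A *v x)) \<partial>lborel)"
    by (rule nn_integral_lborel_matrix[OF det_A_nonzero]) measurable
  then show ?case
    using Suc by (simp add: ennreal_mult mult_ac funpow_swap1)
qed simp

lemma (in integral_self_affine) A_pow_image: "((*v) A ^^ n) ` S = ((*v) invA ^^ n) -` S"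
proof (intro set_eqI iffI)
  fix x assume "x \<in> ((*v) invA ^^ n) -` S"
  then have "((*v) A ^^ n) (((*v) invA ^^ n) x) \<in> ((*v) A ^^ n) ` S" by blast
  then show "x \<in> ((*v) A ^^ n) ` S" by (simp only: A_invA_pow)
qed (auto simp: invA_A_pow)

lemma (in integral_self_affine) A_pow_image_measurable:
  "S \<in> sets borel \<Longrightarrow> ((*v) A ^^ n) ` S \<in> sets borel"
  unfolding A_pow_image by (rule measurable_sets_borel[OF matrix_pow_measurable])

lemma (in integral_self_affine) emeasure_A_pow_image:
  assumes S: "S \<in> sets borel"
  shows "emeasure lborel (((*v) A ^^ n) ` S) = ennreal (\<bar>det A\<bar> ^ n) * emeasure lborel S"
proof -
  have "emeasure lborel (((*v) A ^^ n) ` S) = (\<integral>\<^sup>+x. indicator (((*v) A ^^ n) ` S) x \<partial>lborel)"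
    using A_pow_image_measurable[OF S] by simp
  also have "\<dots> = ennreal (\<bar>det A\<bar> ^ n) * (\<integral>\<^sup>+x. indicator (((*v) A ^^ n) ` S) (((*v) A ^^ n) x) \<partial>lborel)"
    using A_pow_image_measurable[OF S] by (intro nn_integral_A_pow) auto
  also have "(\<lambda>x. indicator (((*v) A ^^ n) ` S) (((*v) A ^^ n) x) :: ennreal) = indicator S"
    unfolding A_pow_image by (auto simp: indicator_def invA_A_pow fun_eq_iff)
  finally show ?thesis using S by simp
qed

text \<open>The image of the unit cell under \<open>A^n\<close> has volume \<open>|det A|^n\<close>
  and lies in a cube whose side tends to 0.\<close>

lemma (in integral_self_affine) abs_det_less_1: "\<bar>det A\<bar> < 1"
proof (rule ccontr)
  assume "\<not> \<bar>det A\<bar> < 1"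
  then have ge: "1 \<le> \<bar>det A\<bar> ^ n" for n by (simp add: one_le_power)
  obtain C r where C: "0 < C" "0 < r" "r < 1" "\<And>n x. norm (((*v) A ^^ n) x) \<le> C * r ^ n * norm x"
    using decay by metis
  define b where "b = norm (One :: real^'n)"
  have b: "0 \<le> b" by (simp add: b_def)
  have cell: "norm x \<le> b" if "x \<in> unit_cell" for x :: "real^'n"
    unfolding b_def using subsetD[OF unit_cell_bounds(2) that] by (intro norm_le_componentwise) (auto simp: mem_box)
  have "1 \<le> (2 * (C * r ^ n * b)) ^ DIM(real^'n)" for n
  proof -
    let ?s = "C * r ^ n * b"
    have s: "0 \<le> ?s" using C b by simp
    have sub: "((*v) A ^^ n) ` unit_cell \<subseteq> cbox (- (?s *\<^sub>R One)) (?s *\<^sub>R One)"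
    proof
      fix y assume "y \<in> ((*v) A ^^ n) ` unit_cell"
      then obtain x where x: "x \<in> unit_cell" "y = ((*v) A ^^ n) x" by blast
      have "norm y \<le> C * r ^ n * norm x" using C(4) x by simp
      also have "\<dots> \<le> ?s" using cell[OF x(1)] C by (intro mult_left_mono) auto
      finally have ny: "norm y \<le> ?s" .
      have "\<bar>y \<bullet> j\<bar> \<le> ?s" if "j \<in> Basis" for j using Basis_le_norm[OF that, of y] ny by linarith
      then show "y \<in> cbox (- (?s *\<^sub>R One)) (?s *\<^sub>R One)" by (force simp: mem_box abs_le_iff)
    qed
    have "ennreal 1 \<le> ennreal (\<bar>det A\<bar> ^ n)" using ge by (intro ennreal_leI)
    also have "\<dots> = emeasure lborel (((*v) A ^^ n) ` (unit_cell :: (real^'n) set))"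
      by (simp add: emeasure_A_pow_image emeasure_unit_cell)
    also have "\<dots> \<le> emeasure lborel (cbox (- (?s *\<^sub>R One)) (?s *\<^sub>R One :: real^'n))"
      using sub by (intro emeasure_mono) auto
    also have "\<dots> = ennreal ((2 * ?s) ^ DIM(real^'n))"
    proof (subst emeasure_lborel_cbox)
      have "(?s *\<^sub>R One - - (?s *\<^sub>R One)) \<bullet> j = 2 * ?s" if "j \<in> (Basis :: (real^'n) set)" for j
      proof -
        have "(One :: real^'n) \<bullet> j = 1" using that by simp
        then show ?thesis unfolding inner_diff_left inner_minus_left inner_scaleR_left by simp
      qed
      then show "ennreal (\<Prod>j\<in>Basis. (?s *\<^sub>R One - - (?s *\<^sub>R One :: real^'n)) \<bullet> j) = ennreal ((2 * ?s) ^ DIM(real^'n))"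
        by (simp only: prod.cong[OF refl] prod_constant)
    qed (use s in \<open>auto simp: inner_simps\<close>)
    finally show ?thesis using s by (subst (asm) ennreal_le_iff) auto
  qed
  moreover have "(\<lambda>n. (2 * (C * r ^ n * b)) ^ DIM(real^'n)) \<longlonglongrightarrow> (2 * (C * 0 * b)) ^ DIM(real^'n)"
    by (intro tendsto_power tendsto_mult tendsto_const LIMSEQ_realpow_zero) (use C in auto)
  ultimately have "1 \<le> (2 * (C * 0 * b)) ^ DIM(real^'n)"
    by (intro LIMSEQ_le_const) auto
  then show False by (simp add: zero_power)
qed

section \<open>Integral form of self-affinity, bounded support and the Fourier transform\<close>

lemma (in integral_self_affine) ifs_map_measurable [measurable]: "ifs_map A a l \<in> borel_measurable borel"
  unfolding ifs_map_def by measurable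

text \<open>With \<open>l\<close> drawn from \<open>p\<close> and \<open>x\<close> from
  \<open>\<mu>\<close> independently, \<open>A x + a l\<close> again has law \<open>\<mu>\<close>.
  Writing \<open>\<mu>\<close> as the image of this product measure carries the identity for sets
  over to integrals.\<close>

lemma (in integral_self_affine) integral_self_affine:
  fixes g :: "real^'n \<Rightarrow> 'b::{banach, second_countable_topology}"
  assumes g[measurable]: "g \<in> borel_measurable borel" and bound: "\<And>x. norm (g x) \<le> K"
  shows "(LINT x|\<mu>. g x) = (\<Sum>l=1..m. p l *\<^sub>R (LINT x|\<mu>. g (ifs_map A a l x)))"
proof -
  have sf: "sigma_finite_measure \<mu>" by unfold_locales
  define Q where "Q = point_measure {1..m} (\<lambda>l. ennreal (p l))"
  have p0: "0 \<le> p l" if "l \<in> {1..m}" for l using p_pos[OF that] by simp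
  have "emeasure Q (space Q) = (\<Sum>l=1..m. ennreal (p l))"
    by (simp add: Q_def space_point_measure emeasure_point_measure_finite)
  also have "\<dots> = 1" using p0 sum_p by (subst sum_ennreal) auto
  finally interpret Q: prob_space Q by (rule prob_spaceI)
  interpret pair_sigma_finite Q \<mu> ..
  define h where "h = (\<lambda>(l, x). ifs_map A a l x)"
  have h: "h \<in> borel_measurable (Q \<Otimes>\<^sub>M \<mu>)"
  proof -
    have "h \<in> borel_measurable (count_space {1..m} \<Otimes>\<^sub>M \<mu>)"
      unfolding h_def by (intro measurable_pair_measure_countable1) auto
    moreover have sets_Q: "sets (Q \<Otimes>\<^sub>M \<mu>) = sets (count_space {1..m} \<Otimes>\<^sub>M \<mu>)"
      by (intro sets_pair_measure_cong) (simp_all add: Q_def sets_point_measure)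
    ultimately show ?thesis unfolding measurable_cong_sets[OF sets_Q refl] by blast
  qed
  have \<mu>_eq: "\<mu> = distr (Q \<Otimes>\<^sub>M \<mu>) borel h"
  proof (rule measure_eqI)
    fix S assume "S \<in> sets \<mu>"
    then have S: "S \<in> sets borel" by (simp add: sets_mu)
    have "emeasure (distr (Q \<Otimes>\<^sub>M \<mu>) borel h) S = emeasure (Q \<Otimes>\<^sub>M \<mu>) (h -` S \<inter> space (Q \<Otimes>\<^sub>M \<mu>))"
      using h S by (rule emeasure_distr)
    also have "\<dots> = (\<integral>\<^sup>+l. emeasure \<mu> (Pair l -` (h -` S \<inter> space (Q \<Otimes>\<^sub>M \<mu>))) \<partial>Q)"
      by (rule sigma_finite_measure.emeasure_pair_measure_alt[OF sf measurable_sets[OF h S]])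
    also have "\<dots> = (\<Sum>l=1..m. ennreal (p l) * emeasure \<mu> (Pair l -` (h -` S \<inter> space (Q \<Otimes>\<^sub>M \<mu>))))"
      unfolding Q_def by (rule nn_integral_point_measure_finite) simp
    also have "\<dots> = (\<Sum>l=1..m. ennreal (p l * measure \<mu> (ifs_map A a l -` S)))"
    proof (rule sum.cong[OF refl])
      fix l assume l: "l \<in> {1..m}"
      have "Pair l -` (h -` S \<inter> space (Q \<Otimes>\<^sub>M \<mu>)) = ifs_map A a l -` S"
        using l by (auto simp: h_def space_pair_measure Q_def space_point_measure)
      then show "ennreal (p l) * emeasure \<mu> (Pair l -` (h -` S \<inter> space (Q \<Otimes>\<^sub>M \<mu>)))
          = ennreal (p l * measure \<mu> (ifs_map A a l -` S))"
        using p0[OF l] by (simp add: emeasure_eq_measure ennreal_mult)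
    qed
    also have "\<dots> = ennreal (measure \<mu> S)"
      unfolding measure_self_affine[OF S] using p0 by (intro sum_ennreal) auto
    finally show "emeasure \<mu> S = emeasure (distr (Q \<Otimes>\<^sub>M \<mu>) borel h) S"
      by (simp add: emeasure_eq_measure)
  qed (simp add: sets_mu)
  have int: "integrable \<mu> g"
    by (rule integrable_const_bound[where B = K]) (use bound in auto)
  then have "integrable (Q \<Otimes>\<^sub>M \<mu>) (\<lambda>z. g (h z))"
    by (subst (asm) \<mu>_eq, subst (asm) integrable_distr_eq) (use h in auto)
  from integral_fst'[OF this] have "(LINT l|Q. (LINT x|\<mu>. g (h (l, x)))) = (LINT z|(Q \<Otimes>\<^sub>M \<mu>). g (h z))" .
  also have "\<dots> = (LINT x|distr (Q \<Otimes>\<^sub>M \<mu>) borel h. g x)"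
    using h by (subst integral_distr) auto
  also have "\<dots> = (LINT x|\<mu>. g x)" using \<mu>_eq by simp
  also have "(LINT l|Q. (LINT x|\<mu>. g (h (l, x)))) = (\<Sum>l=1..m. p l *\<^sub>R (LINT x|\<mu>. g (h (l, x))))"
    unfolding Q_def using p0 by (intro lebesgue_integral_point_measure_finite) auto
  finally show ?thesis by (simp add: h_def)
qed

text \<open>Each map sends \<open>{x. N x \<le> s}\<close> into
  \<open>{x. N x \<le> \<theta> * s + \<alpha>}\<close>, so the mass \<open>g s\<close> does not
  decrease under \<open>s \<mapsto> \<theta> * s + \<alpha>\<close>. Iteration drives every
  \<open>s\<close> towards the fixed point \<open>t\<close>; as the iterates only approach it, the
  radius taken is \<open>t + 1\<close>.\<close>

lemma (in integral_self_affine) bounded_support: "\<exists>R>0. AE x in \<mu>. norm x \<le> R"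
proof -
  obtain N :: "real^'n \<Rightarrow> real" and \<theta> C where N: "0 < \<theta>" "\<theta> < 1" "0 < C" "\<And>x. norm x \<le> N x" "\<And>x. N x \<le> C * norm x"
    "\<And>x y. N (x + y) \<le> N x + N y" "\<And>x. N (A *v x) \<le> \<theta> * N x" "continuous_on UNIV N"
    using adapted_norm[OF spectral_radius_A] by metis
  have N0: "0 \<le> N x" for x using N(4)[of x] norm_ge_zero[of x] by linarith
  have Nm[measurable]: "N \<in> borel_measurable borel" using N(8) by (rule borel_measurable_continuous_onI)
  define \<alpha> where "\<alpha> = (\<Sum>l=1..m. N (a l))"
  have \<alpha>: "N (a l) \<le> \<alpha>" if "l \<in> {1..m}" for l
    unfolding \<alpha>_def using N0 that by (intro member_le_sum) auto
  define g where "g s = measure \<mu> {x. N x \<le> s}" for s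
  have lev: "{x. N x \<le> s} \<in> sets borel" for s by measurable
  have step: "g s \<le> g (\<theta> * s + \<alpha>)" for s
  proof -
    have "g s = (\<Sum>l=1..m. p l * g s)" by (simp add: sum_p del: One_nat_def flip: sum_distrib_right)
    also have "\<dots> \<le> (\<Sum>l=1..m. p l * measure \<mu> (ifs_map A a l -` {x. N x \<le> \<theta> * s + \<alpha>}))"
    proof (intro sum_mono mult_left_mono)
      fix l assume l: "l \<in> {1..m}"
      show "0 \<le> p l" using p_pos[OF l] by simp
      show "g s \<le> measure \<mu> (ifs_map A a l -` {x. N x \<le> \<theta> * s + \<alpha>})"
        unfolding g_def
      proof (rule finite_measure_mono)
        show "{x. N x \<le> s} \<subseteq> ifs_map A a l -` {x. N x \<le> \<theta> * s + \<alpha>}"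
        proof
          fix x assume "x \<in> {x. N x \<le> s}"
          then have "\<theta> * N x \<le> \<theta> * s" using N(1) by simp
          then have "N (A *v x + a l) \<le> \<theta> * s + \<alpha>"
            using N(6)[of "A *v x" "a l"] N(7)[of x] \<alpha>[OF l] by linarith
          then show "x \<in> ifs_map A a l -` {x. N x \<le> \<theta> * s + \<alpha>}" by (simp add: ifs_map_def)
        qed
        show "ifs_map A a l -` {x. N x \<le> \<theta> * s + \<alpha>} \<in> sets \<mu>"
          unfolding sets_mu by (rule measurable_sets_borel[OF ifs_map_measurable lev])
      qed
    qed
    also have "\<dots> = g (\<theta> * s + \<alpha>)" unfolding g_def by (rule measure_self_affine[OF lev, symmetric])
    finally show ?thesis .
  qed
  define t where "t = \<alpha> / (1 - \<theta>)"
  have t: "\<theta> * t + \<alpha> = t" using N(2) by (simp add: t_def field_simps)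
  have t0: "0 \<le> t" using N(2) N0 by (auto simp: t_def \<alpha>_def intro!: divide_nonneg_pos sum_nonneg)
  have iter: "g s \<le> g (\<theta> ^ n * (s - t) + t)" for s n
  proof (induction n)
    case (Suc n)
    have "\<theta> * (\<theta> ^ n * (s - t) + t) + \<alpha> = \<theta> ^ Suc n * (s - t) + t" using t by (simp add: algebra_simps)
    then show ?case using Suc step[of "\<theta> ^ n * (s - t) + t"] by simp
  qed simp
  have mono: "g s \<le> g s'" if "s \<le> s'" for s s'
    unfolding g_def using that lev by (intro finite_measure_mono) (auto simp: sets_mu)
  have le: "g s \<le> g (t + 1)" for s
  proof -
    have "(\<lambda>n. \<theta> ^ n * (s - t)) \<longlonglongrightarrow> 0 * (s - t)"
      by (intro tendsto_mult tendsto_const LIMSEQ_realpow_zero) (use N in auto)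
    then have "\<forall>\<^sub>F n in sequentially. \<theta> ^ n * (s - t) < 1" by (intro order_tendstoD) auto
    then obtain n where "\<theta> ^ n * (s - t) < 1" by (auto simp: eventually_sequentially)
    then show ?thesis using iter[of s n] mono[of "\<theta> ^ n * (s - t) + t" "t + 1"] by linarith
  qed
  have "(\<lambda>n. measure \<mu> {x. N x \<le> real n}) \<longlonglongrightarrow> measure \<mu> (\<Union>n. {x. N x \<le> real n})"
    by (rule finite_Lim_measure_incseq) (use lev in \<open>auto simp: sets_mu incseq_def\<close>)
  also have "(\<Union>n. {x. N x \<le> real n}) = space \<mu>" using real_arch_simple by auto
  finally have "(\<lambda>n. measure \<mu> {x. N x \<le> real n}) \<longlonglongrightarrow> 1" by (simp only: prob_space)
  then have "1 \<le> g (t + 1)" using le by (intro LIMSEQ_le_const2) (auto simp: g_def)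
  then have "g (t + 1) = 1" using prob_le_1 by (simp add: g_def order_antisym)
  then have "AE x in \<mu>. x \<in> {x. N x \<le> t + 1}"
    unfolding g_def using lev by (subst (asm) prob_eq_1) (auto simp: sets_mu)
  then have "AE x in \<mu>. norm x \<le> t + 1"
    by (rule eventually_mono) (use N(4) order.trans in blast)
  with t0 show ?thesis by (intro exI[of _ "t + 1"]) auto
qed

lemma (in integral_self_affine) character_integrable: "integrable \<mu> (character \<xi>)"
  by (rule integrable_const_bound[where B = 1]) auto

lemma (in integral_self_affine) ft_0: "ft 0 = 1"
  using prob_space by (simp add: fourier_transform_character)

lemma (in integral_self_affine) norm_ft_le_1: "cmod (ft \<xi>) \<le> 1"
proof -
  have "cmod (ft \<xi>) \<le> (LINT x|\<mu>. cmod (character \<xi> x))"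
    unfolding fourier_transform_character by (rule integral_norm_bound)
  then show ?thesis using prob_space by simp
qed

lemma (in integral_self_affine) ft_lipschitz:
  obtains L where "0 < L" "\<And>\<xi> \<eta>. cmod (ft (\<xi> + \<eta>) - ft \<xi>) \<le> L * norm \<eta>"
proof -
  obtain R where R: "R > 0" "AE x in \<mu>. norm x \<le> R" using bounded_support by blast
  have "cmod (ft (\<xi> + \<eta>) - ft \<xi>) \<le> 2 * pi * R * norm \<eta>" for \<xi> \<eta>
  proof -
    have "ft (\<xi> + \<eta>) - ft \<xi> = (LINT x|\<mu>. character (\<xi> + \<eta>) x - character \<xi> x)"
      unfolding fourier_transform_character
      by (rule Bochner_Integration.integral_diff[symmetric]) (rule character_integrable)+
    also have "cmod \<dots> \<le> (LINT x|\<mu>. cmod (character (\<xi> + \<eta>) x - character \<xi> x))"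
      by (rule integral_norm_bound)
    also have "\<dots> \<le> (LINT x|\<mu>. 2 * pi * R * norm \<eta>)"
    proof (rule integral_mono_AE)
      show "AE x in \<mu>. cmod (character (\<xi> + \<eta>) x - character \<xi> x) \<le> 2 * pi * R * norm \<eta>"
        using R(2)
      proof eventually_elim
        fix x :: "real^'n" assume x: "norm x \<le> R"
        have "cmod (character (\<xi> + \<eta>) x - character \<xi> x) = cmod (character \<xi> x * (character \<eta> x - 1))"
          by (simp add: character_add_left right_diff_distrib)
        also have "\<dots> = cmod (character \<eta> x - 1)" by (simp only: norm_mult norm_character mult_1)
        also have "\<dots> \<le> 2 * pi * (norm \<eta> * norm x)" by (rule norm_character_diff_1_le)
        also have "\<dots> \<le> 2 * pi * (norm \<eta> * R)" using x by (intro mult_left_mono) auto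
        finally show "cmod (character (\<xi> + \<eta>) x - character \<xi> x) \<le> 2 * pi * R * norm \<eta>" by (simp add: mult_ac)
      qed
    qed (auto intro!: integrable_norm Bochner_Integration.integrable_diff character_integrable)
    also have "\<dots> = 2 * pi * R * norm \<eta>" using prob_space by simp
    finally show ?thesis .
  qed
  moreover have "0 < 2 * pi * R" using R by simp
  ultimately show thesis using that by blast
qed

lemma (in integral_self_affine) mask_periodic: "k \<in> integer_lattice \<Longrightarrow> mask (\<xi> + k) = mask \<xi>"
  unfolding mask_def by (intro sum.cong refl) (simp add: character_add_left character_integer translations_integer)

lemma (in integral_self_affine) mask_0: "mask 0 = 1"
  unfolding mask_def by (simp add: sum_p del: One_nat_def flip: of_real_sum)

lemma (in integral_self_affine) ft_refinement: "ft \<xi> = mask \<xi> * ft (trA *v \<xi>)"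
proof -
  have "ft \<xi> = (\<Sum>l=1..m. p l *\<^sub>R (LINT x|\<mu>. character \<xi> (ifs_map A a l x)))"
    unfolding fourier_transform_character by (rule integral_self_affine[where K = 1]) auto
  also have "\<dots> = (\<Sum>l=1..m. p l *\<^sub>R (character \<xi> (a l) * ft (trA *v \<xi>)))"
  proof (intro sum.cong refl arg_cong[where f = "\<lambda>z. _ *\<^sub>R z"])
    fix l
    have "character \<xi> (ifs_map A a l x) = character \<xi> (a l) * character (trA *v \<xi>) x" for x
      unfolding ifs_map_def character_add_right by (simp add: character_def inner_trA)
    then show "(LINT x|\<mu>. character \<xi> (ifs_map A a l x)) = character \<xi> (a l) * ft (trA *v \<xi>)"
      by (simp add: fourier_transform_character)
  qed
  also have "\<dots> = mask \<xi> * ft (trA *v \<xi>)"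
    by (simp add: mask_def sum_distrib_left scaleR_conv_of_real mult_ac)
  finally show ?thesis .
qed

lemma (in integral_self_affine) ft_iterate:
  "ft \<xi> = (\<Prod>i<n. mask (((*v) trA ^^ i) \<xi>)) * ft (((*v) trA ^^ n) \<xi>)"
proof (induction n)
  case (Suc n)
  then show ?case using ft_refinement[of "((*v) trA ^^ n) \<xi>"] by (simp add: mult_ac)
qed simp

text \<open>\<open>trA^i\<close> maps \<open>trB^n y\<close> to the lattice point
  \<open>trB^(n-i) y\<close>, to which the periodic mask is blind. So the first \<open>n\<close>
  factors are those of \<open>\<xi>\<close>, and only the remaining one sees
  \<open>y\<close>.\<close>

lemma (in integral_self_affine) ft_shift:
  assumes y: "y \<in> integer_lattice"
  shows "ft (\<xi> + ((*v) trB ^^ n) y) = (\<Prod>i<n. mask (((*v) trA ^^ i) \<xi>)) * ft (((*v) trA ^^ n) \<xi> + y)"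
proof -
  have shift: "((*v) trA ^^ i) (\<xi> + ((*v) trB ^^ n) y) = ((*v) trA ^^ i) \<xi> + ((*v) trB ^^ (n - i)) y" if "i \<le> n" for i
  proof -
    have "((*v) trB ^^ n) y = ((*v) trB ^^ i) (((*v) trB ^^ (n - i)) y)"
      using that by (metis comp_apply funpow_add le_add_diff_inverse)
    then show ?thesis by (simp add: linear_add[OF linear_funpow_matrix] trA_trB_pow)
  qed
  have "mask (((*v) trA ^^ i) (\<xi> + ((*v) trB ^^ n) y)) = mask (((*v) trA ^^ i) \<xi>)" if "i < n" for i
    using that shift[of i] by (simp add: mask_periodic trB_pow_lattice[OF y])
  then show ?thesis
    using ft_iterate[of "\<xi> + ((*v) trB ^^ n) y" n] shift[of n] by simp
qed

lemma (in integral_self_affine) ft_trB_pow: "k \<in> integer_lattice \<Longrightarrow> ft (((*v) trB ^^ n) k) = ft k"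
proof -
  have "((*v) trA ^^ i) 0 = 0" for i by (rule linear_0[OF linear_funpow_matrix])
  then show "k \<in> integer_lattice \<Longrightarrow> ft (((*v) trB ^^ n) k) = ft k"
    using ft_shift[of k 0 n] by (simp add: mask_0)
qed

text \<open>Both points share the product of masks, which is at least \<open>cmod (ft \<xi>)\<close>
  because the remaining factor in \<open>ft_iterate\<close> has modulus at most 1. Being
  multiplicative, the estimate can be iterated over digits.\<close>

lemma (in integral_self_affine) norm_ft_shift_ge:
  assumes y: "y \<in> integer_lattice"
  shows "cmod (ft \<xi>) * cmod (ft (((*v) trA ^^ n) \<xi> + y)) \<le> cmod (ft (\<xi> + ((*v) trB ^^ n) y))"
proof -
  let ?P = "\<Prod>i<n. mask (((*v) trA ^^ i) \<xi>)"
  have "cmod (ft \<xi>) = cmod ?P * cmod (ft (((*v) trA ^^ n) \<xi>))"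
    using ft_iterate[of \<xi> n] by (simp add: norm_mult)
  also have "\<dots> \<le> cmod ?P * 1" by (intro mult_left_mono norm_ft_le_1) auto
  finally have "cmod (ft \<xi>) \<le> cmod ?P" by simp
  then show ?thesis unfolding ft_shift[OF y] norm_mult by (intro mult_right_mono) auto
qed

lemma (in integral_self_affine) trB_pow_unbounded:
  assumes "k \<noteq> 0"
  shows "\<exists>n. R < norm (((*v) trB ^^ n) k)"
proof -
  obtain C r where C: "0 < C" "0 < r" "r < 1" "\<And>n x. norm (((*v) trA ^^ n) x) \<le> C * r ^ n * norm x"
    using decay by metis
  have "(\<lambda>n. C * r ^ n * R) \<longlonglongrightarrow> C * 0 * R"
    by (intro tendsto_mult tendsto_const LIMSEQ_realpow_zero) (use C in auto)
  then have "\<forall>\<^sub>F n in sequentially. C * r ^ n * R < norm k"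
    using assms by (intro order_tendstoD) auto
  then obtain n where n: "C * r ^ n * R < norm k" by (auto simp: eventually_sequentially)
  also have "norm k \<le> C * r ^ n * norm (((*v) trB ^^ n) k)"
    using C(4)[of n "((*v) trB ^^ n) k"] by (simp add: trA_trB_pow)
  finally have "R < norm (((*v) trB ^^ n) k)" using C by (simp add: mult_less_cancel_left)
  then show ?thesis ..
qed

section \<open>Decay, absolute continuity and vanishing coefficients\<close>

lemma (in integral_self_affine) coefficients_vanish:
  assumes decay: "\<And>e. 0 < e \<Longrightarrow> \<exists>R. \<forall>\<xi>. R < norm \<xi> \<longrightarrow> cmod (ft \<xi>) < e"
    and k: "k \<in> integer_lattice" "k \<noteq> 0"
  shows "ft k = 0"
proof (rule ccontr)
  assume "ft k \<noteq> 0"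
  then obtain R where R: "\<And>\<xi>. R < norm \<xi> \<Longrightarrow> cmod (ft \<xi>) < cmod (ft k)"
    using decay[of "cmod (ft k)"] by auto
  obtain n where "R < norm (((*v) trB ^^ n) k)" using trB_pow_unbounded[OF k(2)] by blast
  then show False using R ft_trB_pow[OF k(1), of n] by fastforce
qed

lemma (in integral_self_affine) absolutely_continuous_density:
  assumes "absolutely_continuous lborel \<mu>"
  obtains f where "f \<in> borel_measurable borel" "\<And>x. 0 \<le> f x" "\<mu> = density lborel (\<lambda>x. ennreal (f x))"
proof -
  have fin: "AE x in lborel. RN_deriv lborel \<mu> x \<noteq> \<infinity>"
    by (rule sigma_finite_measure.RN_deriv_finite[OF sigma_finite_lborel]) (use assms sigma_finite_measure_axioms in \<open>auto simp: sets_mu\<close>)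
  have "\<mu> = density lborel (RN_deriv lborel \<mu>)"
    using sigma_finite_measure.density_RN_deriv[OF sigma_finite_lborel assms] by (simp add: sets_mu)
  also have "\<dots> = density lborel (\<lambda>x. ennreal (enn2real (RN_deriv lborel \<mu> x)))"
    by (rule density_cong) (use fin in \<open>auto simp: less_top[symmetric]\<close>)
  finally show thesis using that[of "\<lambda>x. enn2real (RN_deriv lborel \<mu> x)"] by simp
qed

lemma (in integral_self_affine) integrable_density:
  assumes f: "f \<in> borel_measurable borel" "\<And>x. 0 \<le> f x" "\<mu> = density lborel (\<lambda>x. ennreal (f x))"
  shows "integrable lborel f" "integral\<^sup>L lborel f = 1" "ft \<xi> = (LINT x|lborel. of_real (f x) * character \<xi> x)"
proof -
  have "integrable (density lborel (\<lambda>x. ennreal (f x))) (\<lambda>_. 1 :: real)"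
    unfolding f(3)[symmetric] by simp
  then show "integrable lborel f"
    by (subst (asm) integrable_density) (use f in auto)
  have "(LINT x|density lborel (\<lambda>x. ennreal (f x)). 1) = (1 :: real)"
    unfolding f(3)[symmetric] using prob_space by simp
  then show "integral\<^sup>L lborel f = 1"
    by (subst (asm) integral_density) (use f in auto)
  have "ft \<xi> = (LINT x|density lborel (\<lambda>x. ennreal (f x)). character \<xi> x)"
    unfolding fourier_transform_character f(3)[symmetric] ..
  also have "\<dots> = (LINT x|lborel. of_real (f x) * character \<xi> x)"
    by (subst integral_density) (use f in \<open>auto simp: scaleR_conv_of_real\<close>)
  finally show "ft \<xi> = (LINT x|lborel. of_real (f x) * character \<xi> x)" .
qed

lemma (in integral_self_affine) absolutely_continuous_imp_coefficients_vanish: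
  assumes "absolutely_continuous lborel \<mu>" "k \<in> integer_lattice" "k \<noteq> 0"
  shows "ft k = 0"
proof -
  obtain f where f: "f \<in> borel_measurable borel" "\<And>x. 0 \<le> f x" "\<mu> = density lborel (\<lambda>x. ennreal (f x))"
    using absolutely_continuous_density[OF assms(1)] by blast
  show ?thesis
    by (rule coefficients_vanish[OF _ assms(2,3)])
      (use riemann_lebesgue[OF integrable_density(1)[OF f]] integrable_density(3)[OF f] in auto)
qed

lemma (in integral_self_affine) power_decay_imp_coefficients_vanish:
  assumes "power_fourier_decay \<mu>" "k \<in> integer_lattice" "k \<noteq> 0"
  shows "ft k = 0"
proof (rule coefficients_vanish[OF _ assms(2,3)])
  fix e :: real assume "0 < e"
  obtain \<alpha> where \<alpha>: "\<alpha> > 0" "(\<lambda>\<xi>. cmod (ft \<xi>)) \<in> O[at_infinity](\<lambda>\<xi>. norm \<xi> powr (- \<alpha>))"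
    using assms(1) by (auto simp: power_fourier_decay_def)
  then obtain c where c: "c > 0" "\<forall>\<^sub>F \<xi> in at_infinity. norm (cmod (ft \<xi>)) \<le> c * norm (norm \<xi> powr (- \<alpha>))"
    by (auto elim!: landau_o.bigE)
  have "((\<lambda>t. c * t powr (- \<alpha>)) \<longlongrightarrow> c * 0) at_top"
    using \<alpha>(1) by (intro tendsto_mult tendsto_const tendsto_neg_powr filterlim_ident) auto
  then have "\<forall>\<^sub>F t in at_top. c * t powr (- \<alpha>) < e" using \<open>0 < e\<close> by (intro order_tendstoD) auto
  then have "\<forall>\<^sub>F \<xi> in at_infinity. c * norm (\<xi> :: real^'n) powr (- \<alpha>) < e"
    by (rule eventually_compose_filterlim) (rule filterlim_norm_at_top)
  with c(2) have "\<forall>\<^sub>F \<xi> in at_infinity. cmod (ft \<xi>) < e"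
    by eventually_elim simp
  then obtain R where "\<And>\<xi>. R \<le> norm \<xi> \<Longrightarrow> cmod (ft \<xi>) < e" by (auto simp: eventually_at_infinity)
  then show "\<exists>R. \<forall>\<xi>. R < norm \<xi> \<longrightarrow> cmod (ft \<xi>) < e" by (intro exI[of _ R]) auto
qed

lemma (in integral_self_affine) vanishing_imp_absolutely_continuous:
  assumes "\<And>k. k \<in> integer_lattice \<Longrightarrow> k \<noteq> 0 \<Longrightarrow> ft k = 0"
  shows "absolutely_continuous lborel \<mu>"
proof -
  have "emeasure \<mu> S = 0" if "S \<in> null_sets lborel" for S
  proof -
    have "emeasure \<mu> S \<le> emeasure lborel S"
      using that by (intro emeasure_le_lborel[OF prob_space_axioms sets_mu assms]) auto
    then show ?thesis using that by auto
  qed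
  then show ?thesis by (auto simp: absolutely_continuous_def null_sets_def sets_mu)
qed

section \<open>Autocorrelation of a bounded density\<close>

lemma finite_lattice_ball: "finite {z \<in> integer_lattice. norm (z :: real^'n) \<le> R}"
proof (rule finite_subset)
  let ?I = "{- \<lceil>R\<rceil>..\<lceil>R\<rceil>}"
  show "finite ((\<lambda>f. \<chi> i. real_of_int (f i)) ` (UNIV \<rightarrow>\<^sub>E ?I) :: (real^'n) set)"
    by (intro finite_imageI finite_PiE) auto
  show "{z \<in> integer_lattice. norm (z :: real^'n) \<le> R} \<subseteq> (\<lambda>f. \<chi> i. real_of_int (f i)) ` (UNIV \<rightarrow>\<^sub>E ?I)"
  proof
    fix z :: "real^'n" assume z: "z \<in> {z \<in> integer_lattice. norm z \<le> R}"
    have "z = (\<chi> i. real_of_int \<lfloor>z $ i\<rfloor>)" using z by (simp add: vec_eq_iff integer_lattice_def)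
    moreover have "(\<lambda>i. \<lfloor>z $ i\<rfloor>) \<in> UNIV \<rightarrow>\<^sub>E ?I"
    proof (intro PiE_I)
      fix i
      have "\<bar>z $ i\<bar> \<le> R" using z component_le_norm_cart[of z i] by auto
      then have "z $ i \<le> R" "- R \<le> z $ i" by auto
      then show "\<lfloor>z $ i\<rfloor> \<in> ?I" by (simp add: le_floor_iff floor_le_iff) linarith
    qed auto
    ultimately show "z \<in> (\<lambda>f. \<chi> i. real_of_int (f i)) ` (UNIV \<rightarrow>\<^sub>E ?I)" by (rule image_eqI)
  qed
qed

context integral_self_affine
begin

text \<open>The bounds hold at every point and not only almost everywhere, so that later estimates
  are pointwise.\<close>

definition has_density :: "(real^'n \<Rightarrow> real) \<Rightarrow> real \<Rightarrow> bool" where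
  "has_density f R \<longleftrightarrow> f \<in> borel_measurable borel \<and> (\<forall>x. 0 \<le> f x \<and> f x \<le> 1) \<and> (\<forall>x. R < norm x \<longrightarrow> f x = 0)
    \<and> 0 < R \<and> \<mu> = density lborel (\<lambda>x. ennreal (f x))"

lemma vanishing_imp_bounded_density:
  assumes zero: "\<And>k. k \<in> integer_lattice \<Longrightarrow> k \<noteq> 0 \<Longrightarrow> ft k = 0"
  obtains f R where "has_density f R"
proof -
  obtain g where g: "g \<in> borel_measurable borel" "\<And>x. 0 \<le> g x" "\<mu> = density lborel (\<lambda>x. ennreal (g x))"
    using absolutely_continuous_density[OF vanishing_imp_absolutely_continuous[OF zero]] by blast
  note [measurable] = g(1)
  have gi: "integrable lborel g" by (rule integrable_density(1)[OF g])
  \<comment> \<open>On \<open>S\<close> the density exceeds 1 although the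
    \<open>\<mu>\<close>-measure of \<open>S\<close> is at most its Lebesgue measure. So
    \<open>g - 1\<close>, which is positive on \<open>S\<close>, has integral 0 there, and
    \<open>S\<close> is null.\<close>
  define S where "S = {x. 1 < g x}"
  have S[measurable]: "S \<in> sets borel" unfolding S_def by measurable
  have "emeasure lborel S = (\<integral>\<^sup>+x. indicator S x \<partial>lborel)" by simp
  also have "\<dots> \<le> (\<integral>\<^sup>+x. ennreal (g x) \<partial>lborel)"
    by (intro nn_integral_mono) (auto simp: indicator_def S_def)
  also have "\<dots> < \<infinity>" using gi g(2) by (simp add: nn_integral_eq_integral)
  finally have Sfin: "emeasure lborel S < \<infinity>" .
  have int: "integrable lborel (\<lambda>x. indicator S x * g x)" "integrable lborel (indicat_real S)"
    using gi Sfin integrable_real_mult_indicator[of S lborel g]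
    by (auto intro: integrable_real_indicator simp: mult.commute)
  have mS: "measure \<mu> S = (LINT x|lborel. indicator S x * g x)"
  proof -
    have "measure \<mu> S = (LINT x|density lborel (\<lambda>x. ennreal (g x)). indicator S x)"
      unfolding g(3)[symmetric] by (simp add: sets_mu)
    also have "\<dots> = (LINT x|lborel. indicator S x * g x)"
      by (subst integral_density) (use g in \<open>auto simp: mult.commute\<close>)
    finally show ?thesis .
  qed
  have "ennreal (measure \<mu> S) \<le> ennreal (measure lborel S)"
    using emeasure_le_lborel[OF prob_space_axioms sets_mu zero S] Sfin
    by (simp add: emeasure_eq_measure emeasure_eq_ennreal_measure)
  then have "measure \<mu> S \<le> measure lborel S" by simp
  then have "(LINT x|lborel. indicator S x * g x - indicat_real S x) \<le> 0"
    using int S by (simp add: mS[symmetric])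
  moreover have nonneg: "0 \<le> indicator S x * g x - indicat_real S x" for x by (auto simp: indicator_def S_def)
  ultimately have "(LINT x|lborel. indicator S x * g x - indicat_real S x) = 0"
    by (intro order_antisym integral_nonneg_AE) auto
  then have "AE x in lborel. indicator S x * g x - indicat_real S x = 0"
    using int nonneg by (subst (asm) integral_nonneg_eq_0_iff_AE) auto
  then have le1: "AE x in lborel. g x \<le> 1"
    by eventually_elim (auto simp: S_def indicator_def split: if_splits)
  obtain R where R: "R > 0" "AE x in \<mu>. norm x \<le> R" using bounded_support by blast
  have "AE x in lborel. 0 < ennreal (g x) \<longrightarrow> norm x \<le> R"
  proof -
    have "AE x in density lborel (\<lambda>x. ennreal (g x)). norm x \<le> R"
      unfolding g(3)[symmetric] by (rule R(2))
    then show ?thesis by (subst (asm) AE_density) auto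
  qed
  with le1 have ae: "AE x in lborel. g x = (if norm x \<le> R then min 1 (g x) else 0)"
  proof eventually_elim
    case (elim x)
    show ?case
    proof (cases "norm x \<le> R")
      case False
      with elim have "g x \<le> 0" by (simp add: not_less)
      with False g(2)[of x] show ?thesis by simp
    qed (use elim in simp)
  qed
  \<comment> \<open>By \<open>ae\<close> this differs from \<open>g\<close> only on a null
    set.\<close>
  define f where "f x = (if norm x \<le> R then min 1 (g x) else 0)" for x
  have [measurable]: "f \<in> borel_measurable borel" unfolding f_def by measurable
  have "AE x in lborel. ennreal (g x) = ennreal (f x)"
    using ae by eventually_elim (simp only: f_def)
  then have "density lborel (\<lambda>x. ennreal (g x)) = density lborel (\<lambda>x. ennreal (f x))"
    by (intro density_cong) auto
  then have "\<mu> = density lborel (\<lambda>x. ennreal (f x))" using g(3) by (rule trans[rotated])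
  moreover have "0 \<le> f x \<and> f x \<le> 1" "R < norm x \<longrightarrow> f x = 0" for x
    using g(2)[of x] by (auto simp: f_def)
  ultimately have "has_density f R" unfolding has_density_def using R(1) \<open>f \<in> borel_measurable borel\<close> by blast
  then show thesis by (rule that)
qed

text \<open>For the density \<open>f\<close> of \<open>\<mu>\<close> this is the density of the
  difference of two independent points with law \<open>\<mu>\<close>; its value at 0 is the squared
  L2 norm of \<open>f\<close>.\<close>

definition autocorrelation :: "(real^'n \<Rightarrow> real) \<Rightarrow> real^'n \<Rightarrow> real" where
  "autocorrelation f t = (LINT x|lborel. f x * f (x + t))"

end

locale bounded_density = integral_self_affine A m a p \<mu>
  for A :: "real^'n^'n" and m a p \<mu> +
  fixes f :: "real^'n \<Rightarrow> real" and R :: real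
  assumes has_density: "has_density f R"

lemma (in bounded_density) f_measurable [measurable]: "f \<in> borel_measurable borel"
  and f_nonneg: "0 \<le> f x" and f_le_1: "f x \<le> 1" and f_support: "R < norm x \<Longrightarrow> f x = 0" and R_pos: "0 < R"
  and mu_density: "\<mu> = density lborel (\<lambda>x. ennreal (f x))"
  using has_density by (auto simp: has_density_def)

lemma (in bounded_density) f_integrable: "integrable lborel f"
  and f_integral: "integral\<^sup>L lborel f = 1"
  and ft_f: "ft \<xi> = (LINT x|lborel. of_real (f x) * character \<xi> x)"
  using integrable_density[OF f_measurable f_nonneg mu_density] by auto

section \<open>The refinement equation of the autocorrelation\<close>

lemma (in bounded_density) integrable_f_mult:
  assumes [measurable]: "g \<in> borel_measurable borel" and "\<And>x. \<bar>g x\<bar> \<le> 1"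
  shows "integrable lborel (\<lambda>x. f x * g x)"
proof (rule Bochner_Integration.integrable_bound[OF f_integrable])
  show "AE x in lborel. norm (f x * g x) \<le> norm (f x)"
    using assms(2) by (intro AE_I2) (simp add: abs_mult mult_left_le)
qed measurable

lemma (in bounded_density) integral_mu:
  fixes g :: "real^'n \<Rightarrow> real"
  assumes [measurable]: "g \<in> borel_measurable borel"
  shows "(LINT x|\<mu>. g x) = (LINT x|lborel. f x * g x)"
  by (subst mu_density, subst integral_density) (auto simp: f_nonneg)

lemma (in bounded_density) autocorrelation_mu: "autocorrelation f t = (LINT x|\<mu>. f (x + t))"
  by (subst integral_mu) (auto simp: autocorrelation_def)

lemma (in bounded_density) autocorrelation_even: "autocorrelation f (- t) = autocorrelation f t"
proof -
  have "autocorrelation f (- t) = (LINT x|lborel. f (x + t) * f (x + t + - t))"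
    unfolding autocorrelation_def by (rule integral_translate[symmetric]) measurable
  then show ?thesis by (simp add: autocorrelation_def mult.commute)
qed

lemma (in bounded_density) autocorrelation_bounds: "0 \<le> autocorrelation f t" "autocorrelation f t \<le> 1"
proof -
  show "0 \<le> autocorrelation f t"
    unfolding autocorrelation_def by (intro integral_nonneg_AE) (simp add: f_nonneg)
  have "autocorrelation f t \<le> (LINT x|lborel. f x)"
    unfolding autocorrelation_def using f_integrable
    by (intro integral_mono integrable_f_mult) (auto simp: f_nonneg f_le_1 abs_le_iff order.trans[OF _ f_nonneg] mult_left_le)
  then show "autocorrelation f t \<le> 1" by (simp add: f_integral)
qed

lemma (in bounded_density) autocorrelation_far: "2 * R < norm t \<Longrightarrow> autocorrelation f t = 0"
proof -
  assume t: "2 * R < norm t"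
  have "f x * f (x + t) = 0" for x
  proof (cases "R < norm x")
    case False
    have "norm t \<le> norm (x + t) + norm x" using norm_triangle_ineq4[of "x + t" x] by simp
    then have "R < norm (x + t)" using t False by linarith
    then show ?thesis by (simp add: f_support)
  qed (simp add: f_support)
  then show ?thesis unfolding autocorrelation_def by (simp only: Bochner_Integration.integral_zero)
qed

text \<open>Substituting \<open>y = A x\<close> moves the matrix, inverted, to the other factor. A
  further use of self-affinity in \<open>y\<close> removes it, because \<open>invA\<close> maps
  \<open>A x + a k\<close> to \<open>x + invA (a k)\<close>.\<close>

lemma (in bounded_density) autocorrelation_substitution:
  "(LINT x|\<mu>. f (A *v x + s)) = 1 / \<bar>det A\<bar> * (\<Sum>k=1..m. p k * autocorrelation f (invA *v a k - invA *v s))"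
proof -
  define G where "G y = f (invA *v y) * f (y + s)" for y
  have [measurable]: "G \<in> borel_measurable borel" unfolding G_def by measurable
  have G0: "0 \<le> G y" for y by (simp add: G_def f_nonneg)
  have "(LINT y|lborel. G y) = enn2real (\<integral>\<^sup>+y. ennreal (G y) \<partial>lborel)"
    by (rule integral_eq_nn_integral) (auto simp: G0)
  also have "\<dots> = \<bar>det A\<bar> * enn2real (\<integral>\<^sup>+x. ennreal (G (A *v x)) \<partial>lborel)"
    by (subst nn_integral_lborel_matrix[OF det_A_nonzero]) (auto simp: enn2real_mult)
  also have "enn2real (\<integral>\<^sup>+x. ennreal (G (A *v x)) \<partial>lborel) = (LINT x|lborel. G (A *v x))"
    by (rule integral_eq_nn_integral[symmetric]) (auto simp: G0)
  also have "\<dots> = (LINT x|\<mu>. f (A *v x + s))"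
    by (subst integral_mu) (auto simp: G_def)
  finally have sub: "(LINT x|\<mu>. f (A *v x + s)) = 1 / \<bar>det A\<bar> * (LINT y|lborel. G y)"
    using det_A_nonzero by simp
  have "(LINT y|lborel. G y) = (LINT y|lborel. G (y + - s))"
    by (rule integral_translate[symmetric]) measurable
  also have "\<dots> = (LINT y|\<mu>. f (invA *v y - invA *v s))"
    by (subst integral_mu) (auto simp: G_def matrix_vector_mult_diff_distrib mult.commute)
  also have "\<dots> = (\<Sum>k=1..m. p k *\<^sub>R (LINT x|\<mu>. f (invA *v (ifs_map A a k x) - invA *v s)))"
    by (rule integral_self_affine[where K = 1]) (auto simp: f_nonneg f_le_1 abs_le_iff order.trans[OF _ f_nonneg])
  also have "\<dots> = (\<Sum>k=1..m. p k * autocorrelation f (invA *v a k - invA *v s))"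
    by (intro sum.cong refl) (simp add: autocorrelation_mu ifs_map_def matrix_vector_right_distrib add_diff_eq)
  finally show ?thesis using sub by simp
qed

text \<open>One use of self-affinity gives the sum over \<open>l\<close>, the substitution gives the
  sum over \<open>k\<close>. For lattice points \<open>z\<close> the new points
  \<open>invA *v (z + a l - a k)\<close> are again in the lattice, and \<open>A *v h\<close> has
  become \<open>h\<close>: values on the lattice shifted by \<open>A *v h\<close> reduce to values
  on the lattice shifted by \<open>h\<close>.\<close>

lemma (in bounded_density) autocorrelation_refinement:
  "autocorrelation f (z + A *v h) = (\<Sum>l=1..m. \<Sum>k=1..m.
    p l * p k / \<bar>det A\<bar> * autocorrelation f (invA *v (z + a l - a k) + h))"
proof -
  have "autocorrelation f (z + A *v h) = (\<Sum>l=1..m. p l *\<^sub>R (LINT x|\<mu>. f (ifs_map A a l x + (z + A *v h))))"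
    unfolding autocorrelation_mu
    by (rule integral_self_affine[where K = 1]) (auto simp: f_nonneg f_le_1 abs_le_iff order.trans[OF _ f_nonneg])
  also have "\<dots> = (\<Sum>l=1..m. \<Sum>k=1..m.
    p l * p k / \<bar>det A\<bar> * autocorrelation f (invA *v (z + a l - a k) + h))"
  proof (rule sum.cong[OF refl])
    fix l
    have "(LINT x|\<mu>. f (ifs_map A a l x + (z + A *v h))) = (LINT x|\<mu>. f (A *v x + (a l + z + A *v h)))"
      by (simp add: ifs_map_def add_ac)
    also have "\<dots> = 1 / \<bar>det A\<bar> * (\<Sum>k=1..m. p k * autocorrelation f (invA *v a k - invA *v (a l + z + A *v h)))"
      by (rule autocorrelation_substitution)
    also have "(\<Sum>k=1..m. p k * autocorrelation f (invA *v a k - invA *v (a l + z + A *v h)))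
        = (\<Sum>k=1..m. p k * autocorrelation f (invA *v (z + a l - a k) + h))"
    proof (rule sum.cong[OF refl])
      fix k
      have "invA *v a k - invA *v (a l + z + A *v h) = - (invA *v (z + a l - a k) + h)"
        by (simp add: matrix_vector_right_distrib matrix_vector_mult_diff_distrib)
      then show "p k * autocorrelation f (invA *v a k - invA *v (a l + z + A *v h))
          = p k * autocorrelation f (invA *v (z + a l - a k) + h)"
        by (simp only: autocorrelation_even)
    qed
    finally show "p l *\<^sub>R (LINT x|\<mu>. f (ifs_map A a l x + (z + A *v h))) = (\<Sum>k=1..m.
      p l * p k / \<bar>det A\<bar> * autocorrelation f (invA *v (z + a l - a k) + h))"
      by (simp add: sum_distrib_left mult_ac)
  qed
  finally show ?thesis .
qed

text \<open>On a bounded \<open>A\<close>-invariant set \<open>H\<close> the refinement equation only involves finitely many lattice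
  points, so the sequences \<open>\<Phi>(A\<^sup>n h)\<close> with \<open>h \<in> H\<close> satisfy a common linear recurrence.\<close>

lemma (in bounded_density) autocorrelation_decay:
  "\<exists>C r. 0 \<le> C \<and> 0 < r \<and> r < 1 \<and>
    (\<forall>n h. norm h \<le> \<rho> \<longrightarrow> autocorrelation f 0 - autocorrelation f (((*v) A ^^ n) h) \<le> C * r ^ n)"
proof -
  let ?\<Phi> = "autocorrelation f"
  obtain N :: "real^'n \<Rightarrow> real" and \<theta> c where N: "0 < \<theta>" "\<theta> < 1" "0 < c" "\<And>x. norm x \<le> N x" "\<And>x. N x \<le> c * norm x"
    "\<And>x. N (A *v x) \<le> \<theta> * N x"
    using adapted_norm[OF spectral_radius_A] by metis
  have N0: "0 \<le> N x" for x using N(4)[of x] norm_ge_zero[of x] by linarith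
  \<comment> \<open>A ball of the adapted norm: invariant under \<open>A\<close> and containing
    every \<open>h\<close> with \<open>norm h \<le> \<rho>\<close>. The absolute value keeps 0 in
    \<open>H\<close> for negative \<open>\<rho>\<close>.\<close>
  define H where "H = {h. N h \<le> c * \<bar>\<rho>\<bar>}"
  have H_A: "A *v h \<in> H" if "h \<in> H" for h
  proof -
    have "\<theta> * N h \<le> 1 * N h" using N(2) N0 by (intro mult_right_mono) auto
    then show ?thesis using N(6)[of h] that by (simp add: H_def)
  qed
  have H_pow: "((*v) A ^^ n) h \<in> H" if "h \<in> H" for n h
    by (induction n) (auto intro: H_A that)
  have H_norm: "norm h \<le> c * \<bar>\<rho>\<bar>" if "h \<in> H" for h using N(4)[of h] that by (simp add: H_def)
  have H_0: "0 \<in> H" using N(5)[of 0] N(3) N0[of 0] by (simp add: H_def)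
  have H_ball: "h \<in> H" if "norm h \<le> \<rho>" for h
  proof -
    have "c * norm h \<le> c * \<bar>\<rho>\<bar>" using that N(3) by (intro mult_left_mono) auto
    then show ?thesis using N(5)[of h] by (simp add: H_def)
  qed
  \<comment> \<open>For \<open>h\<close> in \<open>H\<close> and a lattice point \<open>z\<close>
    outside \<open>Z\<close>, the norm of \<open>z + h\<close> exceeds \<open>2 * R\<close>, where
    the autocorrelation vanishes.\<close>
  define Z where "Z = {z \<in> integer_lattice. norm (z :: real^'n) \<le> 2 * R + c * \<bar>\<rho>\<bar>}"
  have finZ: "finite Z" unfolding Z_def by (rule finite_lattice_ball)
  have off: "?\<Phi> (z + h) = 0" if "z \<in> integer_lattice" "z \<notin> Z" "h \<in> H" for z h
  proof (rule autocorrelation_far)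
    have "norm z \<le> norm (z + h) + norm h" using norm_triangle_ineq4[of "z + h" h] by simp
    then show "2 * R < norm (z + h)" using that H_norm[of h] by (simp add: Z_def)
  qed
  have select: "(\<Sum>z\<in>Z. of_bool (z = w) * ?\<Phi> (z + h)) = (if w \<in> Z then ?\<Phi> (w + h) else 0)" for w h
  proof -
    have "(\<Sum>z\<in>Z. of_bool (z = w) * ?\<Phi> (z + h)) = (\<Sum>z\<in>Z. if z = w then ?\<Phi> (w + h) else 0)"
      by (intro sum.cong) auto
    then show ?thesis using finZ by simp
  qed
  \<comment> \<open>The coefficients \<open>\<tau>\<close> depend on \<open>n\<close> but not on
    \<open>h\<close>. In the induction step the hypothesis is used at \<open>A *v h\<close>, and
    those \<open>w z l k\<close> that fall outside \<open>Z\<close> contribute nothing.\<close>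
  have rows: "\<exists>\<tau>. \<forall>h\<in>H. ?\<Phi> (((*v) A ^^ n) h) = (\<Sum>z\<in>Z. \<tau> z * ?\<Phi> (z + h))" for n
  proof (induction n)
    case 0
    have "0 \<in> Z" using R_pos N(3) by (simp add: Z_def integer_lattice_0)
    then have "(\<Sum>z\<in>Z. of_bool (z = 0) * ?\<Phi> (z + h)) = ?\<Phi> h" for h
      using finZ select[of 0 h] by simp
    then show ?case by (intro exI[of _ "\<lambda>z. of_bool (z = 0)"]) simp
  next
    case (Suc n)
    then obtain \<tau> where \<tau>: "\<And>h. h \<in> H \<Longrightarrow> ?\<Phi> (((*v) A ^^ n) h) = (\<Sum>z\<in>Z. \<tau> z * ?\<Phi> (z + h))" by blast
    define w where "w z l k = invA *v (z + a l - a k)" for z l k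
    define \<sigma> where "\<sigma> y = (\<Sum>z\<in>Z. \<Sum>l=1..m. \<Sum>k=1..m. \<tau> z * (p l * p k / \<bar>det A\<bar>) * of_bool (y = w z l k))" for y
    have "?\<Phi> (((*v) A ^^ Suc n) h) = (\<Sum>y\<in>Z. \<sigma> y * ?\<Phi> (y + h))" if h: "h \<in> H" for h
    proof -
      have "?\<Phi> (((*v) A ^^ Suc n) h) = (\<Sum>z\<in>Z. \<tau> z * ?\<Phi> (z + A *v h))"
        using \<tau>[OF H_A[OF h]] by (simp add: funpow_swap1)
      also have "\<dots> = (\<Sum>z\<in>Z. \<Sum>l=1..m. \<Sum>k=1..m. \<tau> z * (p l * p k / \<bar>det A\<bar>) * ?\<Phi> (w z l k + h))"
        by (simp add: autocorrelation_refinement w_def sum_distrib_left mult_ac)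
      also have "\<dots> = (\<Sum>z\<in>Z. \<Sum>l=1..m. \<Sum>k=1..m. \<tau> z * (p l * p k / \<bar>det A\<bar>) *
          (\<Sum>y\<in>Z. of_bool (y = w z l k) * ?\<Phi> (y + h)))"
      proof (intro sum.cong refl)
        fix z l k assume z: "z \<in> Z" and lk: "l \<in> {1..m}" "k \<in> {1..m}"
        have "w z l k \<in> integer_lattice" unfolding w_def
          using z lk by (intro invA_lattice integer_lattice_diff integer_lattice_add translations_integer) (auto simp: Z_def)
        then have "(\<Sum>y\<in>Z. of_bool (y = w z l k) * ?\<Phi> (y + h)) = ?\<Phi> (w z l k + h)"
          using off[OF _ _ h] by (simp add: select)
        then show "\<tau> z * (p l * p k / \<bar>det A\<bar>) * ?\<Phi> (w z l k + h)
            = \<tau> z * (p l * p k / \<bar>det A\<bar>) * (\<Sum>y\<in>Z. of_bool (y = w z l k) * ?\<Phi> (y + h))" by simp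
      qed
      also have "\<dots> = (\<Sum>z\<in>Z. \<Sum>l=1..m. \<Sum>k=1..m. \<Sum>y\<in>Z.
          \<tau> z * (p l * p k / \<bar>det A\<bar>) * of_bool (y = w z l k) * ?\<Phi> (y + h))"
        by (simp only: sum_distrib_left mult.assoc)
      also have "\<dots> = (\<Sum>z\<in>Z. \<Sum>l=1..m. \<Sum>y\<in>Z. \<Sum>k=1..m.
          \<tau> z * (p l * p k / \<bar>det A\<bar>) * of_bool (y = w z l k) * ?\<Phi> (y + h))"
        by (intro sum.cong refl sum.swap)
      also have "\<dots> = (\<Sum>z\<in>Z. \<Sum>y\<in>Z. \<Sum>l=1..m. \<Sum>k=1..m.
          \<tau> z * (p l * p k / \<bar>det A\<bar>) * of_bool (y = w z l k) * ?\<Phi> (y + h))"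
        by (intro sum.cong refl sum.swap)
      also have "\<dots> = (\<Sum>y\<in>Z. \<Sum>z\<in>Z. \<Sum>l=1..m. \<Sum>k=1..m.
          \<tau> z * (p l * p k / \<bar>det A\<bar>) * of_bool (y = w z l k) * ?\<Phi> (y + h))"
        by (rule sum.swap)
      also have "\<dots> = (\<Sum>y\<in>Z. \<sigma> y * ?\<Phi> (y + h))"
        by (simp only: \<sigma>_def sum_distrib_right)
      finally show ?thesis .
    qed
    then show ?case by blast
  qed
  then obtain \<tau> where \<tau>: "\<And>n h. h \<in> H \<Longrightarrow> ?\<Phi> (((*v) A ^^ n) h) = (\<Sum>z\<in>Z. \<tau> n z * ?\<Phi> (z + h))" by metis
  \<comment> \<open>\<open>card Z + 1\<close> rows of length \<open>card Z\<close> are linearly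
    dependent; this is the recurrence common to all \<open>h\<close>.\<close>
  obtain \<alpha> i0 where \<alpha>: "i0 \<le> card Z" "\<alpha> i0 \<noteq> 0" "\<And>z. z \<in> Z \<Longrightarrow> (\<Sum>i\<le>card Z. \<alpha> i * \<tau> i z) = 0"
    using nontrivial_relation[of Z "{..card Z}" \<tau>] finZ by auto
  have rel: "(\<Sum>i\<le>card Z. \<alpha> i * ?\<Phi> (((*v) A ^^ i) h)) = 0" if h: "h \<in> H" for h
  proof -
    have "(\<Sum>i\<le>card Z. \<alpha> i * ?\<Phi> (((*v) A ^^ i) h)) = (\<Sum>i\<le>card Z. \<Sum>z\<in>Z. \<alpha> i * \<tau> i z * ?\<Phi> (z + h))"
      by (simp add: \<tau>[OF h] sum_distrib_left mult.assoc)
    also have "\<dots> = (\<Sum>z\<in>Z. (\<Sum>i\<le>card Z. \<alpha> i * \<tau> i z) * ?\<Phi> (z + h))"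
      by (subst sum.swap) (simp only: sum_distrib_right)
    finally show ?thesis using \<alpha>(3) by simp
  qed
  define q :: "complex poly" where "q = (\<Sum>i\<le>card Z. monom (of_real (\<alpha> i)) i)"
  have co: "coeff q i = (if i \<le> card Z then of_real (\<alpha> i) else 0)" for i
    by (simp add: q_def coeff_sum sum.delta if_distrib cong: if_cong)
  have deg: "degree q \<le> card Z" unfolding q_def
    by (intro degree_sum_le) (auto intro: order.trans[OF degree_monom_le])
  have "q \<noteq> 0" using co[of i0] \<alpha>(1,2) by auto
  then obtain C r where C: "0 \<le> C" "0 < r" "r < 1" "\<And>c K n. (\<forall>n. shift_apply q c n = 0) \<Longrightarrow> c \<longlonglongrightarrow> 0 \<Longrightarrow>
    (\<forall>n. cmod (c n) \<le> K) \<Longrightarrow> cmod (c n) \<le> C * K * r ^ n"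
    using null_recurrence_decay by metis
  have "?\<Phi> 0 - ?\<Phi> (((*v) A ^^ n) h) \<le> C * r ^ n" if h: "norm h \<le> \<rho>" for n h
  proof -
    have hH: "h \<in> H" using h by (rule H_ball)
    \<comment> \<open>The case \<open>h = 0\<close> shows that the constant sequence
      \<open>?\<Phi> 0\<close> obeys the recurrence too. Hence so does the difference, which tends
      to 0 as \<open>null_recurrence_decay\<close> demands.\<close>
    define d where "d n = ?\<Phi> (((*v) A ^^ n) h) - ?\<Phi> 0" for n
    have d1: "\<bar>d n\<bar> \<le> 1" for n
      using autocorrelation_bounds[of "((*v) A ^^ n) h"] autocorrelation_bounds[of 0] by (simp add: d_def abs_le_iff)
    have "shift_apply q (\<lambda>n. of_real (d n)) n = 0" for n
    proof -
      have "((*v) A ^^ (n + i)) h = ((*v) A ^^ i) (((*v) A ^^ n) h)" for i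
        by (subst add.commute) (simp add: funpow_add)
      moreover have "((*v) A ^^ i) 0 = 0" for i by (rule linear_0[OF linear_funpow_matrix])
      ultimately have "(\<Sum>i\<le>card Z. \<alpha> i * d (n + i)) =
          (\<Sum>i\<le>card Z. \<alpha> i * ?\<Phi> (((*v) A ^^ i) (((*v) A ^^ n) h))) - (\<Sum>i\<le>card Z. \<alpha> i * ?\<Phi> (((*v) A ^^ i) 0))"
        by (simp add: d_def right_diff_distrib sum_subtractf)
      also have "\<dots> = 0" using rel[OF H_pow[OF hH]] rel[OF H_0] by simp
      finally have "complex_of_real (\<Sum>i\<le>card Z. \<alpha> i * d (n + i)) = 0" by simp
      then show ?thesis by (simp add: shift_apply_eq[OF deg] co)
    qed
    moreover have "d \<longlonglongrightarrow> 0"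
    proof (rule LIMSEQ_I)
      fix e :: real assume "0 < e"
      obtain \<delta> where \<delta>: "\<delta> > 0" "\<And>t. norm t < \<delta> \<Longrightarrow> (LINT x|lborel. abs (f (x + t) - f x)) < e"
        using L1_translation_continuous[OF f_integrable \<open>0 < e\<close>] by blast
      have small: "norm (?\<Phi> t - ?\<Phi> 0) < e" if "norm t < \<delta>" for t
      proof -
        have ints: "integrable lborel (\<lambda>x. f x * f (x + t))" "integrable lborel (\<lambda>x. f x * f x)"
          by (auto intro!: integrable_f_mult simp: f_nonneg f_le_1)
        have "norm (?\<Phi> t - ?\<Phi> 0) = norm (LINT x|lborel. f x * f (x + t) - f x * f x)"
          using ints by (simp add: autocorrelation_def)
        also have "\<dots> \<le> (LINT x|lborel. norm (f x * f (x + t) - f x * f x))"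
          by (rule integral_norm_bound)
        also have "\<dots> \<le> (LINT x|lborel. abs (f (x + t) - f x))"
        proof (rule integral_mono)
          show "integrable lborel (\<lambda>x. abs (f (x + t) - f x))"
            using f_integrable integrable_translate[OF f_integrable] by auto
          fix x
          have "norm (f x * f (x + t) - f x * f x) = f x * abs (f (x + t) - f x)"
            by (simp add: f_nonneg abs_mult flip: right_diff_distrib)
          also have "\<dots> \<le> 1 * abs (f (x + t) - f x)" using f_le_1 by (intro mult_right_mono) auto
          finally show "norm (f x * f (x + t) - f x * f x) \<le> abs (f (x + t) - f x)" by simp
        qed (use ints in auto)
        also have "\<dots> < e" by (rule \<delta>(2)[OF that])
        finally show ?thesis .
      qed
      obtain n0 where "\<And>n. n \<ge> n0 \<Longrightarrow> norm (((*v) A ^^ n) h) < \<delta>"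
        using LIMSEQ_D[OF A_pow_tendsto_0 \<delta>(1), of h] by auto
      then show "\<exists>n0. \<forall>n\<ge>n0. norm (d n - 0) < e" using small by (auto simp: d_def intro!: exI[of _ n0])
    qed
    then have "(\<lambda>n. complex_of_real (d n)) \<longlonglongrightarrow> 0" by (simp only: tendsto_of_real_iff[of d 0, unfolded of_real_0])
    ultimately have "cmod (of_real (d n)) \<le> C * 1 * r ^ n"
      using d1 by (intro C(4)) auto
    then have "\<bar>d n\<bar> \<le> C * r ^ n" by (simp only: norm_of_real mult_1_right)
    then show ?thesis by (simp add: d_def abs_le_iff)
  qed
  with C(1-3) show ?thesis by blast
qed

text \<open>The squared L2 distance of \<open>f\<close> from its translate by \<open>t\<close>
  equals \<open>2 * (\<Phi> 0 - \<Phi> t)\<close>, of order \<open>r ^ n\<close>. On a fixed ball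
  this yields an L1 distance of order \<open>sqrt r ^ n\<close>, and
  \<open>half_period_shift\<close> converts it into a bound for \<open>ft\<close>.\<close>

lemma (in bounded_density) ft_decay_step:
  "\<exists>C q. 0 < C \<and> 0 < q \<and> q < 1 \<and>
    (\<forall>n h \<xi>. norm h \<le> \<rho> \<longrightarrow> \<xi> \<bullet> (((*v) A ^^ n) h) = 1 / 2 \<longrightarrow> cmod (ft \<xi>) \<le> C * q ^ n)"
proof -
  let ?\<Phi> = "autocorrelation f"
  obtain C r where C: "0 \<le> C" "0 < r" "r < 1" "\<And>n h. norm h \<le> \<rho> \<Longrightarrow> ?\<Phi> 0 - ?\<Phi> (((*v) A ^^ n) h) \<le> C * r ^ n"
    using autocorrelation_decay[of \<rho>] by blast
  obtain C' r' where C': "0 < C'" "0 < r'" "r' < 1" "\<And>n x. norm (((*v) A ^^ n) x) \<le> C' * r' ^ n * norm x"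
    using decay by metis
  \<comment> \<open>The ball of this radius contains the supports of \<open>f\<close> and of all the
    translates considered.\<close>
  define R1 where "R1 = R + C' * \<bar>\<rho>\<bar>"
  define V where "V = measure lborel (cball (0 :: real^'n) R1)"
  define q where "q = sqrt r"
  have q: "0 < q" "q < 1" "q * q = r" using C by (auto simp: q_def)
  have "cmod (ft \<xi>) \<le> (V + 2 * C + 1) * q ^ n" if h: "norm h \<le> \<rho>" and \<xi>: "\<xi> \<bullet> (((*v) A ^^ n) h) = 1 / 2" for n h \<xi>
  proof -
    define t where "t = ((*v) A ^^ n) h"
    define s where "s = q ^ n"
    have s: "0 < s" "s * s = r ^ n" using q by (auto simp: s_def simp flip: power_mult_distrib)
    have "norm t \<le> C' * r' ^ n * norm h" unfolding t_def by (rule C'(4))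
    also have "\<dots> \<le> C' * 1 * \<bar>\<rho>\<bar>"
      using C' h by (intro mult_mono power_le_one) auto
    finally have t: "norm t \<le> C' * \<bar>\<rho>\<bar>" by simp
    have supp: "f (x + t) - f x = 0" if "x \<notin> cball 0 R1" for x
    proof -
      have "norm x \<le> norm (x + t) + norm t" using norm_triangle_ineq4[of "x + t" t] by simp
      moreover have "R1 < norm x" using that by simp
      moreover have "0 \<le> C' * \<bar>\<rho>\<bar>" using C' by simp
      ultimately have "R < norm x" "R < norm (x + t)" using t by (auto simp: R1_def)
      then show ?thesis by (simp add: f_support)
    qed
    have int2: "integrable lborel (\<lambda>x. f x * f (x + t))" "integrable lborel (\<lambda>x. f x * f x)"
      by (auto intro!: integrable_f_mult simp: f_nonneg f_le_1)
    have int3: "integrable lborel (\<lambda>x. f (x + t) * f (x + t))"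
      using integrable_translate[OF int2(2), of t] by simp
    have sq: "(f (x + t) - f x)\<^sup>2 = f (x + t) * f (x + t) + f x * f x - 2 * (f x * f (x + t))" for x
      by (simp add: power2_eq_square algebra_simps)
    have int_sq: "integrable lborel (\<lambda>x. (f (x + t) - f x)\<^sup>2)"
      unfolding sq using int2 int3 by auto
    have "(LINT x|lborel. f (x + t) * f (x + t)) = (LINT x|lborel. f x * f x)"
      by (rule integral_translate[of "\<lambda>x. f x * f x" t]) measurable
    then have "(LINT x|lborel. (f (x + t) - f x)\<^sup>2) = 2 * (?\<Phi> 0 - ?\<Phi> t)"
      unfolding sq using int2 int3 by (simp add: autocorrelation_def)
    also have "\<dots> \<le> 2 * (C * r ^ n)" using C(4)[OF h, of n] by (simp add: t_def)
    finally have L2: "(LINT x|lborel. (f (x + t) - f x)\<^sup>2) \<le> 2 * (C * r ^ n)" .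
    have ball_int: "integrable lborel (indicat_real (cball (0 :: real^'n) R1))"
      by (intro integrable_real_indicator emeasure_lborel_cball_finite) auto
    have "2 * cmod (ft \<xi>) \<le> (LINT x|lborel. abs (f (x + t) - f x))"
      unfolding ft_f using \<xi> by (intro half_period_shift f_integrable) (simp add: t_def)
    \<comment> \<open>AM-GM in place of Cauchy-Schwarz; with \<open>s = q ^ n\<close> and
      \<open>s * s = r ^ n\<close> both terms have order \<open>s\<close>.\<close>
    also have "\<dots> \<le> (LINT x|lborel. s * indicat_real (cball 0 R1) x + (f (x + t) - f x)\<^sup>2 / s)"
    proof (rule integral_mono')
      show "integrable lborel (\<lambda>x. s * indicat_real (cball 0 R1) x + (f (x + t) - f x)\<^sup>2 / s)"
        using ball_int int_sq by auto
      show "abs (f (x + t) - f x) \<le> s * indicat_real (cball 0 R1) x + (f (x + t) - f x)\<^sup>2 / s" for x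
      proof (cases "x \<in> cball 0 R1")
        case True
        define u where "u = abs (f (x + t) - f x)"
        have "0 \<le> (s - u)\<^sup>2 / s + u" using s by (simp add: u_def)
        also have "\<dots> = s + u\<^sup>2 / s - u" using s by (simp add: power2_eq_square field_simps)
        finally show ?thesis using True by (simp add: u_def)
      qed (simp add: supp)
    qed (use s in auto)
    also have "\<dots> = s * V + (LINT x|lborel. (f (x + t) - f x)\<^sup>2) / s"
      using ball_int int_sq by (simp add: V_def)
    also have "\<dots> \<le> s * V + 2 * (C * r ^ n) / s" using L2 s by (simp add: divide_right_mono)
    also have "2 * (C * r ^ n) / s = s * (2 * C)" using s by (simp add: s(2)[symmetric])
    also have "s * V + s * (2 * C) \<le> 2 * ((V + 2 * C + 1) * s)"
    proof -
      have "0 \<le> s * V" "0 \<le> s * C" using s C(1) by (auto simp: V_def)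
      then show ?thesis using s by (simp add: algebra_simps)
    qed
    finally show ?thesis by (simp add: s_def)
  qed
  moreover have "0 < V + 2 * C + 1" using C(1) by (simp add: V_def add_nonneg_pos)
  ultimately show ?thesis using q by blast
qed

lemma (in bounded_density) power_decay: "power_fourier_decay \<mu>"
proof -
  obtain K0 where K0: "\<And>x. norm (trB *v x) \<le> norm x * K0" "0 < K0"
    using bounded_linear.pos_bounded[OF matrix_vector_mul_bounded_linear[of trB]] by blast
  \<comment> \<open>A bound for the expansion by \<open>trB\<close>, made larger than 1 so that
    \<open>ln K\<close> is positive.\<close>
  define K where "K = max 2 K0"
  have K: "1 < K" by (simp add: K_def)
  have KB: "norm (trB *v x) \<le> K * norm x" for x
    using order.trans[OF K0(1) mult_left_mono[of K0 K "norm x"]] by (simp add: K_def mult.commute)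
  have K_pow: "norm (((*v) trB ^^ n) x) \<le> K ^ n * norm x" for n x
  proof (induction n)
    case (Suc n)
    have "norm (trB *v (((*v) trB ^^ n) x)) \<le> K * norm (((*v) trB ^^ n) x)" by (rule KB)
    also have "\<dots> \<le> K * (K ^ n * norm x)" using Suc K by (intro mult_left_mono) auto
    finally show ?case by (simp add: mult.assoc)
  qed simp
  obtain C q where C: "0 < C" "0 < q" "q < 1"
    "\<And>n h \<xi>. norm h \<le> K / 2 \<Longrightarrow> \<xi> \<bullet> (((*v) A ^^ n) h) = 1 / 2 \<Longrightarrow> cmod (ft \<xi>) \<le> C * q ^ n"
    using ft_decay_step[of "K / 2"] by blast
  obtain C' r where C': "0 < C'" "0 < r" "r < 1" "\<And>n x. norm (((*v) trA ^^ n) x) \<le> C' * r ^ n * norm x"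
    using decay by metis
  \<comment> \<open>Chosen so that \<open>K powr (- \<alpha>) = q\<close>.\<close>
  define \<alpha> where "\<alpha> = - ln q / ln K"
  have "ln q < 0" "0 < ln K" using C K by auto
  then have \<alpha>: "0 < \<alpha>" by (simp add: \<alpha>_def divide_neg_pos)
  have "cmod (ft \<xi>) \<le> C * norm \<xi> powr (- \<alpha>)" if \<xi>: "1 < norm \<xi>" for \<xi>
  proof -
    have "(\<lambda>n. C' * r ^ n * norm \<xi>) \<longlonglongrightarrow> C' * 0 * norm \<xi>"
      by (intro tendsto_mult tendsto_const LIMSEQ_realpow_zero) (use C' in auto)
    then have "\<forall>\<^sub>F n in sequentially. C' * r ^ n * norm \<xi> < 1" by (intro order_tendstoD) auto
    then obtain n0 where "C' * r ^ n0 * norm \<xi> < 1" by (auto simp: eventually_sequentially)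
    then have ex: "norm (((*v) trA ^^ n0) \<xi>) \<le> 1" using C'(4)[of n0 \<xi>] by linarith
    \<comment> \<open>The first time the contracted frequency enters the unit ball. By minimality
      \<open>\<eta>\<close> is still longer than \<open>1 / K\<close>, so the half-period vector
      \<open>h\<close> below has length at most \<open>K / 2\<close>.\<close>
    define n where "n = (LEAST n. norm (((*v) trA ^^ n) \<xi>) \<le> 1)"
    define \<eta> where "\<eta> = ((*v) trA ^^ n) \<xi>"
    have le: "norm \<eta> \<le> 1" unfolding \<eta>_def n_def using ex by (rule LeastI)
    have "n \<noteq> 0" using le \<xi> by (auto simp: \<eta>_def intro!: Nat.gr0I)
    then obtain j where j: "n = Suc j" by (cases n) auto
    have "\<not> norm (((*v) trA ^^ j) \<xi>) \<le> 1" using j not_less_Least[of j "\<lambda>n. norm (((*v) trA ^^ n) \<xi>) \<le> 1"] by (simp add: n_def)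
    then have "1 < norm (trB *v \<eta>)" by (simp add: \<eta>_def j)
    with KB[of \<eta>] have ge: "1 < K * norm \<eta>" by linarith
    then have \<eta>0: "0 < norm \<eta>" using K by (auto intro: ccontr)
    define h where "h = (1 / (2 * (norm \<eta>)\<^sup>2)) *\<^sub>R \<eta>"
    have "norm h = 1 / norm \<eta> / 2" using \<eta>0 by (simp add: h_def power2_eq_square)
    moreover have "1 / norm \<eta> \<le> K" using ge \<eta>0 by (simp add: field_simps)
    ultimately have "norm h \<le> K / 2" by simp
    moreover have "\<xi> \<bullet> (((*v) A ^^ n) h) = 1 / 2"
      using \<eta>0 inner_trA_pow[of n \<xi> h] by (simp add: h_def dot_square_norm flip: \<eta>_def)
    ultimately have ft: "cmod (ft \<xi>) \<le> C * q ^ n" by (rule C(4))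
    have "norm \<xi> \<le> K ^ n * norm \<eta>" using K_pow[of n \<eta>] by (simp add: \<eta>_def trB_trA_pow)
    also have "\<dots> \<le> K ^ n * 1" using le K by (intro mult_left_mono) auto
    finally have "norm \<xi> \<le> K ^ n" by simp
    then have "(K ^ n) powr (- \<alpha>) \<le> norm \<xi> powr (- \<alpha>)" using \<xi> \<alpha> by (intro powr_mono2') auto
    moreover have "(K ^ n) powr (- \<alpha>) = q ^ n"
    proof -
      have "(K ^ n) powr (- \<alpha>) = exp (real n * ln q)"
        using K by (simp add: powr_def ln_realpow \<alpha>_def)
      also have "\<dots> = q ^ n" using C(2) by (simp add: exp_of_nat_mult)
      finally show ?thesis .
    qed
    ultimately have "C * q ^ n \<le> C * norm \<xi> powr (- \<alpha>)" using C(1) by (intro mult_left_mono) auto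
    with ft show ?thesis by linarith
  qed
  then have "\<forall>\<^sub>F \<xi> in at_infinity. norm (cmod (ft \<xi>)) \<le> C * norm (norm \<xi> powr (- \<alpha>))"
    by (auto simp: eventually_at_infinity intro!: exI[of _ 2])
  then have "(\<lambda>\<xi>. cmod (ft \<xi>)) \<in> O[at_infinity](\<lambda>\<xi>. norm \<xi> powr (- \<alpha>))" by (rule bigoI)
  with \<alpha> show ?thesis unfolding power_fourier_decay_def by blast
qed

section \<open>The \<open>L\<^sup>2\<close>-dimension\<close>

context integral_self_affine
begin

definition cell :: "nat \<Rightarrow> real^'n \<Rightarrow> (real^'n) set" where
  "cell n z = ((*v) A ^^ n) ` (+) z ` unit_cell"

definition mass :: "nat \<Rightarrow> real^'n \<Rightarrow> real" where
  "mass n z = measure \<mu> (cell n z)"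

definition support_radius :: real where
  "support_radius = (SOME R. 0 < R \<and> (AE x in \<mu>. norm x \<le> R))"

text \<open>A finite index set outside which \<open>mass n\<close> vanishes; cells of mass 0 may
  belong to it.\<close>

definition charged :: "nat \<Rightarrow> (real^'n) set" where
  "charged n = {z \<in> integer_lattice. cell n z \<inter> cball 0 support_radius \<noteq> {}}"

text \<open>The sum in \<open>LAq_dimension\<close> for \<open>q = 2\<close>, in finite form
  (\<open>infsum_unit_cubes\<close>).\<close>

definition energy :: "nat \<Rightarrow> real" where
  "energy n = (\<Sum>z\<in>charged n. (mass n z)\<^sup>2)"

end

lemma (in integral_self_affine) support_radius: "0 < support_radius" "AE x in \<mu>. norm x \<le> support_radius"
  using someI_ex[OF bounded_support] by (auto simp: support_radius_def)

lemma (in integral_self_affine) mem_cell: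
  "x \<in> cell n z \<longleftrightarrow> (\<forall>i. z $ i \<le> (((*v) invA ^^ n) x) $ i \<and> (((*v) invA ^^ n) x) $ i < z $ i + 1)"
  by (simp add: cell_def A_pow_image mem_translate_unit_cell)

lemma (in integral_self_affine) cell_measurable [measurable]: "cell n z \<in> sets borel"
  unfolding cell_def by (intro A_pow_image_measurable translate_measurable) simp

lemma (in integral_self_affine) emeasure_cell: "emeasure lborel (cell n z) = ennreal (\<bar>det A\<bar> ^ n)"
  unfolding cell_def by (simp add: emeasure_A_pow_image emeasure_lborel_translate emeasure_unit_cell)

lemma (in integral_self_affine) measure_cell: "measure lborel (cell n z) = \<bar>det A\<bar> ^ n"
  using emeasure_cell[of n z] by (simp add: measure_def)

lemma (in integral_self_affine) integrable_cell: "integrable lborel (indicat_real (cell n z))"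
  by (rule integrable_real_indicator) (auto simp: emeasure_cell)

lemma (in integral_self_affine) lattice_point:
  obtains z where "z \<in> integer_lattice" "x \<in> cell n z"
proof -
  obtain z where "z \<in> integer_lattice" "((*v) invA ^^ n) x \<in> (+) z ` unit_cell"
    using ex_lattice_cell by blast
  then show thesis using that by (simp add: cell_def A_pow_image)
qed

lemma (in integral_self_affine) disjoint_cells: "disjoint_family_on (cell n) integer_lattice"
  unfolding disjoint_family_on_def
proof (intro ballI impI)
  fix z w :: "real^'n" assume zw: "z \<in> integer_lattice" "w \<in> integer_lattice" "z \<noteq> w"
  show "cell n z \<inter> cell n w = {}"
  proof (rule ccontr)
    assume "cell n z \<inter> cell n w \<noteq> {}"
    then obtain x where "((*v) invA ^^ n) x \<in> (+) z ` unit_cell" "((*v) invA ^^ n) x \<in> (+) w ` unit_cell"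
      by (auto simp: cell_def A_pow_image simp del: image_add_0)
    with zw lattice_cell_unique show False by blast
  qed
qed

lemma norm_unit_cell: "x \<in> unit_cell \<Longrightarrow> norm (x :: real^'n) \<le> real CARD('n)"
proof -
  assume x: "x \<in> unit_cell"
  have "norm x \<le> (\<Sum>i\<in>UNIV. \<bar>x $ i\<bar>)" by (rule norm_le_l1_cart)
  also have "\<dots> \<le> (\<Sum>i\<in>(UNIV::'n set). 1)" using x by (intro sum_mono) (auto simp: unit_cell_def abs_le_iff less_imp_le)
  finally show ?thesis by simp
qed

text \<open>The powers of \<open>A\<close> are uniformly bounded, so the constant serves all
  \<open>n\<close>; charged cells of every generation thus stay in one ball.\<close>

lemma (in integral_self_affine) cell_diameter:
  obtains c where "0 < c" "\<And>n z x y. x \<in> cell n z \<Longrightarrow> y \<in> cell n z \<Longrightarrow> norm (x - y) \<le> c"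
proof -
  obtain C r where C: "0 < C" "0 < r" "r < 1" "\<And>n x. norm (((*v) A ^^ n) x) \<le> C * r ^ n * norm x"
    using decay by metis
  have "norm (x - y) \<le> C * (2 * real CARD('n))" if xy: "x \<in> cell n z" "y \<in> cell n z" for n z x y
  proof -
    obtain u v where uv: "u \<in> unit_cell" "v \<in> unit_cell" "x = ((*v) A ^^ n) (z + u)" "y = ((*v) A ^^ n) (z + v)"
      using xy unfolding cell_def by blast
    have "x - y = ((*v) A ^^ n) (u - v)"
      unfolding uv(3,4) linear_diff[OF linear_funpow_matrix, symmetric] by simp
    then have "norm (x - y) \<le> C * r ^ n * norm (u - v)" using C(4) by simp
    also have "\<dots> \<le> C * 1 * (2 * real CARD('n))"
    proof (intro mult_mono)
      show "norm (u - v) \<le> 2 * real CARD('n)"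
        using norm_triangle_ineq4[of u v] norm_unit_cell[OF uv(1)] norm_unit_cell[OF uv(2)] by linarith
      show "r ^ n \<le> 1" using C by (intro power_le_one) auto
    qed (use C in auto)
    finally show ?thesis by simp
  qed
  moreover have "0 < C * (2 * real CARD('n))" using C by (intro mult_pos_pos) auto
  ultimately show thesis using that by blast
qed

lemma (in integral_self_affine) finite_charged: "finite (charged n)"
proof -
  have "bounded_linear ((*v) invA ^^ n)" by (rule linear_conv_bounded_linear[THEN iffD1, OF linear_funpow_matrix])
  then obtain K where K: "0 < K" "\<And>x. norm (((*v) invA ^^ n) x) \<le> norm x * K"
    using bounded_linear.pos_bounded by blast
  have "charged n \<subseteq> {z \<in> integer_lattice. norm z \<le> support_radius * K + real CARD('n)}"
  proof
    fix z assume "z \<in> charged n"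
    then obtain x where x: "z \<in> integer_lattice" "x \<in> cell n z" "norm x \<le> support_radius"
      by (auto simp: charged_def)
    then have "((*v) invA ^^ n) x \<in> (+) z ` unit_cell" by (simp add: cell_def A_pow_image)
    then obtain u where u: "u \<in> unit_cell" "((*v) invA ^^ n) x = z + u" by blast
    have "norm z \<le> norm (z + u) + norm u" using norm_triangle_ineq4[of "z + u" u] by simp
    also have "norm (z + u) \<le> norm x * K" unfolding u(2)[symmetric] by (rule K(2))
    also have "norm x * K \<le> support_radius * K" using x(3) K(1) by (intro mult_right_mono) auto
    finally have "norm z \<le> support_radius * K + real CARD('n)" using norm_unit_cell[OF u(1)] by linarith
    with x(1) show "z \<in> {z \<in> integer_lattice. norm z \<le> support_radius * K + real CARD('n)}" by simp
  qed
  then show ?thesis by (rule finite_subset) (rule finite_lattice_ball)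
qed

lemma (in integral_self_affine) mass_nonneg: "0 \<le> mass n z"
  by (simp add: mass_def)

lemma (in integral_self_affine) mass_uncharged:
  assumes "z \<in> integer_lattice" "z \<notin> charged n"
  shows "mass n z = 0"
proof -
  have "AE x in \<mu>. x \<notin> cell n z"
    using support_radius(2) by eventually_elim (use assms in \<open>auto simp: charged_def\<close>)
  then have "emeasure \<mu> (cell n z) = 0"
    by (subst (asm) AE_iff_measurable[OF _ refl]) (auto simp: sets_mu)
  then show ?thesis by (simp add: mass_def measure_def)
qed

lemma (in integral_self_affine) sum_mass: "(\<Sum>z\<in>charged n. mass n z) = 1"
proof -
  have "(\<Sum>z\<in>charged n. mass n z) = measure \<mu> (\<Union>z\<in>charged n. cell n z)"
    unfolding mass_def
  proof (rule finite_measure_finite_Union[symmetric])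
    show "disjoint_family_on (cell n) (charged n)"
      by (rule disjoint_family_on_mono[OF _ disjoint_cells]) (auto simp: charged_def)
  qed (use finite_charged in \<open>auto simp: sets_mu\<close>)
  also have "\<dots> = 1"
  proof (rule prob_eq_1[THEN iffD2])
    show "(\<Union>z\<in>charged n. cell n z) \<in> sets \<mu>"
      using finite_charged by (auto simp: sets_mu intro!: sets.finite_UN)
    show "AE x in \<mu>. x \<in> (\<Union>z\<in>charged n. cell n z)"
      using support_radius(2)
    proof eventually_elim
      fix x :: "real^'n" assume x: "norm x \<le> support_radius"
      obtain z where "z \<in> integer_lattice" "x \<in> cell n z" by (rule lattice_point)
      moreover from this x have "x \<in> cell n z \<inter> cball 0 support_radius" by simp
      ultimately show "x \<in> (\<Union>z\<in>charged n. cell n z)" unfolding charged_def by blast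
    qed
  qed
  finally show ?thesis .
qed

lemma (in integral_self_affine) infsum_unit_cubes:
  "(\<Sum>\<^sub>\<infinity>Q\<in>unit_cubes. measure \<mu> (((*v) A ^^ n) ` Q) powr 2) = energy n"
proof -
  have inj: "inj_on (\<lambda>z. (+) z ` unit_cell) (integer_lattice :: (real^'n) set)"
  proof (rule inj_onI)
    fix z w :: "real^'n" assume zw: "z \<in> integer_lattice" "w \<in> integer_lattice" "(+) z ` unit_cell = (+) w ` unit_cell"
    have "z \<in> (+) z ` unit_cell" by (simp add: mem_translate_unit_cell)
    with zw show "z = w" using lattice_cell_unique by metis
  qed
  have "(\<Sum>\<^sub>\<infinity>Q\<in>unit_cubes. measure \<mu> (((*v) A ^^ n) ` Q) powr 2) = (\<Sum>\<^sub>\<infinity>z\<in>integer_lattice. mass n z powr 2)"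
    unfolding unit_cubes_eq infsum_reindex[OF inj] by (simp add: o_def mass_def cell_def)
  also have "\<dots> = (\<Sum>\<^sub>\<infinity>z\<in>charged n. (mass n z)\<^sup>2)"
    by (rule infsum_cong_neutral) (auto simp: mass_uncharged charged_def mass_nonneg)
  also have "\<dots> = energy n" using finite_charged by (simp add: energy_def)
  finally show ?thesis .
qed

section \<open>Bounds for the energy\<close>

lemma (in integral_self_affine) LAq_dimension_energy:
  "LAq_dimension A \<mu> 2 = liminf (\<lambda>n. ereal (real CARD('n) / (real n * ln \<bar>det A\<bar>) * ln (energy n)))"
  unfolding LAq_dimension_def infsum_unit_cubes ..

text \<open>Charged cells are disjoint, have volume \<open>|det A|^n\<close> and lie in a fixed
  ball.\<close>

lemma (in integral_self_affine) card_charged: "\<exists>V>0. \<forall>n. real (card (charged n)) * \<bar>det A\<bar> ^ n \<le> V"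
proof -
  obtain c where c: "0 < c" "\<And>n z x y. x \<in> cell n z \<Longrightarrow> y \<in> cell n z \<Longrightarrow> norm (x - y) \<le> c"
    by (rule cell_diameter) blast
  define V where "V = measure lborel (cball (0 :: real^'n) (support_radius + c))"
  have fin: "emeasure lborel (cball (0 :: real^'n) (support_radius + c)) < \<infinity>"
    by (rule emeasure_lborel_cball_finite)
  have "real (card (charged n)) * \<bar>det A\<bar> ^ n \<le> V + 1" for n
  proof -
    have "ennreal (real (card (charged n)) * \<bar>det A\<bar> ^ n) = (\<Sum>z\<in>charged n. emeasure lborel (cell n z))"
      by (simp add: emeasure_cell ennreal_mult ennreal_of_nat_eq_real_of_nat)
    also have "\<dots> = emeasure lborel (\<Union>z\<in>charged n. cell n z)"
    proof (rule sum_emeasure)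
      show "disjoint_family_on (cell n) (charged n)"
        by (rule disjoint_family_on_mono[OF _ disjoint_cells]) (auto simp: charged_def)
    qed (use finite_charged in auto)
    also have "\<dots> \<le> emeasure lborel (cball (0 :: real^'n) (support_radius + c))"
    proof (rule emeasure_mono)
      show "(\<Union>z\<in>charged n. cell n z) \<subseteq> cball 0 (support_radius + c)"
      proof
        fix x assume "x \<in> (\<Union>z\<in>charged n. cell n z)"
        then obtain z y where "x \<in> cell n z" "y \<in> cell n z" "norm y \<le> support_radius"
          by (auto simp: charged_def)
        then show "x \<in> cball 0 (support_radius + c)"
          using c(2)[of x n z y] norm_triangle_ineq[of "x - y" y] by simp
      qed
    qed simp
    also have "\<dots> = ennreal V" unfolding V_def using fin by (intro emeasure_eq_ennreal_measure) auto
    finally have "real (card (charged n)) * \<bar>det A\<bar> ^ n \<le> V" by (simp add: V_def)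
    then show ?thesis by simp
  qed
  moreover have "0 < V + 1" by (simp add: V_def add_nonneg_pos)
  ultimately show ?thesis by blast
qed

text \<open>Cauchy-Schwarz, in the form that the masses have nonnegative variance about their mean
  \<open>1 / card (charged n)\<close>, combined with the bound on the number of charged
  cells.\<close>

lemma (in integral_self_affine) energy_lower: "\<exists>V>0. \<forall>n. \<bar>det A\<bar> ^ n / V \<le> energy n"
proof -
  obtain V where V: "V > 0" "\<And>n. real (card (charged n)) * \<bar>det A\<bar> ^ n \<le> V" using card_charged by blast
  have "\<bar>det A\<bar> ^ n / V \<le> energy n" for n
  proof -
    let ?N = "real (card (charged n))"
    have "charged n \<noteq> {}" using sum_mass[of n] by auto
    then have N: "0 < ?N" using finite_charged by (simp add: card_gt_0_iff)
    have "0 \<le> (\<Sum>z\<in>charged n. (mass n z - 1 / ?N)\<^sup>2)" by (intro sum_nonneg) auto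
    also have "\<dots> = (\<Sum>z\<in>charged n. (mass n z)\<^sup>2 - 2 / ?N * mass n z + 1 / ?N\<^sup>2)"
      by (intro sum.cong refl) (simp add: power2_diff power_divide)
    also have "\<dots> = energy n - 2 / ?N * (\<Sum>z\<in>charged n. mass n z) + ?N * (1 / ?N\<^sup>2)"
      by (simp add: sum.distrib sum_subtractf energy_def sum_distrib_left)
    also have "\<dots> = energy n - 1 / ?N" using N by (simp add: sum_mass power2_eq_square)
    finally have "1 / ?N \<le> energy n" by simp
    moreover have "\<bar>det A\<bar> ^ n / V \<le> 1 / ?N" using V(1) V(2)[of n] N by (simp add: field_simps)
    ultimately show ?thesis by linarith
  qed
  with V(1) show ?thesis by blast
qed

lemma (in integral_self_affine) energy_pos: "0 < energy n"
proof -
  obtain V where "V > 0" "\<bar>det A\<bar> ^ n / V \<le> energy n" using energy_lower by blast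
  moreover have "0 < \<bar>det A\<bar> ^ n / V" using \<open>V > 0\<close> det_A_nonzero by simp
  ultimately show ?thesis by linarith
qed

text \<open>Here \<open>\<mu>\<close> is dominated by Lebesgue measure, so each cell has mass at
  most \<open>|det A|^n\<close> and the energy matches its general lower bound up to a constant.
  Division by the negative \<open>ln |det A|\<close> reverses the inequalities.\<close>

lemma (in integral_self_affine) vanishing_imp_dimension:
  assumes zero: "\<And>k. k \<in> integer_lattice \<Longrightarrow> k \<noteq> 0 \<Longrightarrow> ft k = 0"
  shows "LAq_dimension A \<mu> 2 = ereal (real CARD('n))"
proof -
  let ?d = "real CARD('n)" and ?L = "ln \<bar>det A\<bar>"
  have L: "?L < 0" using abs_det_less_1 det_A_nonzero by simp
  have upper: "energy n \<le> \<bar>det A\<bar> ^ n" for n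
  proof -
    have "mass n z \<le> \<bar>det A\<bar> ^ n" for z
      using emeasure_le_lborel[OF prob_space_axioms sets_mu zero cell_measurable, of n z]
      by (simp add: mass_def emeasure_eq_measure emeasure_cell)
    then have "energy n \<le> (\<Sum>z\<in>charged n. \<bar>det A\<bar> ^ n * mass n z)"
      unfolding energy_def by (intro sum_mono) (simp add: power2_eq_square mult_right_mono mass_nonneg)
    also have "\<dots> = \<bar>det A\<bar> ^ n" by (simp add: sum_mass flip: sum_distrib_left)
    finally show ?thesis .
  qed
  obtain V where V: "V > 0" "\<And>n. \<bar>det A\<bar> ^ n / V \<le> energy n" using energy_lower by blast
  have "(\<lambda>n. ?d / (real n * ?L) * ln (energy n)) \<longlonglongrightarrow> ?d"
  proof (rule tendsto_sandwich)
    show "\<forall>\<^sub>F n in sequentially. ?d \<le> ?d / (real n * ?L) * ln (energy n)"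
    proof (rule eventually_mono[OF eventually_gt_at_top[of 0]])
      \<comment> \<open>At \<open>n = 0\<close> the quotient is 0 by the convention for division,
        hence the restriction to positive \<open>n\<close>.\<close>
      fix n :: nat assume n: "0 < n"
      have "ln (energy n) \<le> ln (\<bar>det A\<bar> ^ n)" using upper[of n] energy_pos[of n] det_A_nonzero by (subst ln_le_cancel_iff) auto
      also have "\<dots> = real n * ?L" using det_A_nonzero by (simp add: ln_realpow)
      finally have "?d / (real n * ?L) * (real n * ?L) \<le> ?d / (real n * ?L) * ln (energy n)"
        using n L by (intro mult_left_mono_neg) (auto simp: divide_le_0_iff mult_nonneg_nonpos)
      then show "?d \<le> ?d / (real n * ?L) * ln (energy n)" using n L by simp
    qed
    show "\<forall>\<^sub>F n in sequentially. ?d / (real n * ?L) * ln (energy n) \<le> ?d - ?d * ln V / ?L * inverse (real n)"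
    proof (rule eventually_mono[OF eventually_gt_at_top[of 0]])
      fix n :: nat assume n: "0 < n"
      have pos: "0 < \<bar>det A\<bar> ^ n" using det_A_nonzero by simp
      have "real n * ?L - ln V = ln (\<bar>det A\<bar> ^ n / V)"
        using V(1) pos det_A_nonzero by (simp add: ln_div ln_realpow)
      also have "\<dots> \<le> ln (energy n)" using V pos energy_pos[of n] by simp
      finally have "?d / (real n * ?L) * ln (energy n) \<le> ?d / (real n * ?L) * (real n * ?L - ln V)"
        using n L by (intro mult_left_mono_neg) (auto simp: divide_le_0_iff mult_nonneg_nonpos)
      also have "\<dots> = ?d - ?d * ln V / ?L * inverse (real n)"
        using n L by (simp add: field_simps)
      finally show "?d / (real n * ?L) * ln (energy n) \<le> ?d - ?d * ln V / ?L * inverse (real n)" .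
    qed
    have "(\<lambda>n. ?d - ?d * ln V / ?L * inverse (real n)) \<longlonglongrightarrow> ?d - ?d * ln V / ?L * 0"
      by (intro tendsto_diff tendsto_mult tendsto_const lim_inverse_n)
    then show "(\<lambda>n. ?d - ?d * ln V / ?L * inverse (real n)) \<longlonglongrightarrow> ?d" by simp
  qed simp
  then have "(\<lambda>n. ereal (?d / (real n * ?L) * ln (energy n))) \<longlonglongrightarrow> ereal ?d" by simp
  then show ?thesis unfolding LAq_dimension_energy by (intro lim_imp_Liminf) auto
qed

text \<open>Bessel's inequality is applied to the density of the convolution of \<open>\<mu>\<close> with the normalised
  Lebesgue measure on \<open>A\<^sup>n[0,1)\<^sup>d\<close>, whose Fourier coefficients are multiples of those of \<open>\<mu>\<close>.\<close>

lemma (in integral_self_affine) sum_coefficients_le_energy: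
  "\<exists>C \<delta>. 0 < C \<and> 0 < \<delta> \<and> (\<forall>n K. finite K \<longrightarrow> K \<subseteq> integer_lattice \<longrightarrow>
    (\<forall>k\<in>K. norm (((*v) trA ^^ n) k) \<le> \<delta>) \<longrightarrow> (\<Sum>k\<in>K. (cmod (ft k))\<^sup>2) * \<bar>det A\<bar> ^ n \<le> C * energy n)"
proof -
  obtain c where c: "0 < c" "\<And>n z x y. x \<in> cell n z \<Longrightarrow> y \<in> cell n z \<Longrightarrow> norm (x - y) \<le> c"
    by (rule cell_diameter) blast
  \<comment> \<open>The convolution lives in the cube of half-side \<open>L\<close>; an integer side
    makes the lattice characters orthogonal on it.\<close>
  obtain L :: nat where L: "support_radius + c < real L" using reals_Archimedean2 by blast
  define a0 :: "real^'n" where "a0 = - (real L *\<^sub>R One)"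
  define Cube where "Cube = cbox a0 (a0 + real (2 * L) *\<^sub>R One)"
  have [measurable]: "Cube \<in> sets borel" by (simp add: Cube_def)
  have Cube_fin: "emeasure lborel Cube < \<infinity>" unfolding Cube_def by (rule emeasure_lborel_cbox_finite)
  define V where "V = measure lborel Cube"
  have in_Cube: "x \<in> Cube" if "norm x \<le> support_radius + c" for x
  proof -
    have "- real L \<le> x \<bullet> b" "x \<bullet> b \<le> real L" if "b \<in> Basis" for b
      using Basis_le_norm[OF that, of x] \<open>norm x \<le> support_radius + c\<close> L by linarith+
    then show ?thesis by (simp add: Cube_def a0_def mem_box inner_simps)
  qed
  have L0: "0 < real L" using L support_radius(1) c(1) by linarith
  have "0 < V"
  proof -
    have "0 < measure lborel (cbox a0 (a0 + real (2 * L) *\<^sub>R One))"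
      using L0 by (subst content_pos_lt_eq) (auto simp: inner_add_left)
    then show ?thesis by (simp add: V_def Cube_def)
  qed
  define M where "M = restrict_space lborel Cube"
  have int_M: "integral\<^sup>L M h = (LINT x|lborel. indicat_real Cube x *\<^sub>R h x)" for h :: "real^'n \<Rightarrow> 'b::{banach,second_countable_topology}"
    unfolding M_def by (rule integral_restrict_space) simp
  have M_fin: "finite_measure M"
    by (rule finite_measureI) (use Cube_fin in \<open>simp add: M_def space_restrict_space emeasure_restrict_space\<close>)
  have M_meas: "h \<in> borel_measurable M" if "h \<in> borel_measurable borel" for h :: "real^'n \<Rightarrow> 'b::topological_space"
    unfolding M_def by (rule measurable_restrict_space1) (use that in simp)
  have orth: "(LINT x|M. character k x * cnj (character j x)) = (if k = j then of_real V else 0)"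
    if "k \<in> integer_lattice" "j \<in> integer_lattice" for k j
  proof -
    have kj: "character k x * cnj (character j x) = character (k - j) x" for x
      by (simp add: cnj_character flip: character_add_left)
    show ?thesis
    proof (cases "k = j")
      case True
      have "(LINT x|lborel. indicat_real Cube x *\<^sub>R (1::complex)) = of_real V"
        using Cube_fin by (simp add: V_def scaleR_conv_of_real)
      then show ?thesis unfolding kj int_M using True by simp
    next
      case False
      have "(LINT x|lborel. indicat_real Cube x *\<^sub>R character (k - j) x) = 0"
        unfolding Cube_def using that False by (intro integral_character_cube integer_lattice_diff) auto
      then show ?thesis unfolding kj int_M using False by simp
    qed
  qed
  \<comment> \<open>The possible differences between the integer parts of two vectors whose
    difference lies in the unit cell.\<close>
  define E where "E = {e \<in> integer_lattice. \<forall>i. e $ i = 0 \<or> e $ i = (1::real)} \<inter> (UNIV :: (real^'n) set)"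
  have finE: "finite E"
  proof (rule finite_subset[OF _ finite_lattice_ball])
    show "E \<subseteq> {z \<in> integer_lattice. norm z \<le> real CARD('n)}"
    proof
      fix e assume e: "e \<in> E"
      have "norm e \<le> (\<Sum>i\<in>UNIV. \<bar>e $ i\<bar>)" by (rule norm_le_l1_cart)
      also have "\<dots> \<le> (\<Sum>i\<in>(UNIV::'n set). 1)"
      proof (rule sum_mono)
        fix i show "\<bar>e $ i\<bar> \<le> 1" using e by (cases "e $ i = 0") (auto simp: E_def)
      qed
      finally show "e \<in> {z \<in> integer_lattice. norm z \<le> real CARD('n)}" using e by (simp add: E_def)
    qed
  qed
  define \<epsilon> where "\<epsilon> = real (card E)"
  \<comment> \<open>Gives \<open>2 * pi * (\<delta> * CARD('n)) = 1 / 2\<close>: a character of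
    frequency at most \<open>\<delta>\<close> differs from 1 by at most 1/2 on the unit
    cell.\<close>
  define \<delta> where "\<delta> = 1 / (4 * pi * real CARD('n))"
  have \<delta>: "0 < \<delta>" by (simp add: \<delta>_def)
  have main: "(\<Sum>k\<in>K. (cmod (ft k))\<^sup>2) * \<bar>det A\<bar> ^ n \<le> (4 * V * \<epsilon>\<^sup>2 + 1) * energy n"
    if K: "finite K" "K \<subseteq> integer_lattice" "\<And>k. k \<in> K \<Longrightarrow> norm (((*v) trA ^^ n) k) \<le> \<delta>" for n K
  proof -
    define \<Delta> where "\<Delta> = \<bar>det A\<bar> ^ n"
    have \<Delta>: "0 < \<Delta>" using det_A_nonzero by (simp add: \<Delta>_def)
    define c0 where "c0 = cell n 0"
    have [measurable]: "c0 \<in> sets borel" by (simp add: c0_def)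
    have c0_0: "0 \<in> c0"
      unfolding c0_def mem_cell linear_0[OF linear_funpow_matrix] by simp
    have c0_norm: "norm x \<le> c" if "x \<in> c0" for x
      using c(2)[of x n 0 0] that c0_0 by (simp add: c0_def)
    \<comment> \<open>The density of the convolution, multiplied by \<open>\<Delta>\<close>.\<close>
    define g where "g x = measure \<mu> {y. x - y \<in> c0}" for x
    have g_int: "g x = (LINT y|\<mu>. indicat_real c0 (x - y))" for x
    proof -
      have "(\<lambda>y. indicat_real c0 (x - y)) = indicat_real {y. x - y \<in> c0}" by (auto simp: indicator_def)
      moreover have "{y. x - y \<in> c0} \<in> sets \<mu>" unfolding sets_mu by measurable
      ultimately show ?thesis by (simp add: g_def)
    qed
    have gm[measurable]: "g \<in> borel_measurable borel"
      unfolding g_int[abs_def] by measurable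
    have g01: "0 \<le> g x" "g x \<le> 1" for x by (auto simp: g_def)
    have g_off: "g x = 0" if "x \<notin> Cube" for x
    proof -
      have "AE y in \<mu>. indicat_real c0 (x - y) = 0"
        using support_radius(2)
      proof eventually_elim
        fix y :: "real^'n" assume y: "norm y \<le> support_radius"
        show "indicat_real c0 (x - y) = 0"
        proof (rule ccontr)
          assume "indicat_real c0 (x - y) \<noteq> 0"
          then have "norm (x - y) \<le> c" by (intro c0_norm) (auto simp: indicator_def split: if_splits)
          then have "norm x \<le> support_radius + c" using y norm_triangle_ineq[of "x - y" y] by simp
          with in_Cube that show False by blast
        qed
      qed
      then show ?thesis unfolding g_int by (rule integral_eq_zero_AE)
    qed
    have Cube_int: "integrable lborel (indicat_real Cube)" using Cube_fin by (intro integrable_real_indicator) auto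
    have g_integrable: "integrable lborel g"
    proof (rule Bochner_Integration.integrable_bound[OF Cube_int])
      show "AE x in lborel. norm (g x) \<le> norm (indicat_real Cube x)"
        using g01 g_off by (intro AE_I2) (auto simp: indicator_def)
    qed simp
    define w where "w k = (LINT x|lborel. of_real (indicat_real c0 x) * character k x)" for k
    have coeff: "(LINT x|M. of_real (g x) * character k x) = ft k * w k" for k
    proof -
      interpret pair_sigma_finite lborel \<mu> ..
      define h where "h x y = complex_of_real (indicat_real c0 (x - y)) * character k x" for x y
      have hm: "case_prod h \<in> borel_measurable (lborel \<Otimes>\<^sub>M \<mu>)" unfolding h_def by measurable
      have h_int: "integrable (lborel \<Otimes>\<^sub>M \<mu>) (case_prod h)"
      proof (rule Fubini_integrable[OF hm])
        show "integrable lborel (\<lambda>x. LINT y|\<mu>. norm (case_prod h (x, y)))"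
          using g_integrable unfolding g_int[abs_def] by (simp add: h_def norm_mult)
        show "AE x in lborel. integrable \<mu> (\<lambda>y. case_prod h (x, y))"
        proof (intro AE_I2)
          fix x
          have "(\<lambda>y. case_prod h (x, y)) \<in> borel_measurable \<mu>" unfolding h_def prod.case by measurable
          then show "integrable \<mu> (\<lambda>y. case_prod h (x, y))"
            by (rule integrable_const_bound[where B = 1, rotated]) (auto simp: h_def norm_mult indicator_def)
        qed
      qed
      have "(LINT x|M. of_real (g x) * character k x) = (LINT x|lborel. of_real (g x) * character k x)"
        unfolding int_M using g_off by (intro Bochner_Integration.integral_cong refl) (auto simp: indicator_def)
      also have "\<dots> = (LINT x|lborel. (LINT y|\<mu>. h x y))"
        unfolding g_int h_def by (simp flip: integral_complex_of_real)
      also have "\<dots> = (LINT y|\<mu>. (LINT x|lborel. h x y))"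
        by (rule Fubini_integral[OF h_int, symmetric])
      also have "\<dots> = (LINT y|\<mu>. character k y * w k)"
      proof (intro Bochner_Integration.integral_cong refl)
        fix y
        have "(LINT x|lborel. h x y) = (LINT x|lborel. h (x + y) y)"
          by (rule integral_translate[symmetric]) (simp add: h_def)
        also have "\<dots> = (LINT x|lborel. character k y * (of_real (indicat_real c0 x) * character k x))"
          by (simp add: h_def character_add_right mult_ac)
        also have "\<dots> = character k y * w k" unfolding w_def by simp
        finally show "(LINT x|lborel. h x y) = character k y * w k" .
      qed
      also have "\<dots> = ft k * w k" by (simp add: fourier_transform_character)
      finally show ?thesis .
    qed
    have c0_int: "integrable lborel (indicat_real c0)" unfolding c0_def by (rule integrable_cell)
    \<comment> \<open>On \<open>c0\<close> the character at \<open>k\<close> is within 1/2 of 1, by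
      the choice of \<open>\<delta>\<close>, so integrating it over \<open>c0\<close> loses at most
      half of the volume \<open>\<Delta>\<close>.\<close>
    have w_ge: "\<Delta> / 2 \<le> cmod (w k)" if k: "k \<in> K" for k
    proof -
      have ci: "integrable lborel (\<lambda>x. complex_of_real (indicat_real c0 x))" using c0_int by (simp only: complex_of_real_integrable_eq)
      have wi: "integrable lborel (\<lambda>x. of_real (indicat_real c0 x) * character k x)"
        by (rule Bochner_Integration.integrable_bound[OF ci]) (auto simp: norm_mult)
      have "(LINT x|lborel. indicat_real c0 x) = \<Delta>"
        by (simp add: c0_def measure_cell \<Delta>_def)
      then have "w k - of_real \<Delta> = w k - (LINT x|lborel. complex_of_real (indicat_real c0 x))"
        by (simp only: integral_complex_of_real)
      also have "\<dots> = (LINT x|lborel. of_real (indicat_real c0 x) * character k x - of_real (indicat_real c0 x))"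
        unfolding w_def using wi ci by (rule Bochner_Integration.integral_diff[symmetric])
      also have "cmod \<dots> \<le> (LINT x|lborel. cmod (of_real (indicat_real c0 x) * character k x - of_real (indicat_real c0 x)))"
        by (rule integral_norm_bound)
      also have "\<dots> \<le> (LINT x|lborel. indicat_real c0 x * (1 / 2))"
      proof (rule integral_mono')
        show "integrable lborel (\<lambda>x. indicat_real c0 x * (1 / 2))" using c0_int by auto
        show "cmod (of_real (indicat_real c0 x) * character k x - of_real (indicat_real c0 x)) \<le> indicat_real c0 x * (1 / 2)" for x
        proof (cases "x \<in> c0")
          case True
          then obtain u where u: "u \<in> unit_cell" "x = ((*v) A ^^ n) u" by (auto simp: c0_def cell_def)
          have "cmod (character k x - 1) = cmod (character (((*v) trA ^^ n) k) u - 1)"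
            by (simp add: character_def u(2) inner_trA_pow)
          also have "\<dots> \<le> 2 * pi * (norm (((*v) trA ^^ n) k) * norm u)" by (rule norm_character_diff_1_le)
          also have "\<dots> \<le> 2 * pi * (\<delta> * real CARD('n))"
            using K(3)[OF k] norm_unit_cell[OF u(1)] \<delta> by (intro mult_left_mono mult_mono) auto
          also have "\<dots> = 1 / 2" by (simp add: \<delta>_def)
          finally show ?thesis using True by simp
        qed simp
      qed simp
      also have "\<dots> = \<Delta> / 2" by (simp add: c0_def measure_cell \<Delta>_def)
      finally have "cmod (w k - of_real \<Delta>) \<le> \<Delta> / 2" .
      moreover have "\<Delta> \<le> cmod (w k) + cmod (w k - of_real \<Delta>)"
        using norm_triangle_ineq4[of "w k" "w k - of_real \<Delta>"] \<Delta> by simp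
      ultimately show ?thesis by linarith
    qed
    \<comment> \<open>Up to the factor \<open>\<epsilon>\<close> a majorant of the square of
      \<open>g\<close>: for \<open>x\<close> in the cell of \<open>v\<close>, the points
      \<open>y\<close> with \<open>x - y\<close> in \<open>c0\<close> lie in the cells of
      \<open>v - e\<close> with \<open>e\<close> in \<open>E\<close>, so \<open>g x\<close> is at
      most a sum of \<open>card E\<close> masses.\<close>
    define H where "H x = (\<Sum>e\<in>E. \<Sum>z\<in>charged n. (mass n z)\<^sup>2 * indicat_real (cell n (z + e)) x)" for x
    have H_int: "integrable lborel H"
      unfolding H_def by (intro Bochner_Integration.integrable_sum integrable_mult_right integrable_cell)
    have H_val: "integral\<^sup>L lborel H = \<epsilon> * \<Delta> * energy n"
    proof -
      have "integral\<^sup>L lborel H = (\<Sum>e\<in>E. \<Sum>z\<in>charged n. (mass n z)\<^sup>2 * \<Delta>)"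
        unfolding H_def
        by (subst Bochner_Integration.integral_sum; (intro Bochner_Integration.integrable_sum integrable_mult_right integrable_cell)?)
          (simp add: Bochner_Integration.integral_sum integrable_cell measure_cell \<Delta>_def)
      then show ?thesis by (simp add: energy_def \<epsilon>_def sum_distrib_left mult_ac)
    qed
    have H0: "0 \<le> H x" for x unfolding H_def by (intro sum_nonneg) auto
    have g_H: "(g x)\<^sup>2 \<le> \<epsilon> * H x" for x
    proof -
      obtain v where v: "v \<in> integer_lattice" "x \<in> cell n v" by (rule lattice_point)
      have "{y. x - y \<in> c0} \<subseteq> (\<Union>e\<in>E. cell n (v - e))"
      proof
        fix y assume "y \<in> {y. x - y \<in> c0}"
        then have xy: "x - y \<in> cell n 0" by (simp add: c0_def)
        obtain u where u: "u \<in> integer_lattice" "y \<in> cell n u" by (rule lattice_point)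
        have "(v - u) $ i = 0 \<or> (v - u) $ i = 1" for i
        proof -
          obtain j k where jk: "v $ i = real_of_int j" "u $ i = real_of_int k"
            using v(1) u(1) by (auto simp: integer_lattice_def elim!: Ints_cases) (metis Ints_cases)
          let ?x = "(((*v) invA ^^ n) x) $ i" and ?y = "(((*v) invA ^^ n) y) $ i"
          have "0 \<le> ?x - ?y" "?x - ?y < 1"
            using xy[unfolded mem_cell linear_diff[OF linear_funpow_matrix]] by auto
          moreover have "v $ i \<le> ?x" "?x < v $ i + 1" "u $ i \<le> ?y" "?y < u $ i + 1"
            using v(2) u(2) by (auto simp: mem_cell)
          ultimately have "j - k = 0 \<or> j - k = 1" using jk by linarith
          then show ?thesis using jk by (auto simp flip: of_int_diff)
        qed
        then have "v - u \<in> E" using v u by (simp add: E_def integer_lattice_diff del: vector_minus_component)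
        moreover have "u = v - (v - u)" by simp
        ultimately show "y \<in> (\<Union>e\<in>E. cell n (v - e))" using u(2) by (metis UN_I)
      qed
      then have "g x \<le> measure \<mu> (\<Union>e\<in>E. cell n (v - e))"
        unfolding g_def using finE by (intro finite_measure_mono) (auto simp: sets_mu)
      also have "\<dots> \<le> (\<Sum>e\<in>E. mass n (v - e))"
        unfolding mass_def using finE by (intro finite_measure_subadditive_finite) (auto simp: sets_mu)
      finally have gE: "g x \<le> (\<Sum>e\<in>E. mass n (v - e))" .
      have "(g x)\<^sup>2 \<le> (\<Sum>e\<in>E. mass n (v - e))\<^sup>2" using gE g01 by (intro power_mono)
      also have "\<dots> \<le> \<epsilon> * (\<Sum>e\<in>E. (mass n (v - e))\<^sup>2)"
        unfolding \<epsilon>_def using sum_squared_le_sum_of_squares[of "\<lambda>e. mass n (v - e)" E] by (simp add: mult.commute)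
      also have "\<dots> \<le> \<epsilon> * H x"
        unfolding H_def
      proof (intro mult_left_mono sum_mono)
        fix e assume e: "e \<in> E"
        show "(mass n (v - e))\<^sup>2 \<le> (\<Sum>z\<in>charged n. (mass n z)\<^sup>2 * indicat_real (cell n (z + e)) x)"
        proof (cases "v - e \<in> charged n")
          case True
          have "(mass n (v - e))\<^sup>2 = (mass n (v - e))\<^sup>2 * indicat_real (cell n (v - e + e)) x" using v(2) by simp
          also have "\<dots> \<le> (\<Sum>z\<in>charged n. (mass n z)\<^sup>2 * indicat_real (cell n (z + e)) x)"
            using True finite_charged by (intro member_le_sum) auto
          finally show ?thesis .
        next
          case False
          moreover have "v - e \<in> integer_lattice" using v e by (intro integer_lattice_diff) (auto simp: E_def)
          ultimately show ?thesis by (simp add: mass_uncharged sum_nonneg)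
        qed
      qed (simp add: \<epsilon>_def)
      finally show ?thesis .
    qed
    have "(\<Sum>k\<in>K. (cmod (ft k))\<^sup>2) * (\<Delta> / 2)\<^sup>2 \<le> (\<Sum>k\<in>K. (cmod (ft k * w k))\<^sup>2)"
      unfolding sum_distrib_right norm_mult power_mult_distrib
      using w_ge \<Delta> by (intro sum_mono mult_left_mono power_mono) auto
    also have "\<dots> \<le> V * (LINT x|M. (g x)\<^sup>2)"
      unfolding coeff[symmetric]
    proof (rule bessel_inequality[OF M_fin K(1) \<open>0 < V\<close>, where B = 1])
      show "\<And>k j. k \<in> K \<Longrightarrow> j \<in> K \<Longrightarrow> (LINT x|M. character k x * cnj (character j x)) = (if k = j then of_real V else 0)"
        using orth K(2) by blast
    qed (use g01 in \<open>auto intro!: M_meas simp: abs_le_iff order.trans[OF _ g01(1)]\<close>)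
    also have "\<dots> \<le> V * (LINT x|lborel. \<epsilon> * H x)"
    proof (rule mult_left_mono)
      show "(LINT x|M. (g x)\<^sup>2) \<le> (LINT x|lborel. \<epsilon> * H x)"
        unfolding int_M
      proof (rule integral_mono')
        show "integrable lborel (\<lambda>x. \<epsilon> * H x)" using H_int by auto
        show "indicat_real Cube x *\<^sub>R (g x)\<^sup>2 \<le> \<epsilon> * H x" for x
          using g_H[of x] H0[of x] by (auto simp: indicator_def \<epsilon>_def)
        show "0 \<le> \<epsilon> * H x" for x using H0[of x] by (simp add: \<epsilon>_def)
      qed
    qed (use \<open>0 < V\<close> in simp)
    also have "\<dots> = V * (\<epsilon> * (\<epsilon> * \<Delta> * energy n))" by (simp add: H_val)
    finally have "((\<Sum>k\<in>K. (cmod (ft k))\<^sup>2) * \<Delta>) * \<Delta> \<le> (4 * V * \<epsilon>\<^sup>2 * energy n) * \<Delta>"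
      by (simp add: power2_eq_square field_simps)
    then have "(\<Sum>k\<in>K. (cmod (ft k))\<^sup>2) * \<Delta> \<le> 4 * V * \<epsilon>\<^sup>2 * energy n" using \<Delta> by simp
    then show ?thesis using energy_pos[of n] by (simp add: \<Delta>_def algebra_simps)
  qed
  show ?thesis
  proof (intro exI conjI allI impI)
    show "0 < 4 * V * \<epsilon>\<^sup>2 + 1" using \<open>0 < V\<close> by (intro add_nonneg_pos) auto
    show "0 < \<delta>" by (rule \<delta>)
    fix n K assume "finite K" "K \<subseteq> integer_lattice" "\<forall>k\<in>K. norm (((*v) trA ^^ n) k) \<le> \<delta>"
    then show "(\<Sum>k\<in>K. (cmod (ft k))\<^sup>2) * \<bar>det A\<bar> ^ n \<le> (4 * V * \<epsilon>\<^sup>2 + 1) * energy n"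
      by (intro main) auto
  qed
qed

section \<open>Lattice points with large Fourier coefficients\<close>

lemma lattice_norm_ge_1:
  assumes "k \<in> integer_lattice" "k \<noteq> 0"
  shows "1 \<le> norm (k :: real^'n)"
proof -
  obtain i where i: "k $ i \<noteq> 0" using assms by (auto simp: vec_eq_iff)
  have "1 \<le> \<bar>k $ i\<bar>" using assms(1) i by (intro Ints_nonzero_abs_ge1) (auto simp: integer_lattice_def)
  also have "\<dots> \<le> norm k" by (rule component_le_norm_cart)
  finally show ?thesis .
qed

text \<open>If \<open>ft k\<^sub>0 \<noteq> 0\<close>, then \<open>|ft|\<close> is not small at the lattice points \<open>\<Sum>\<^sub>i \<epsilon>\<^sub>i M\<^bsup>iN\<^esup> k\<^sub>0\<close> with \<open>\<epsilon>\<^sub>i \<in> {0, 1}\<close>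
  and \<open>M\<close> the inverse transpose of \<open>A\<close>; here \<open>e\<close> accounts for the lower order digits.\<close>

lemma (in integral_self_affine) coefficients_grow:
  assumes k0: "k0 \<in> integer_lattice" "k0 \<noteq> 0" "ft k0 \<noteq> 0" and "0 < \<delta>"
  obtains N \<beta> where "0 < N" "1 < \<beta>" "\<And>j. \<exists>K. finite K \<and> K \<subseteq> integer_lattice \<and>
    (\<forall>k\<in>K. norm (((*v) trA ^^ (N * j)) k) \<le> \<delta>) \<and> \<beta> ^ j / 2 \<le> (\<Sum>k\<in>K. (cmod (ft k))\<^sup>2)"
proof -
  obtain L where L: "0 < L" "\<And>\<xi> \<eta>. cmod (ft (\<xi> + \<eta>) - ft \<xi>) \<le> L * norm \<eta>" by (rule ft_lipschitz) blast
  define c where "c = cmod (ft k0)"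
  have c: "0 < c" "c \<le> 1" using k0 norm_ft_le_1 by (auto simp: c_def)
  \<comment> \<open>Bounds the error caused by lower digits. By the Lipschitz bound such an error
    costs at most \<open>c^2 / 8\<close> in \<open>ft\<close>; the bound \<open>1 / 2\<close> keeps
    \<open>d\<close> below the length of any nonzero lattice vector.\<close>
  define d where "d = min (min \<delta> (1 / 2)) (c\<^sup>2 / 8 / L)"
  have d: "0 < d" "d \<le> \<delta>" "d \<le> 1 / 2" "L * d \<le> c\<^sup>2 / 8"
  proof -
    show "0 < d" "d \<le> \<delta>" "d \<le> 1 / 2" using \<open>0 < \<delta>\<close> c L by (auto simp: d_def)
    have "L * d \<le> L * (c\<^sup>2 / 8 / L)" using L(1) by (intro mult_left_mono) (auto simp: d_def)
    then show "L * d \<le> c\<^sup>2 / 8" using L(1) by simp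
  qed
  \<comment> \<open>\<open>(1 - c^2/8)^2 + (c - c^2/8)^2\<close> is at least this, because
    \<open>c \<le> 1\<close>.\<close>
  define \<beta> where "\<beta> = 1 + c\<^sup>2 / 2"
  have \<beta>: "1 < \<beta>" using c by (simp add: \<beta>_def)
  have c2: "c\<^sup>2 \<le> c" "c\<^sup>2 \<le> 1" using c by (auto simp: power2_eq_square mult_le_one mult_left_le)
  have near: "1 - c\<^sup>2 / 8 \<le> cmod (ft e)" "c - c\<^sup>2 / 8 \<le> cmod (ft (k0 + e))" if e: "norm e \<le> d" for e
  proof -
    have "L * norm e \<le> c\<^sup>2 / 8" using d(4) mult_left_mono[OF e, of L] L(1) by linarith
    then have le: "cmod (ft (\<xi> + e) - ft \<xi>) \<le> c\<^sup>2 / 8" for \<xi> using L(2)[of \<xi> e] by linarith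
    have "cmod (ft \<xi>) \<le> cmod (ft (\<xi> + e)) + cmod (ft (\<xi> + e) - ft \<xi>)" for \<xi>
      using norm_triangle_ineq4[of "ft (\<xi> + e)" "ft (\<xi> + e) - ft \<xi>"] by simp
    from this[of 0] this[of k0] le[of 0] le[of k0]
    show "1 - c\<^sup>2 / 8 \<le> cmod (ft e)" "c - c\<^sup>2 / 8 \<le> cmod (ft (k0 + e))"
      by (simp_all add: ft_0 c_def)
  qed
  have half: "1 / 2 \<le> (cmod (ft e))\<^sup>2" and sum2: "\<beta> \<le> (cmod (ft e))\<^sup>2 + (cmod (ft (k0 + e)))\<^sup>2" if e: "norm e \<le> d" for e
  proof -
    have "(1 - c\<^sup>2 / 8)\<^sup>2 \<le> (cmod (ft e))\<^sup>2" using near(1)[OF e] c2 by (intro power_mono) auto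
    moreover have "(1 - c\<^sup>2 / 8)\<^sup>2 = 1 - c\<^sup>2 / 4 + (c\<^sup>2 / 8)\<^sup>2" by (simp add: power2_diff)
    moreover have "0 \<le> (c\<^sup>2 / 8)\<^sup>2" by simp
    ultimately have 1: "1 - c\<^sup>2 / 4 \<le> (cmod (ft e))\<^sup>2" by linarith
    then show "1 / 2 \<le> (cmod (ft e))\<^sup>2" using c2 by linarith
    have "(c - c\<^sup>2 / 8)\<^sup>2 \<le> (cmod (ft (k0 + e)))\<^sup>2" using near(2)[OF e] c c2 by (intro power_mono) auto
    moreover have "(c - c\<^sup>2 / 8)\<^sup>2 = c\<^sup>2 - c * c\<^sup>2 / 4 + (c\<^sup>2 / 8)\<^sup>2" by (simp add: power2_diff)
    moreover have "c * c\<^sup>2 \<le> 1 * c\<^sup>2" using c by (intro mult_right_mono) auto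
    moreover have "0 \<le> (c\<^sup>2 / 8)\<^sup>2" by simp
    ultimately have "c\<^sup>2 - c\<^sup>2 / 4 \<le> (cmod (ft (k0 + e)))\<^sup>2" by linarith
    with 1 show "\<beta> \<le> (cmod (ft e))\<^sup>2 + (cmod (ft (k0 + e)))\<^sup>2" by (simp add: \<beta>_def)
  qed
  obtain C r where C: "0 < C" "0 < r" "r < 1" "\<And>n x. norm (((*v) trA ^^ n) x) \<le> C * r ^ n * norm x"
    using decay by metis
  have "(\<lambda>n. C * r ^ n * (norm k0 + d)) \<longlonglongrightarrow> C * 0 * (norm k0 + d)"
    by (intro tendsto_mult tendsto_const LIMSEQ_realpow_zero) (use C in auto)
  then have "\<forall>\<^sub>F n in sequentially. C * r ^ n * (norm k0 + d) < d" using d by (intro order_tendstoD) auto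
  then obtain N0 where N0: "\<And>n. n \<ge> N0 \<Longrightarrow> C * r ^ n * (norm k0 + d) < d" by (auto simp: eventually_sequentially)
  \<comment> \<open>Digits are spaced \<open>N\<close> apart so that \<open>trA^N\<close> returns
    both \<open>e\<close> and \<open>k0 + e\<close> to the ball of radius \<open>d\<close>: the
    lower digits together stay a small error.\<close>
  define N where "N = Suc N0"
  have contract: "norm (((*v) trA ^^ N) x) \<le> d" if "norm x \<le> norm k0 + d" for x
  proof -
    have "norm (((*v) trA ^^ N) x) \<le> C * r ^ N * norm x" by (rule C(4))
    also have "\<dots> \<le> C * r ^ N * (norm k0 + d)" using that C by (intro mult_left_mono) auto
    also have "\<dots> \<le> d" using N0[of N] by (simp add: N_def)
    finally show ?thesis .
  qed
  define T where "T = ((*v) trB ^^ N)"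
  have T_inj: "inj T" unfolding T_def by (rule inj_on_inverseI[where g = "(*v) trA ^^ N"]) (simp add: trA_trB_pow)
  have T_lattice: "T k \<in> integer_lattice" if "k \<in> integer_lattice" for k
    unfolding T_def by (rule trB_pow_lattice[OF that])
  have T_lin: "T (x - y) = T x - T y" for x y unfolding T_def by (rule linear_diff[OF linear_funpow_matrix])
  \<comment> \<open>This keeps the points with lowest digit 0 and 1 apart. A \<open>k\<close> with
    \<open>T k = k0\<close> would be a nonzero lattice vector of norm at most \<open>d\<close>,
    which is below 1.\<close>
  have k0_T: "k0 \<noteq> T k" if "k \<in> integer_lattice" for k
  proof
    assume eq: "k0 = T k"
    then have "k \<noteq> 0" using k0 linear_0[OF linear_funpow_matrix[where A = trB and n = N]] by (auto simp: T_def)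
    then have "1 \<le> norm k" using that lattice_norm_ge_1 by blast
    moreover have "k = ((*v) trA ^^ N) k0" by (simp add: eq T_def trA_trB_pow)
    then have "norm k \<le> d" using contract[of k0] d(1) by simp
    ultimately show False using d(3) by linarith
  qed
  \<comment> \<open>Uniform in the error \<open>e\<close>, because the induction inserts a new
    lowest digit: with \<open>x = e\<close> or \<open>x = k0 + e\<close>, the point
    \<open>x + T k\<close> reduces by \<open>norm_ft_shift_ge\<close> to the previous stage with
    error \<open>trA^N x\<close>. The factor 1/2 bounds \<open>|ft e|^2\<close> from below at
    \<open>j = 0\<close>.\<close>
  have digits: "\<exists>K. finite K \<and> K \<subseteq> integer_lattice \<and> (\<forall>e. norm e \<le> d \<longrightarrow> \<beta> ^ j / 2 \<le> (\<Sum>k\<in>K. (cmod (ft (e + k)))\<^sup>2) \<and>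
    (\<forall>k\<in>K. norm (((*v) trA ^^ (N * j)) (e + k)) \<le> d))" for j
  proof (induction j)
    case 0
    show ?case using half by (intro exI[of _ "{0}"]) (auto simp: integer_lattice_0)
  next
    case (Suc j)
    then obtain K where K: "finite K" "K \<subseteq> integer_lattice"
      "\<And>e. norm e \<le> d \<Longrightarrow> \<beta> ^ j / 2 \<le> (\<Sum>k\<in>K. (cmod (ft (e + k)))\<^sup>2)"
      "\<And>e k. norm e \<le> d \<Longrightarrow> k \<in> K \<Longrightarrow> norm (((*v) trA ^^ (N * j)) (e + k)) \<le> d" by blast
    define K' where "K' = T ` K \<union> (\<lambda>k. k0 + T k) ` K"
    have K': "finite K'" "K' \<subseteq> integer_lattice"
      using K k0 by (auto simp: K'_def intro!: T_lattice integer_lattice_add)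
    have disj: "T ` K \<inter> (\<lambda>k. k0 + T k) ` K = {}"
    proof (rule ccontr)
      assume "T ` K \<inter> (\<lambda>k. k0 + T k) ` K \<noteq> {}"
      then obtain k k' where "k \<in> K" "k' \<in> K" "T k = k0 + T k'" by auto
      then have "k0 = T (k - k')" by (simp add: T_lin)
      moreover have "k - k' \<in> integer_lattice" using \<open>k \<in> K\<close> \<open>k' \<in> K\<close> K(2) by (intro integer_lattice_diff) auto
      ultimately show False using k0_T by blast
    qed
    have split: "(\<Sum>k\<in>K'. F k) = (\<Sum>k\<in>K. F (T k)) + (\<Sum>k\<in>K. F (k0 + T k))" for F :: "real^'n \<Rightarrow> real"
    proof -
      have "(\<Sum>k\<in>K'. F k) = (\<Sum>k\<in>T ` K. F k) + (\<Sum>k\<in>(\<lambda>k. k0 + T k) ` K. F k)"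
        unfolding K'_def using K(1) disj by (intro sum.union_disjoint) auto
      moreover have "inj_on T K" "inj_on (\<lambda>k. k0 + T k) K" using T_inj by (auto simp: inj_on_def)
      ultimately show ?thesis by (simp add: sum.reindex)
    qed
    have lower: "(cmod (ft x))\<^sup>2 * (\<beta> ^ j / 2) \<le> (\<Sum>k\<in>K. (cmod (ft (x + T k)))\<^sup>2)" if x: "norm x \<le> norm k0 + d" for x
    proof -
      have "(cmod (ft x))\<^sup>2 * (\<beta> ^ j / 2) \<le> (cmod (ft x))\<^sup>2 * (\<Sum>k\<in>K. (cmod (ft (((*v) trA ^^ N) x + k)))\<^sup>2)"
        using K(3)[OF contract[OF x]] by (intro mult_left_mono) auto
      also have "\<dots> = (\<Sum>k\<in>K. (cmod (ft x) * cmod (ft (((*v) trA ^^ N) x + k)))\<^sup>2)"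
        by (simp add: sum_distrib_left power_mult_distrib)
      also have "\<dots> \<le> (\<Sum>k\<in>K. (cmod (ft (x + T k)))\<^sup>2)"
        unfolding T_def using K(2) by (intro sum_mono power_mono norm_ft_shift_ge) auto
      finally show ?thesis .
    qed
    have "\<beta> ^ Suc j / 2 \<le> (\<Sum>k\<in>K'. (cmod (ft (e + k)))\<^sup>2) \<and> (\<forall>k\<in>K'. norm (((*v) trA ^^ (N * Suc j)) (e + k)) \<le> d)"
      if e: "norm e \<le> d" for e
    proof
      have e': "norm e \<le> norm k0 + d" "norm (k0 + e) \<le> norm k0 + d"
        using e norm_triangle_ineq[of k0 e] norm_ge_zero[of k0] by linarith+
      have "\<beta> ^ Suc j / 2 = \<beta> * (\<beta> ^ j / 2)" by simp
      also have "\<dots> \<le> ((cmod (ft e))\<^sup>2 + (cmod (ft (k0 + e)))\<^sup>2) * (\<beta> ^ j / 2)"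
        using sum2[OF e] \<beta> by (intro mult_right_mono) auto
      also have "\<dots> \<le> (\<Sum>k\<in>K. (cmod (ft (e + T k)))\<^sup>2) + (\<Sum>k\<in>K. (cmod (ft (k0 + e + T k)))\<^sup>2)"
        using lower[OF e'(1)] lower[OF e'(2)] by (simp add: ring_distribs)
      also have "\<dots> = (\<Sum>k\<in>K'. (cmod (ft (e + k)))\<^sup>2)"
        unfolding split by (simp add: add_ac)
      finally show "\<beta> ^ Suc j / 2 \<le> (\<Sum>k\<in>K'. (cmod (ft (e + k)))\<^sup>2)" .
      have norm: "norm (((*v) trA ^^ (N * Suc j)) (x + T k)) \<le> d" if "norm x \<le> norm k0 + d" "k \<in> K" for x k
      proof -
        have "((*v) trA ^^ (N * Suc j)) (x + T k) = ((*v) trA ^^ (N * j)) (((*v) trA ^^ N) (x + T k))"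
          using funpow_add[of "N * j" N "(*v) trA"] by (simp add: add.commute)
        also have "((*v) trA ^^ N) (x + T k) = ((*v) trA ^^ N) x + k"
          by (simp add: linear_add[OF linear_funpow_matrix] T_def trA_trB_pow)
        finally show ?thesis using K(4)[OF contract[OF that(1)] that(2)] by simp
      qed
      show "\<forall>k\<in>K'. norm (((*v) trA ^^ (N * Suc j)) (e + k)) \<le> d"
        using norm[OF e'(1)] norm[OF e'(2)] by (auto simp: K'_def add_ac)
    qed
    with K' show ?case by blast
  qed
  have "\<exists>K. finite K \<and> K \<subseteq> integer_lattice \<and>
    (\<forall>k\<in>K. norm (((*v) trA ^^ (N * j)) k) \<le> \<delta>) \<and> \<beta> ^ j / 2 \<le> (\<Sum>k\<in>K. (cmod (ft k))\<^sup>2)" for j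
  proof -
    obtain K where K: "finite K" "K \<subseteq> integer_lattice"
      "\<And>e. norm e \<le> d \<Longrightarrow> \<beta> ^ j / 2 \<le> (\<Sum>k\<in>K. (cmod (ft (e + k)))\<^sup>2)"
      "\<And>e k. norm e \<le> d \<Longrightarrow> k \<in> K \<Longrightarrow> norm (((*v) trA ^^ (N * j)) (e + k)) \<le> d"
      using digits[of j] by blast
    have "norm (((*v) trA ^^ (N * j)) k) \<le> \<delta>" if "k \<in> K" for k
      using K(4)[of 0 k] that d(1,2) by simp
    with K(1,2) K(3)[of 0] d(1) show ?thesis by (intro exI[of _ K]) auto
  qed
  moreover have "0 < N" by (simp add: N_def)
  ultimately show thesis using \<beta> that by blast
qed

text \<open>If \<open>ft k \<noteq> 0\<close>, the energy at \<open>N * j\<close> is at least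
  \<open>\<beta>^j |det A|^(N j) / (2 C)\<close>. A subsequence is enough, as the limit inferior of
  a sequence never exceeds that of a subsequence.\<close>

lemma (in integral_self_affine) dimension_imp_vanishing:
  assumes dim: "LAq_dimension A \<mu> 2 = ereal (real CARD('n))" and k: "k \<in> integer_lattice" "k \<noteq> 0"
  shows "ft k = 0"
proof (rule ccontr)
  assume nz: "ft k \<noteq> 0"
  let ?d = "real CARD('n)" and ?L = "ln \<bar>det A\<bar>"
  have L: "?L < 0" using abs_det_less_1 det_A_nonzero by simp
  obtain C \<delta> where C: "0 < C" "0 < \<delta>" and bound: "\<And>n K. finite K \<Longrightarrow> K \<subseteq> integer_lattice \<Longrightarrow>
    (\<forall>k\<in>K. norm (((*v) trA ^^ n) k) \<le> \<delta>) \<Longrightarrow> (\<Sum>k\<in>K. (cmod (ft k))\<^sup>2) * \<bar>det A\<bar> ^ n \<le> C * energy n"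
    using sum_coefficients_le_energy by metis
  obtain N \<beta> where N: "0 < N" "1 < \<beta>" and grow: "\<And>j. \<exists>K. finite K \<and> K \<subseteq> integer_lattice \<and>
    (\<forall>k\<in>K. norm (((*v) trA ^^ (N * j)) k) \<le> \<delta>) \<and> \<beta> ^ j / 2 \<le> (\<Sum>k\<in>K. (cmod (ft k))\<^sup>2)"
    using coefficients_grow[OF k nz C(2)] by metis
  define x where "x n = ?d / (real n * ?L) * ln (energy n)" for n
  \<comment> \<open>As \<open>?L\<close> is negative and \<open>\<beta> > 1\<close>, the limit of
    \<open>y\<close> lies strictly below \<open>?d\<close>.\<close>
  define y where "y j = ?d + ?d * ln \<beta> / (real N * ?L) - ?d * ln (2 * C) / (real N * ?L) * inverse (real j)" for j
  have le: "x (N * j) \<le> y j" if j: "0 < j" for j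
  proof -
    obtain K where K: "finite K" "K \<subseteq> integer_lattice" "\<forall>k\<in>K. norm (((*v) trA ^^ (N * j)) k) \<le> \<delta>"
      "\<beta> ^ j / 2 \<le> (\<Sum>k\<in>K. (cmod (ft k))\<^sup>2)" using grow[of j] by blast
    have pos: "0 < \<bar>det A\<bar> ^ (N * j)" using det_A_nonzero by simp
    have "\<beta> ^ j / 2 * \<bar>det A\<bar> ^ (N * j) \<le> C * energy (N * j)"
      using bound[OF K(1-3)] mult_right_mono[OF K(4), of "\<bar>det A\<bar> ^ (N * j)"] pos by linarith
    then have "\<beta> ^ j * \<bar>det A\<bar> ^ (N * j) / (2 * C) \<le> energy (N * j)" using C(1) by (simp add: field_simps)
    moreover have "0 < \<beta> ^ j * \<bar>det A\<bar> ^ (N * j) / (2 * C)" using N C pos by simp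
    ultimately have "ln (\<beta> ^ j * \<bar>det A\<bar> ^ (N * j) / (2 * C)) \<le> ln (energy (N * j))" by simp
    moreover have "ln (\<beta> ^ j * \<bar>det A\<bar> ^ (N * j) / (2 * C)) = real j * ln \<beta> + real (N * j) * ?L - ln (2 * C)"
    proof -
      have "ln (\<beta> ^ j * \<bar>det A\<bar> ^ (N * j) / (2 * C)) = ln (\<beta> ^ j) + ln (\<bar>det A\<bar> ^ (N * j)) - ln (2 * C)"
        using N(2) C(1) pos by (simp only: ln_div ln_mult zero_less_power mult_pos_pos) (simp add: ln_div ln_mult)
      also have "ln (\<beta> ^ j) = real j * ln \<beta>" using N by (simp add: ln_realpow)
      also have "ln (\<bar>det A\<bar> ^ (N * j)) = real (N * j) * ?L" using det_A_nonzero by (simp add: ln_realpow)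
      finally show ?thesis .
    qed
    ultimately have "real j * ln \<beta> + real (N * j) * ?L - ln (2 * C) \<le> ln (energy (N * j))" by simp
    then have "x (N * j) \<le> ?d / (real (N * j) * ?L) * (real j * ln \<beta> + real (N * j) * ?L - ln (2 * C))"
      unfolding x_def using L N j by (intro mult_left_mono_neg) (auto simp: divide_le_0_iff mult_nonneg_nonpos)
    also have "\<dots> = y j" unfolding y_def using L N(1) j by (simp add: field_simps)
    finally show ?thesis .
  qed
  \<comment> \<open>\<open>Suc j\<close> avoids the index 0, where the quotient is a division by
    zero and \<open>le\<close> says nothing.\<close>
  have mono: "strict_mono (\<lambda>j. N * Suc j)" using N(1) by (intro strict_monoI) simp
  have "(\<lambda>j. y (Suc j)) \<longlonglongrightarrow> ?d + ?d * ln \<beta> / (real N * ?L) - ?d * ln (2 * C) / (real N * ?L) * 0"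
    unfolding y_def by (intro tendsto_diff tendsto_mult tendsto_const LIMSEQ_Suc[OF lim_inverse_n])
  then have lim: "(\<lambda>j. ereal (y (Suc j))) \<longlonglongrightarrow> ereal (?d + ?d * ln \<beta> / (real N * ?L))" by simp
  have "ereal ?d = liminf (\<lambda>n. ereal (x n))" using dim by (simp add: LAq_dimension_energy x_def)
  also have "\<dots> \<le> liminf ((\<lambda>n. ereal (x n)) \<circ> (\<lambda>j. N * Suc j))" by (rule liminf_subseq_mono[OF mono])
  also have "\<dots> \<le> liminf (\<lambda>j. ereal (y (Suc j)))"
    using le by (intro Liminf_mono always_eventually) (simp del: mult_Suc_right)
  also have "\<dots> = ereal (?d + ?d * ln \<beta> / (real N * ?L))" using lim by (intro lim_imp_Liminf) auto
  finally have "0 \<le> ?d * ln \<beta> / (real N * ?L)" by simp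
  moreover have "?d * ln \<beta> / (real N * ?L) < 0"
    using N L by (intro divide_pos_neg mult_pos_pos mult_pos_neg) auto
  ultimately show False by linarith
qed

theorem theorem1p10:
  fixes A :: "real^'n^'n" and m :: nat and a :: "nat \<Rightarrow> real^'n"
    and p :: "nat \<Rightarrow> real" and \<mu> :: "(real^'n) measure"
  assumes "integral_affine_ifs A m a"
    and "affinely_irreducible A m a"
    and "strictly_positive_probability_vector m p"
    and "is_self_affine_measure A m a p \<mu>"
  shows "(absolutely_continuous lborel \<mu> \<longleftrightarrow> power_fourier_decay \<mu>) \<and>
         (power_fourier_decay \<mu> \<longleftrightarrow> LAq_dimension A \<mu> 2 = ereal (real CARD('n)))"
proof -
  interpret integral_self_affine A m a p \<mu> by (rule integral_self_affine.intro) fact+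
  let ?vanishing = "\<forall>k\<in>integer_lattice. k \<noteq> 0 \<longrightarrow> fourier_transform \<mu> k = 0"
  have "power_fourier_decay \<mu>" if ?vanishing
  proof -
    have zero: "\<And>k. k \<in> integer_lattice \<Longrightarrow> k \<noteq> 0 \<Longrightarrow> fourier_transform \<mu> k = 0" using that by blast
    obtain f R where "has_density f R" by (rule vanishing_imp_bounded_density[OF zero])
    then interpret bounded_density A m a p \<mu> f R by unfold_locales
    show ?thesis by (rule power_decay)
  qed
  moreover have "absolutely_continuous lborel \<mu> \<longleftrightarrow> ?vanishing"
    using absolutely_continuous_imp_coefficients_vanish vanishing_imp_absolutely_continuous by blast
  moreover have "power_fourier_decay \<mu> \<Longrightarrow> ?vanishing"
    using power_decay_imp_coefficients_vanish by blast
  moreover have "LAq_dimension A \<mu> 2 = ereal (real CARD('n)) \<longleftrightarrow> ?vanishing"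
    using dimension_imp_vanishing vanishing_imp_dimension by blast
  ultimately show ?thesis by blast
qed

end
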